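(* Let $n\ge1$ be an integer and let $0<a_1<a_2<\dots<a_n$ be real numbers. Let $\Delta_2=\Delta_2(k)$ be the determinant defined in the context, and assume that there exist constants $M>0$ and $\gamma\ge 0$ such that $$|\Delta_2(k)|>\frac{M}{k^{\gamma}}$$ for all $k\in\mathbb N$ with the possible exception of finitely many. Put $\alpha=\gamma$ if $\gamma\in\mathbb N\cup\{0\}$, and $\alpha=[\gamma]+1$ if $0<\gamma\notin\mathbb N$, where $[\gamma]$ is the integer part. Let $\varphi_j,\psi_j\in C^{2n+1+\alpha}[0,1]$ for $j=0,\dots,n-1$, and assume that for all $j=0,\dots,n-1$, all $s=1,\dots,2n+1+\alpha$ and all $k\in\mathbb N$, $$\left.\left(\varphi_j^{(s-1)}(x)\sin\left(\pi kx+\frac{\pi}{2}s\right)\right)\right|_{x=0}^{x=1}=0,\qquad \left.\left(\psi_j^{(s-1)}(x)\sin\left(\pi kx+\frac{\pi}{2}s\right)\right)\right|_{x=0}^{x=1}=0 .$$ For every $k\in\mathbb N$ let $u_k$ be a solution of the one-dimensional problem $(P_k)$ stated in the context. Then the series $$u(x,y)=\sqrt2\sum_{k=1}^\infty u_k(y)\sin \pi kx$$ is a classical solution of the Dirichlet problem with data $\varphi_s,\psi_s$ (defined in the context).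
   Context: Setting. $\mathbb N=\{1,2,\dots\}$, $\Omega=\{(x,y):0<x<1,\,-1<y<1\}$, $\Omega_+=\Omega\cap\{y>0\}$, $\Omega_-=\Omega\cap\{y<0\}$, and $$Lu=\left\{\prod_{j=1}^n\left(a_j^2\frac{\partial^2}{\partial x^2}+\operatorname{sgn}(y)\frac{\partial^2}{\partial y^2}\right)\right\}u .$$ Dirichlet problem: find a function $u$ (a classical solution) such that (i) $u\in C^{2n-1}(\overline\Omega)\cap C^{2n}(\Omega_+\cup\Omega_-)$; (ii) $Lu(x,y)=0$ for $(x,y)\in\Omega_+\cup\Omega_-$; (iii) $D_x^{2s}u(0,y)=D_x^{2s}u(1,y)=0$ for $-1\le y\le 1$; (iv) $D_y^{2s}u(x,1)=\varphi_s(x)$ for $0\le x\le 1$; (v) $D_y^{2s}u(x,-1)=\psi_s(x)$ for $0\le x\le 1$; where in (iii)-(v) $s=0,1,\dots,n-1$. Problem $(P_k)$: find a function $u_k$ on $[-1,1]$ with $$\prod_{j=1}^n\left(-(a_jk\pi)^2+\operatorname{sgn}(y)\frac{d^2}{dy^2}\right)u_k(y)=0\quad\text{for } 0<|y|<1,$$ $$u_k^{(2s)}(1)=\varphi_{sk},\quad u_k^{(2s)}(-1)=\psi_{sk}\quad (s=0,\dots,n-1),\qquad u_k^{(t)}(+0)=u_k^{(t)}(-0)\quad(t=0,\dots,2n-1),$$ where $\varphi_{sk}=\sqrt2\int_0^1\varphi_s(x)\sin(\pi kx)\,dx$, $\psi_{sk}=\sqrt2\int_0^1\psi_s(x)\sin(\pi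 kx)\,dx$. The determinant $\Delta_2(k)$. For $k\in\mathbb N$, $$\Delta_2(k)=\left(-\frac i2\right)^n\det\left[p_1,\dots,p_n,q_1^+,q_1^-,q_2^+,q_2^-,\dots,q_n^+,q_n^-\right],$$ the determinant of a $3n\times3n$ complex matrix whose columns are as follows. The first $n$ entries of a column are indexed by $m=0,\dots,n-1$ and the last $2n$ entries by $t=0,\dots,2n-1$. The column $p_s$ has entries $0$ (for each $m$) and $(-a_s)^t$ (for each $t$); the column $q_s^{+}$ has entries $a_s^{2m}e^{-i\pi k a_s}$ and $(ia_s)^t$; the column $q_s^{-}$ has entries $a_s^{2m}e^{i\pi k a_s}$ and $(-ia_s)^t$. *)

theory Defs
  imports "HOL-Analysis.Analysis" "Jordan_Normal_Form.Determinant"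
begin

text \<open>The derivative is taken relative to the set \<open>S\<close>: this is the ordinary derivative at interior
  points of \<open>S\<close> and the one-sided derivative at an endpoint of an interval. Only the values of
  \<open>f\<close> on \<open>S\<close> matter at points of \<open>S\<close>, so the operator can be iterated.\<close>

definition deriv_on :: "real set \<Rightarrow> (real \<Rightarrow> real) \<Rightarrow> real \<Rightarrow> real" where
  "deriv_on S f = (\<lambda>x. vector_derivative f (at x within S))"

primrec Ck_on :: "nat \<Rightarrow> real set \<Rightarrow> (real \<Rightarrow> real) \<Rightarrow> bool" where
  "Ck_on 0 S f \<longleftrightarrow> continuous_on S f"
| "Ck_on (Suc m) S f \<longleftrightarrow> f differentiable_on S \<and> Ck_on m S (deriv_on S f)"

text \<open>On an open set these are the ordinary partial derivatives. At a boundary point of a closed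
  rectangle they are the one-sided ones, which for functions of class \<open>C\<^sup>m\<close> are the continuous
  extensions of the partial derivatives in the interior.\<close>

definition deriv_x :: "(real \<times> real) set \<Rightarrow> (real \<times> real \<Rightarrow> real) \<Rightarrow> real \<times> real \<Rightarrow> real" where
  "deriv_x S u = (\<lambda>(x, y). deriv_on {\<xi>. (\<xi>, y) \<in> S} (\<lambda>\<xi>. u (\<xi>, y)) x)"

definition deriv_y :: "(real \<times> real) set \<Rightarrow> (real \<times> real \<Rightarrow> real) \<Rightarrow> real \<times> real \<Rightarrow> real" where
  "deriv_y S u = (\<lambda>(x, y). deriv_on {\<eta>. (x, \<eta>) \<in> S} (\<lambda>\<eta>. u (x, \<eta>)) y)"

text \<open>All partial derivatives of order at most \<open>m\<close>, mixed ones in every order of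
  differentiation, exist and are continuous on \<open>S\<close>.\<close>

primrec Ck2_on :: "nat \<Rightarrow> (real \<times> real) set \<Rightarrow> (real \<times> real \<Rightarrow> real) \<Rightarrow> bool" where
  "Ck2_on 0 S u \<longleftrightarrow> continuous_on S u"
| "Ck2_on (Suc m) S u \<longleftrightarrow> continuous_on S u
     \<and> (\<forall>y. (\<lambda>\<xi>. u (\<xi>, y)) differentiable_on {\<xi>. (\<xi>, y) \<in> S})
     \<and> (\<forall>x. (\<lambda>\<eta>. u (x, \<eta>)) differentiable_on {\<eta>. (x, \<eta>) \<in> S})
     \<and> Ck2_on m S (deriv_x S u) \<and> Ck2_on m S (deriv_y S u)"

definition Omega :: "(real \<times> real) set" where
  "Omega = {(x, y). 0 < x \<and> x < 1 \<and> -1 < y \<and> y < 1}"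

definition Omega_pos :: "(real \<times> real) set" where
  "Omega_pos = Omega \<inter> {(x, y). y > 0}"

definition Omega_neg :: "(real \<times> real) set" where
  "Omega_neg = Omega \<inter> {(x, y). y < 0}"

definition L_factor ::
  "(real \<times> real) set \<Rightarrow> real \<Rightarrow> (real \<times> real \<Rightarrow> real) \<Rightarrow> real \<times> real \<Rightarrow> real" where
  "L_factor S c u = (\<lambda>(x, y). c\<^sup>2 * (deriv_x S ^^ 2) u (x, y) + sgn y * (deriv_y S ^^ 2) u (x, y))"

text \<open>The product of the operators is their composition, the factor with \<open>a 1\<close> being outermost;
  the factors commute on functions of class \<open>C\<^sup>2\<^sup>n\<close> on \<open>Omega_pos \<union> Omega_neg\<close>.\<close>

definition L_op :: "nat \<Rightarrow> (nat \<Rightarrow> real) \<Rightarrow> (real \<times> real \<Rightarrow> real) \<Rightarrow> real \<times> real \<Rightarrow> real" where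
  "L_op n a u = foldr (\<lambda>j. L_factor (Omega_pos \<union> Omega_neg) (a j)) [1..<Suc n] u"

definition classical_solution ::
  "nat \<Rightarrow> (nat \<Rightarrow> real) \<Rightarrow> (nat \<Rightarrow> real \<Rightarrow> real) \<Rightarrow> (nat \<Rightarrow> real \<Rightarrow> real) \<Rightarrow> (real \<times> real \<Rightarrow> real) \<Rightarrow> bool"
where
  "classical_solution n a \<phi> \<psi> u \<longleftrightarrow>
     Ck2_on (2 * n - 1) (closure Omega) u
   \<and> Ck2_on (2 * n) (Omega_pos \<union> Omega_neg) u
   \<and> (\<forall>z \<in> Omega_pos \<union> Omega_neg. L_op n a u z = 0)
   \<and> (\<forall>s<n. \<forall>y\<in>{-1..1}. (deriv_x (closure Omega) ^^ (2 * s)) u (0, y) = 0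
                        \<and> (deriv_x (closure Omega) ^^ (2 * s)) u (1, y) = 0)
   \<and> (\<forall>s<n. \<forall>x\<in>{0..1}. (deriv_y (closure Omega) ^^ (2 * s)) u (x, 1) = \<phi> s x)
   \<and> (\<forall>s<n. \<forall>x\<in>{0..1}. (deriv_y (closure Omega) ^^ (2 * s)) u (x, -1) = \<psi> s x)"

definition sine_coeff :: "(real \<Rightarrow> real) \<Rightarrow> nat \<Rightarrow> real" where
  "sine_coeff f k = sqrt 2 * integral {0..1} (\<lambda>x. f x * sin (pi * real k * x))"

definition P_factor :: "real set \<Rightarrow> nat \<Rightarrow> real \<Rightarrow> (real \<Rightarrow> real) \<Rightarrow> real \<Rightarrow> real" where
  "P_factor S k c v = (\<lambda>y. - (c * real k * pi)\<^sup>2 * v y + sgn y * (deriv_on S ^^ 2) v y)"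

definition P_op :: "nat \<Rightarrow> (nat \<Rightarrow> real) \<Rightarrow> nat \<Rightarrow> (real \<Rightarrow> real) \<Rightarrow> real \<Rightarrow> real" where
  "P_op n a k v = foldr (\<lambda>j. P_factor {y. 0 < \<bar>y\<bar> \<and> \<bar>y\<bar> < 1} k (a j)) [1..<Suc n] v"

text \<open>The first three conjuncts are the regularity needed for the remaining conditions to make
  sense: the equation has order \<open>2 n\<close>, derivatives up to order \<open>2 n - 2\<close> are evaluated at the
  endpoints (one-sidedly), and \<open>v 0\<close> is the common value of the one-sided limits of \<open>v\<close> at \<open>0\<close>,
  which the matching conditions alone would not fix.\<close>

definition solves_P ::
  "nat \<Rightarrow> (nat \<Rightarrow> real) \<Rightarrow> (nat \<Rightarrow> real \<Rightarrow> real) \<Rightarrow> (nat \<Rightarrow> real \<Rightarrow> real) \<Rightarrow> nat \<Rightarrow> (real \<Rightarrow> real) \<Rightarrow> bool"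
where
  "solves_P n a \<phi> \<psi> k v \<longleftrightarrow>
     Ck_on (2 * n) {y. 0 < \<bar>y\<bar> \<and> \<bar>y\<bar> < 1} v
   \<and> Ck_on (2 * n - 2) ({-1..1} - {0}) v
   \<and> isCont v 0
   \<and> (\<forall>y. 0 < \<bar>y\<bar> \<and> \<bar>y\<bar> < 1 \<longrightarrow> P_op n a k v y = 0)
   \<and> (\<forall>s<n. (deriv_on ({-1..1} - {0}) ^^ (2 * s)) v 1 = sine_coeff (\<phi> s) k
           \<and> (deriv_on ({-1..1} - {0}) ^^ (2 * s)) v (-1) = sine_coeff (\<psi> s) k)
   \<and> (\<forall>t<2 * n. \<exists>l. ((deriv_on {y. 0 < \<bar>y\<bar> \<and> \<bar>y\<bar> < 1} ^^ t) v \<longlongrightarrow> l) (at_right 0)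
                 \<and> ((deriv_on {y. 0 < \<bar>y\<bar> \<and> \<bar>y\<bar> < 1} ^^ t) v \<longlongrightarrow> l) (at_left 0))"

text \<open>Rows \<open>r < n\<close> are the entries \<open>m = r\<close>, rows \<open>n \<le> r < 3 n\<close> the entries \<open>t = r - n\<close>.\<close>

definition p_entry :: "nat \<Rightarrow> (nat \<Rightarrow> real) \<Rightarrow> nat \<Rightarrow> nat \<Rightarrow> complex" where
  "p_entry n a s r = (if r < n then 0 else of_real ((- a s) ^ (r - n)))"

definition q_pos_entry :: "nat \<Rightarrow> (nat \<Rightarrow> real) \<Rightarrow> nat \<Rightarrow> nat \<Rightarrow> nat \<Rightarrow> complex" where
  "q_pos_entry n a k s r =
     (if r < n then of_real (a s ^ (2 * r)) * exp (- \<i> * of_real (pi * real k * a s))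
      else (\<i> * of_real (a s)) ^ (r - n))"

definition q_neg_entry :: "nat \<Rightarrow> (nat \<Rightarrow> real) \<Rightarrow> nat \<Rightarrow> nat \<Rightarrow> nat \<Rightarrow> complex" where
  "q_neg_entry n a k s r =
     (if r < n then of_real (a s ^ (2 * r)) * exp (\<i> * of_real (pi * real k * a s))
      else (- \<i> * of_real (a s)) ^ (r - n))"

text \<open>Rows and columns are counted from \<open>0\<close>: column \<open>c < n\<close> is \<open>p\<close> with index \<open>c + 1\<close>, and columns
  \<open>n + 2 i\<close> and \<open>n + 2 i + 1\<close> are the two \<open>q\<close> columns with index \<open>i + 1\<close>.\<close>

definition Delta2 :: "nat \<Rightarrow> (nat \<Rightarrow> real) \<Rightarrow> nat \<Rightarrow> complex" where
  "Delta2 n a k = (- \<i> / 2) ^ n * Determinant.det (Matrix.mat (3 * n) (3 * n) (\<lambda>(r, c).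
     if c < n then p_entry n a (c + 1) r
     else if even (c - n) then q_pos_entry n a k ((c - n) div 2 + 1) r
     else q_neg_entry n a k ((c - n) div 2 + 1) r))"

end

theory Submission
  imports Defs "HOL-Real_Asymp.Real_Asymp"
begin

text \<open>On each side of \<open>0\<close> a solution \<open>u\<^sub>k\<close> is a combination of exponentials: \<open>exp (\<plusminus> a\<^sub>s k \<pi> y)\<close> above
  and \<open>exp (\<plusminus> \<i> a\<^sub>s k \<pi> y)\<close> below. Up to exponentially small terms, the boundary and matching
  conditions are a linear system with determinant \<open>Delta2\<close> times a Vandermonde determinant, so
  all normalised coefficients are \<open>O(k\<^sup>\<gamma>)\<close> times the sine coefficients of the data, and the derivative
  of \<open>u\<^sub>k\<close> of order \<open>t\<close> costs at most a factor \<open>k\<^sup>t\<close>. Integrating by parts \<open>2 n + 1 + \<alpha>\<close> times gains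
  that power of \<open>k\<close> in the sine coefficients, and by Bessel's inequality the remaining factor is square
  summable. Hence all derivatives of order at most \<open>2 n\<close> of the series converge normally. The boundary values are
  identified through the completeness of the sine system, which follows from the density of the
  polynomials in \<open>cos (\<pi> x)\<close>.\<close>

section \<open>Iterated derivatives\<close>

text \<open>What brings \<open>Delta2\<close> in is the normalisation of the \<open>4 n\<close>
  unknowns of a mode: growing exponentials are measured at \<open>y = 1\<close>, decaying ones at
  \<open>y = 0\<close>. The decaying ones are then exponentially small in the conditions at
  \<open>y = 1\<close>, the growing ones in the matching conditions at \<open>y = 0\<close>. Without
  these terms the system splits into an \<open>n\<close> by \<open>n\<close> Vandermonde system for
  the growing part, whose inverse does not depend on \<open>k\<close>, and the \<open>3 n\<close> by
  \<open>3 n\<close> system of \<open>Delta2\<close> for the decaying and oscillating parts. Small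
  denominators occur only in the latter. The order \<open>2 n + 1 + \<alpha>\<close> splits into
  \<open>2 n\<close> for the derivatives of the series, \<open>\<alpha>\<close> for the division by
  \<open>Delta2\<close>, and one power of \<open>k\<close> that turns a square summable sequence
  into an absolutely summable one. The \<open>y\<close>-derivative of order \<open>2 n\<close> may
  jump at \<open>y = 0\<close>, the lower ones do not. Convergence is therefore shown to order
  \<open>2 n - 1\<close> on the closed rectangle and to order \<open>2 n\<close> with
  \<open>y = 0\<close> removed; the second set is not convex, which matters for termwise
  differentiation.\<close>

lemma deriv_on_eqI:
  assumes "(f has_real_derivative d) (at x within S)" and "x islimpt S"
  shows "deriv_on S f x = d"
  using assms vector_derivative_within[of x S f d]
  by (simp add: deriv_on_def has_real_derivative_iff_has_vector_derivative trivial_limit_within)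

lemma has_real_derivative_cong_on:
  assumes "\<And>x. x \<in> S \<Longrightarrow> f x = g x" and "x \<in> S"
  shows "(f has_real_derivative d) (at x within S) \<longleftrightarrow> (g has_real_derivative d) (at x within S)"
  using assms by (metis has_vector_derivative_transform has_real_derivative_iff_has_vector_derivative)

lemma deriv_on_cong:
  assumes "\<And>x. x \<in> S \<Longrightarrow> f x = g x" and "x \<in> S"
  shows "deriv_on S f x = deriv_on S g x"
  unfolding deriv_on_def vector_derivative_def
    has_real_derivative_iff_has_vector_derivative[symmetric]
  using has_real_derivative_cong_on[OF assms] by simp

text \<open>Iterating \<open>deriv_on\<close> is awkward because it is a choice operator. An
  explicit chain \<open>F\<close> of derivatives determines all iterates, and agreement with
  \<open>f\<close> on \<open>S\<close> suffices because relative derivatives see only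
  \<open>S\<close>.\<close>

lemma funpow_deriv_on_eq:
  assumes "\<And>x. x \<in> S \<Longrightarrow> f x = F 0 x"
    and "\<And>j x. j < m \<Longrightarrow> x \<in> S \<Longrightarrow> (F j has_real_derivative F (Suc j) x) (at x within S)"
    and "\<And>x. x \<in> S \<Longrightarrow> x islimpt S"
    and "j \<le> m" and "x \<in> S"
  shows "(deriv_on S ^^ j) f x = F j x"
  using assms(4,5)
proof (induction j arbitrary: x)
  case 0
  then show ?case using assms(1) by simp
next
  case (Suc j)
  have "(deriv_on S ^^ Suc j) f x = deriv_on S (F j) x"
    using Suc by (auto intro: deriv_on_cong)
  also have "\<dots> = F (Suc j) x"
    using Suc.prems assms(2,3) by (intro deriv_on_eqI) auto
  finally show ?case .
qed

lemma Ck_on_has_derivative: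
  assumes "Ck_on m S f" and "j < m" and "x \<in> S"
  shows "((deriv_on S ^^ j) f has_real_derivative (deriv_on S ^^ Suc j) f x) (at x within S)"
  using assms
proof (induction m arbitrary: f j)
  case (Suc m)
  show ?case
  proof (cases j)
    case 0
    have "f differentiable (at x within S)"
      using Suc.prems by (auto simp: differentiable_on_def)
    then show ?thesis
      using 0 by (simp add: deriv_on_def vector_derivative_works
          has_real_derivative_iff_has_vector_derivative)
  next
    case (Suc i)
    have "((deriv_on S ^^ i) (deriv_on S f) has_real_derivative
        (deriv_on S ^^ Suc i) (deriv_on S f) x) (at x within S)"
      using Suc Suc.prems by (intro Suc.IH) auto
    then show ?thesis
      \<comment> \<open>\<open>Ck_on\<close> recurses on the derivative of \<open>f\<close>, whereas
        \<open>^^\<close> applies the last derivative outermost.\<close>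
      by (simp add: Suc funpow_swap1)
  qed
qed simp

lemma Ck_on_continuous:
  assumes "Ck_on m S f" and "j \<le> m"
  shows "continuous_on S ((deriv_on S ^^ j) f)"
  using assms
proof (induction m arbitrary: f j)
  case (Suc m)
  show ?case
  proof (cases j)
    case 0
    then show ?thesis using Suc.prems differentiable_imp_continuous_on by auto
  next
    case (Suc i)
    then have "continuous_on S ((deriv_on S ^^ i) (deriv_on S f))"
      using Suc.prems by (intro Suc.IH) auto
    then show ?thesis by (simp add: Suc funpow_swap1)
  qed
qed simp

text \<open>\<open>W i j\<close> plays the role of the mixed derivative of order \<open>i\<close> in \<open>x\<close> and \<open>j\<close> in \<open>y\<close>.\<close>

definition jet :: "nat \<Rightarrow> real set \<Rightarrow> real set \<Rightarrow> (nat \<Rightarrow> nat \<Rightarrow> real \<times> real \<Rightarrow> real) \<Rightarrow> bool" where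
  "jet N X Y W \<longleftrightarrow> (\<forall>i j. i + j \<le> N \<longrightarrow> continuous_on (X \<times> Y) (W i j))
    \<and> (\<forall>i j. \<forall>x\<in>X. \<forall>y\<in>Y. i + j < N \<longrightarrow>
        ((\<lambda>\<xi>. W i j (\<xi>, y)) has_real_derivative W (Suc i) j (x, y)) (at x within X)
      \<and> ((\<lambda>\<eta>. W i j (x, \<eta>)) has_real_derivative W i (Suc j) (x, y)) (at y within Y))"

text \<open>Without isolated points relative derivatives are unique, so the operators
  \<open>deriv_x\<close> and \<open>deriv_y\<close> return the derivative that was
  exhibited.\<close>

locale perfect_rectangle =
  fixes X Y :: "real set"
  assumes limpt_X: "x \<in> X \<Longrightarrow> x islimpt X" and limpt_Y: "y \<in> Y \<Longrightarrow> y islimpt Y"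
begin

lemma slices:
  "y \<in> Y \<Longrightarrow> {\<xi>. (\<xi>, y) \<in> X \<times> Y} = X" "x \<in> X \<Longrightarrow> {\<eta>. (x, \<eta>) \<in> X \<times> Y} = Y"
  by auto

context
  fixes N :: nat and W :: "nat \<Rightarrow> nat \<Rightarrow> real \<times> real \<Rightarrow> real"
  assumes W: "jet N X Y W"
begin

lemma slice_derivatives:
  assumes u: "\<And>z. z \<in> X \<times> Y \<Longrightarrow> u z = W i j z" and "i + j < N" and "x \<in> X" and "y \<in> Y"
  shows "((\<lambda>\<xi>. u (\<xi>, y)) has_real_derivative W (Suc i) j (x, y)) (at x within X)"
    and "((\<lambda>\<eta>. u (x, \<eta>)) has_real_derivative W i (Suc j) (x, y)) (at y within Y)"
  using has_real_derivative_cong_on[of X "\<lambda>\<xi>. u (\<xi>, y)" "\<lambda>\<xi>. W i j (\<xi>, y)" x]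
    has_real_derivative_cong_on[of Y "\<lambda>\<eta>. u (x, \<eta>)" "\<lambda>\<eta>. W i j (x, \<eta>)" y] W assms
  by (auto simp: jet_def)

lemma partials_eq:
  assumes u: "\<And>z. z \<in> X \<times> Y \<Longrightarrow> u z = W i j z" and "i + j < N" and "z \<in> X \<times> Y"
  shows "deriv_x (X \<times> Y) u z = W (Suc i) j z" and "deriv_y (X \<times> Y) u z = W i (Suc j) z"
proof -
  obtain x y where z: "z = (x, y)" and xy: "x \<in> X" "y \<in> Y" using assms(3) by auto
  show "deriv_x (X \<times> Y) u z = W (Suc i) j z" "deriv_y (X \<times> Y) u z = W i (Suc j) z"
    unfolding z deriv_x_def deriv_y_def case_prod_conv slices(1)[OF xy(2)] slices(2)[OF xy(1)]
    by (intro deriv_on_eqI slice_derivatives[OF u assms(2) xy] limpt_X limpt_Y xy; assumption)+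
qed

lemma funpow_deriv_x_eq:
  assumes "\<And>z. z \<in> X \<times> Y \<Longrightarrow> u z = W 0 0 z" and "p \<le> N" and "z \<in> X \<times> Y"
  shows "(deriv_x (X \<times> Y) ^^ p) u z = W p 0 z"
  using assms(2,3)
proof (induction p arbitrary: z)
  case (Suc p)
  then show ?case by (auto intro: partials_eq(1)[where j = 0])
qed (use assms(1) in auto)

lemma funpow_deriv_y_eq:
  assumes "\<And>z. z \<in> X \<times> Y \<Longrightarrow> u z = W 0 0 z" and "p \<le> N" and "z \<in> X \<times> Y"
  shows "(deriv_y (X \<times> Y) ^^ p) u z = W 0 p z"
  using assms(2,3)
proof (induction p arbitrary: z)
  case (Suc p)
  then show ?case by (auto intro: partials_eq(2)[where i = 0])
qed (use assms(1) in auto)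

text \<open>Here \<open>u\<close> may agree with any \<open>W i j\<close>, because the recursion of
  \<open>Ck2_on\<close> passes to both partial derivatives. Every mixed derivative, in whatever
  order it is taken, lands on the same \<open>W i j\<close>; no appeal to the symmetry of second
  derivatives is made.\<close>

lemma Ck2_on_jet:
  assumes "\<And>z. z \<in> X \<times> Y \<Longrightarrow> u z = W i j z" and "i + j + m \<le> N"
  shows "Ck2_on m (X \<times> Y) u"
  using assms
proof (induction m arbitrary: u i j)
  case 0
  then show ?case
    using W continuous_on_cong[of "X \<times> Y" "X \<times> Y" u "W i j"] by (simp add: jet_def)
next
  case (Suc m)
  have "continuous_on (X \<times> Y) u"
    using W Suc.prems continuous_on_cong[of "X \<times> Y" "X \<times> Y" u "W i j"] by (simp add: jet_def)
  \<comment> \<open>For \<open>y\<close> outside \<open>Y\<close> the slice is empty and the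
    condition is void.\<close>
  moreover have "(\<lambda>\<xi>. u (\<xi>, y)) differentiable_on {\<xi>. (\<xi>, y) \<in> X \<times> Y}" for y
  proof (cases "y \<in> Y")
    case True
    then show ?thesis
      unfolding slices(1)[OF True] differentiable_on_def real_differentiable_def
      using slice_derivatives(1)[of u i j _ y] Suc.prems by auto
  qed (simp add: differentiable_on_def)
  moreover have "(\<lambda>\<eta>. u (x, \<eta>)) differentiable_on {\<eta>. (x, \<eta>) \<in> X \<times> Y}" for x
  proof (cases "x \<in> X")
    case True
    then show ?thesis
      unfolding slices(2)[OF True] differentiable_on_def real_differentiable_def
      using slice_derivatives(2)[of u i j x] Suc.prems by auto
  qed (simp add: differentiable_on_def)
  moreover have "Ck2_on m (X \<times> Y) (deriv_x (X \<times> Y) u)"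
    using Suc.prems by (intro Suc.IH[where i = "Suc i" and j = j] partials_eq(1)) auto
  moreover have "Ck2_on m (X \<times> Y) (deriv_y (X \<times> Y) u)"
    using Suc.prems by (intro Suc.IH[where i = i and j = "Suc j"] partials_eq(2)) auto
  ultimately show ?case by simp
qed

end

end

section \<open>Sine series with variable coefficients\<close>

text \<open>Series are indexed from 0, so the index \<open>k\<close> stands for the mode
  \<open>k + 1\<close>.\<close>

definition freq :: "nat \<Rightarrow> real" where
  "freq k = pi * real (Suc k)"

lemma freq_ge_1: "freq k \<ge> 1"
proof -
  have "1 * 1 \<le> pi * real (Suc k)"
    using pi_gt3 by (intro mult_mono) auto
  then show ?thesis by (simp add: freq_def)
qed

text \<open>Each derivative in \<open>x\<close> contributes a factor \<open>freq k\<close> and a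
  quarter turn of the phase, which avoids a distinction between sines and cosines.\<close>

definition sine_series :: "(nat \<Rightarrow> nat \<Rightarrow> real \<Rightarrow> real) \<Rightarrow> nat \<Rightarrow> nat \<Rightarrow> real \<times> real \<Rightarrow> real" where
  "sine_series G i j = (\<lambda>(x, y). \<Sum>k. freq k ^ i * sin (freq k * x + real i * (pi / 2)) * G k j y)"

text \<open>\<open>G k j\<close> plays the role of the \<open>j\<close>-th derivative of the \<open>k\<close>-th sine coefficient; the weight
  makes every mixed derivative of order at most \<open>N\<close> of the series normally convergent.\<close>

definition derivative_jet :: "nat \<Rightarrow> real set \<Rightarrow> (nat \<Rightarrow> real \<Rightarrow> real) \<Rightarrow> bool" where
  "derivative_jet N Y F \<longleftrightarrow>
     (\<forall>j<N. \<forall>y\<in>Y. (F j has_real_derivative F (Suc j) y) (at y within Y))"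

definition decaying_jet :: "nat \<Rightarrow> real set \<Rightarrow> (nat \<Rightarrow> nat \<Rightarrow> real \<Rightarrow> real) \<Rightarrow> bool" where
  "decaying_jet N Y G \<longleftrightarrow>
     (\<forall>k. \<forall>j\<le>N. continuous_on Y (G k j))
   \<and> (\<forall>k. derivative_jet N Y (G k))
   \<and> (\<exists>c. summable c \<and> (\<forall>k. \<forall>j\<le>N. \<forall>y\<in>Y. freq k ^ (N - j) * \<bar>G k j y\<bar> \<le> c k))"

lemma decaying_jet_bound:
  assumes "decaying_jet N Y G"
  obtains c where "summable c"
    and "\<And>k j y. j \<le> N \<Longrightarrow> y \<in> Y \<Longrightarrow> freq k ^ (N - j) * \<bar>G k j y\<bar> \<le> c k"
  using assms by (auto simp: decaying_jet_def)

text \<open>Frequencies are at least 1, so the weight with exponent \<open>N - j\<close> dominates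
  every \<open>freq k ^ i\<close> that can occur with \<open>j\<close>.\<close>

lemma decaying_jet_term_bound:
  assumes "freq k ^ (N - j) * \<bar>G k j y\<bar> \<le> (c :: real)" and "i + j \<le> N"
  shows "norm (freq k ^ i * sin t * G k j y) \<le> c"
proof -
  have "norm (freq k ^ i * sin t * G k j y) = freq k ^ i * \<bar>sin t\<bar> * \<bar>G k j y\<bar>"
    using freq_ge_1[of k] by (simp add: abs_mult)
  also have "\<dots> \<le> freq k ^ (N - j) * 1 * \<bar>G k j y\<bar>"
    using freq_ge_1[of k] assms(2)
    by (intro mult_mono power_increasing) auto
  finally show ?thesis using assms(1) by simp
qed

section \<open>Normal convergence and termwise differentiation\<close>

lemma sine_series_sums:
  assumes "decaying_jet N Y G" and "i + j \<le> N" and "y \<in> Y"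
  shows "(\<lambda>k. freq k ^ i * sin (freq k * x + real i * (pi / 2)) * G k j y) sums sine_series G i j (x, y)"
proof -
  obtain c where c: "summable c" "\<And>k. freq k ^ (N - j) * \<bar>G k j y\<bar> \<le> c k"
    using assms(2,3) by (rule_tac decaying_jet_bound[OF assms(1)]) auto
  have "summable (\<lambda>k. freq k ^ i * sin (freq k * x + real i * (pi / 2)) * G k j y)"
    by (rule summable_comparison_test'[OF c(1), of 0]) (rule decaying_jet_term_bound[of _ N j G y, OF c(2) assms(2)])
  then show ?thesis by (simp add: sine_series_def summable_sums)
qed

lemma sine_series_uniform_limit:
  assumes "decaying_jet N Y G" and "i + j \<le> N"
  shows "uniform_limit (UNIV \<times> Y)
    (\<lambda>m z. \<Sum>k<m. freq k ^ i * sin (freq k * fst z + real i * (pi / 2)) * G k j (snd z))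
    (sine_series G i j) sequentially"
proof -
  obtain c where c: "summable c" "\<And>k y. y \<in> Y \<Longrightarrow> freq k ^ (N - j) * \<bar>G k j y\<bar> \<le> c k"
    using assms(2) by (rule_tac decaying_jet_bound[OF assms(1)]) auto
  have "uniform_limit (UNIV \<times> Y)
    (\<lambda>m z. \<Sum>k<m. freq k ^ i * sin (freq k * fst z + real i * (pi / 2)) * G k j (snd z))
    (\<lambda>z. \<Sum>k. freq k ^ i * sin (freq k * fst z + real i * (pi / 2)) * G k j (snd z)) sequentially"
    by (rule Weierstrass_m_test[OF _ c(1)]) (auto intro!: decaying_jet_term_bound[of _ N j G, OF c(2) assms(2)] simp del: real_norm_def)
  then show ?thesis by (simp add: sine_series_def case_prod_unfold)
qed

lemma sine_series_continuous:
  assumes "decaying_jet N Y G" and "i + j \<le> N"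
  shows "continuous_on (UNIV \<times> Y) (sine_series G i j)"
proof (rule uniform_limit_theorem[OF _ sine_series_uniform_limit[OF assms]])
  have G: "continuous_on Y (G k j)" for k
    using assms by (auto simp: decaying_jet_def)
  have G': "continuous_on (UNIV \<times> Y) (\<lambda>z. G k j (snd z))" for k
    by (rule continuous_on_compose2[OF G continuous_on_snd]) (auto intro: continuous_on_id)
  show "\<forall>\<^sub>F m in sequentially. continuous_on (UNIV \<times> Y)
      (\<lambda>z. \<Sum>k<m. freq k ^ i * sin (freq k * fst z + real i * (pi / 2)) * G k j (snd z))"
    by (intro always_eventually allI continuous_intros G')
qed simp

lemma sin_quarter_shift: "sin (t + real (Suc i) * (pi / 2)) = cos (t + real i * (pi / 2))"
proof -
  have eq: "t + real (Suc i) * (pi / 2) = (t + real i * (pi / 2)) + pi / 2"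
    by (simp add: algebra_simps add_divide_distrib)
  show ?thesis
    unfolding eq sin_add[of "t + real i * (pi / 2)" "pi / 2"] by simp
qed

lemma sine_series_deriv_x:
  assumes "decaying_jet N Y G" and "i + j < N" and y: "y \<in> Y"
  shows "((\<lambda>\<xi>. sine_series G i j (\<xi>, y)) has_real_derivative sine_series G (Suc i) j (x, y)) (at x)"
proof -
  let ?f = "\<lambda>k \<xi>. freq k ^ i * sin (freq k * \<xi> + real i * (pi / 2)) * G k j y"
  let ?f' = "\<lambda>k \<xi>. freq k ^ Suc i * sin (freq k * \<xi> + real (Suc i) * (pi / 2)) * G k j y"
  have d: "(?f k has_real_derivative ?f' k \<xi>) (at \<xi> within UNIV)" for k \<xi>
    unfolding sin_quarter_shift by (auto intro!: derivative_eq_intros simp: algebra_simps)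
  have ul: "uniform_limit UNIV (\<lambda>m \<xi>. \<Sum>k<m. ?f' k \<xi>) (\<lambda>\<xi>. sine_series G (Suc i) j (\<xi>, y)) sequentially"
    using uniform_limit_compose'[OF sine_series_uniform_limit[OF assms(1), of "Suc i" j], of "\<lambda>\<xi>. (\<xi>, y)" UNIV]
      assms(2) y by auto
  have sm: "summable (\<lambda>k. ?f k x)"
    using sine_series_sums[OF assms(1) _ y, of i j x] assms(2) by (auto dest: sums_summable)
  obtain g where g: "\<And>\<xi>. (\<lambda>k. ?f k \<xi>) sums g \<xi>"
      "(g has_real_derivative sine_series G (Suc i) j (x, y)) (at x)"
    using has_field_derivative_series[OF convex_UNIV d ul UNIV_I sm] by auto
  have "g = (\<lambda>\<xi>. sine_series G i j (\<xi>, y))"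
    using sums_unique[OF g(1)] by (auto simp: sine_series_def)
  then show ?thesis using g(2) by simp
qed

text \<open>Termwise differentiation is a statement about convex sets. Derivatives are local, so
  convexity near the point is enough, and this covers both a closed interval and an open set with a
  hole.\<close>

definition locally_convex_at :: "real set \<Rightarrow> real \<Rightarrow> bool" where
  "locally_convex_at Y y \<longleftrightarrow> (\<exists>d>0. convex (Y \<inter> ball y d))"

lemma sine_series_deriv_y:
  assumes G: "decaying_jet N Y G" and "i + j < N" and y: "y \<in> Y" and "locally_convex_at Y y"
  shows "((\<lambda>\<eta>. sine_series G i j (x, \<eta>)) has_real_derivative sine_series G i (Suc j) (x, y)) (at y within Y)"
proof -
  let ?f = "\<lambda>k \<eta>. freq k ^ i * sin (freq k * x + real i * (pi / 2)) * G k j \<eta>"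
  let ?f' = "\<lambda>k \<eta>. freq k ^ i * sin (freq k * x + real i * (pi / 2)) * G k (Suc j) \<eta>"
  obtain d where d: "d > 0" "convex (Y \<inter> ball y d)"
    using assms(4) by (auto simp: locally_convex_at_def)
  define C where "C = Y \<inter> ball y d"
  have yC: "y \<in> C" using y d by (simp add: C_def)
  have C: "at y within C = at y within Y"
    using d by (intro at_within_nhd[of y "ball y d"]) (auto simp: C_def)
  have der: "(?f k has_real_derivative ?f' k \<eta>) (at \<eta> within C)" if "\<eta> \<in> C" for k \<eta>
  proof -
    have "(G k j has_real_derivative G k (Suc j) \<eta>) (at \<eta> within Y)"
      using G that assms(2) by (auto simp: decaying_jet_def derivative_jet_def C_def)
    then have "(G k j has_real_derivative G k (Suc j) \<eta>) (at \<eta> within C)"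
      by (rule DERIV_subset) (auto simp: C_def)
    then show ?thesis by (auto intro!: derivative_eq_intros)
  qed
  have ul: "uniform_limit C (\<lambda>m \<eta>. \<Sum>k<m. ?f' k \<eta>) (\<lambda>\<eta>. sine_series G i (Suc j) (x, \<eta>)) sequentially"
    using uniform_limit_compose'[OF sine_series_uniform_limit[OF G, of i "Suc j"], of "\<lambda>\<eta>. (x, \<eta>)" C]
      assms(2) y by (auto simp: C_def)
  have sm: "summable (\<lambda>k. ?f k y)"
    using sine_series_sums[OF G _ y, of i j x] assms(2) by (auto dest: sums_summable)
  obtain g where g: "\<And>\<eta>. \<eta> \<in> C \<Longrightarrow> (\<lambda>k. ?f k \<eta>) sums g \<eta>"
      "(g has_real_derivative sine_series G i (Suc j) (x, y)) (at y within C)"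
    using has_field_derivative_series[OF d(2)[folded C_def] der ul yC sm] yC by auto
  have "g \<eta> = sine_series G i j (x, \<eta>)" if "\<eta> \<in> C" for \<eta>
    using sums_unique[OF g(1)[OF that]] by (auto simp: sine_series_def)
  then have "((\<lambda>\<eta>. sine_series G i j (x, \<eta>)) has_real_derivative sine_series G i (Suc j) (x, y)) (at y within C)"
    using g(2) has_real_derivative_cong_on[of C g "\<lambda>\<eta>. sine_series G i j (x, \<eta>)", OF _ yC] by simp
  then show ?thesis by (simp add: C)
qed

lemma sine_series_jet:
  assumes "decaying_jet N Y G" and "\<And>y. y \<in> Y \<Longrightarrow> locally_convex_at Y y"
  shows "jet N X Y (sine_series G)"
  unfolding jet_def
  using continuous_on_subset[OF sine_series_continuous[OF assms(1)], of _ _ "X \<times> Y"]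
    DERIV_subset[OF sine_series_deriv_x[OF assms(1)], of _ _ _ X]
    sine_series_deriv_y[OF assms(1) _ _ assms(2)]
  by auto

section \<open>The differential operators acting on sine coefficients\<close>

definition factor_jet :: "real \<Rightarrow> (nat \<Rightarrow> real \<Rightarrow> real) \<Rightarrow> nat \<Rightarrow> real \<Rightarrow> real" where
  "factor_jet l F = (\<lambda>j y. - l\<^sup>2 * F j y + sgn y * F (j + 2) y)"

text \<open>A factor of \<open>L\<close> with constant \<open>c\<close> acts on a mode as the factor
  of the one-dimensional equation with \<open>l = c * freq k\<close>. Away from \<open>y = 0\<close>
  the sign is locally constant, so in \<open>factor_jet\<close> every derivative of the result is
  given by the same formula.\<close>

definition factor_coeffs :: "real \<Rightarrow> (nat \<Rightarrow> nat \<Rightarrow> real \<Rightarrow> real) \<Rightarrow> nat \<Rightarrow> nat \<Rightarrow> real \<Rightarrow> real" where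
  "factor_coeffs c G = (\<lambda>k. factor_jet (c * freq k) (G k))"

lemma sgn_has_derivative_zero:
  assumes "y \<noteq> 0"
  shows "(sgn has_real_derivative 0) (at (y :: real))"
proof -
  have "((\<lambda>_. sgn y) has_real_derivative 0) (at y)" by simp
  then show ?thesis
    by (rule has_field_derivative_transform_within_open[where S = "if y > 0 then {0<..} else {..<0}"])
      (use assms in \<open>auto split: if_splits\<close>)
qed

lemma derivative_jet_factor_jet:
  assumes "derivative_jet (N + 2) Y F" and "0 \<notin> Y"
  shows "derivative_jet N Y (factor_jet l F)"
  unfolding derivative_jet_def
proof (intro allI impI ballI)
  fix j y assume jy: "j < N" "y \<in> Y"
  have "(sgn has_real_derivative 0) (at y within Y)"
    using sgn_has_derivative_zero jy assms(2) by (metis has_field_derivative_at_within)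
  moreover have "(F j has_real_derivative F (Suc j) y) (at y within Y)"
      "(F (j + 2) has_real_derivative F (Suc j + 2) y) (at y within Y)"
    using assms(1) jy by (auto simp: derivative_jet_def)
  ultimately show "(factor_jet l F j has_real_derivative factor_jet l F (Suc j) y) (at y within Y)"
    unfolding factor_jet_def by (auto intro!: derivative_eq_intros)
qed

text \<open>Two orders are traded for two powers of the frequency: the term with
  \<open>G k j\<close> gains the factor \<open>freq k ^ 2\<close>, and the one with
  \<open>G k (j + 2)\<close> comes with a weight smaller by that factor. Both fit the weight for
  \<open>N + 2\<close>.\<close>

lemma decaying_jet_factor_coeffs:
  assumes "decaying_jet (N + 2) Y G" and "0 \<notin> Y"
  shows "decaying_jet N Y (factor_coeffs c G)"
proof -
  have sgn: "(sgn has_real_derivative 0) (at y within Y)" if "y \<in> Y" for y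
    using sgn_has_derivative_zero that assms(2) by (metis has_field_derivative_at_within)
  have sgnc: "continuous_on Y sgn"
    using sgn by (meson DERIV_continuous_on)
  obtain b where b: "summable b"
      "\<And>k j y. j \<le> N + 2 \<Longrightarrow> y \<in> Y \<Longrightarrow> freq k ^ (N + 2 - j) * \<bar>G k j y\<bar> \<le> b k"
    using assms(1) by (auto simp: decaying_jet_def)
  have "continuous_on Y (factor_coeffs c G k j)" if "j \<le> N" for k j
    unfolding factor_coeffs_def factor_jet_def
    using assms(1) that by (intro continuous_intros sgnc) (auto simp: decaying_jet_def)
  moreover have "derivative_jet N Y (factor_coeffs c G k)" for k
    unfolding factor_coeffs_def
    using assms(1) by (intro derivative_jet_factor_jet assms(2)) (simp add: decaying_jet_def)
  moreover have "freq k ^ (N - j) * \<bar>factor_coeffs c G k j y\<bar> \<le> (c\<^sup>2 + 1) * b k"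
    if "j \<le> N" "y \<in> Y" for k j y
  proof -
    have f: "freq k > 0" using freq_ge_1[of k] by simp
    have "\<bar>factor_coeffs c G k j y\<bar> \<le> \<bar>- (c * freq k)\<^sup>2 * G k j y\<bar> + \<bar>sgn y * G k (j + 2) y\<bar>"
      unfolding factor_coeffs_def factor_jet_def by (rule abs_triangle_ineq)
    also have "\<dots> \<le> c\<^sup>2 * freq k ^ 2 * \<bar>G k j y\<bar> + \<bar>G k (j + 2) y\<bar>"
      by (intro add_mono) (auto simp: abs_mult power_mult_distrib abs_sgn_eq)
    finally have "freq k ^ (N - j) * \<bar>factor_coeffs c G k j y\<bar> \<le>
        freq k ^ (N - j) * (c\<^sup>2 * freq k ^ 2 * \<bar>G k j y\<bar> + \<bar>G k (j + 2) y\<bar>)"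
      using f by (intro mult_left_mono) auto
    also have "\<dots> = c\<^sup>2 * (freq k ^ (N + 2 - j) * \<bar>G k j y\<bar>) + freq k ^ (N + 2 - (j + 2)) * \<bar>G k (j + 2) y\<bar>"
    proof -
      have "freq k ^ (N + 2 - j) = freq k ^ (N - j) * freq k ^ 2"
        using that(1) by (simp only: Nat.add_diff_assoc2 flip: power_add)
      then show ?thesis by (simp add: algebra_simps)
    qed
    also have "\<dots> \<le> c\<^sup>2 * b k + b k"
      using that by (intro add_mono mult_left_mono b(2)) auto
    finally show ?thesis by (simp add: algebra_simps)
  qed
  moreover have "summable (\<lambda>k. (c\<^sup>2 + 1) * b k)"
    using b(1) by (rule summable_mult)
  ultimately show ?thesis
    unfolding decaying_jet_def by blast
qed

lemma P_factor_eq: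
  assumes "derivative_jet (N + 2) Y F" and "\<And>y. y \<in> Y \<Longrightarrow> y islimpt Y"
    and "\<And>y. y \<in> Y \<Longrightarrow> v y = F 0 y" and "y \<in> Y"
  shows "P_factor Y k c v y = factor_jet (c * real k * pi) F 0 y"
proof -
  have "(deriv_on Y ^^ 2) v y = F 2 y"
    using assms(1) by (intro funpow_deriv_on_eq[of Y v F 2] assms(2-4))
      (auto simp: derivative_jet_def)
  then show ?thesis
    using assms(3,4) by (simp add: P_factor_def factor_jet_def eval_nat_numeral)
qed

text \<open>Each factor differentiates the outcome of the previous ones, so the intermediate
  functions must be known together with their derivatives. That is why the composition is carried
  out on families; every factor uses up two orders.\<close>

lemma P_factors_eq:
  assumes "derivative_jet (N + 2 * length js) Y F" and "0 \<notin> Y" and "\<And>y. y \<in> Y \<Longrightarrow> y islimpt Y"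
    and "\<And>y. y \<in> Y \<Longrightarrow> v y = F 0 y"
  shows "derivative_jet N Y (foldr (\<lambda>j. factor_jet (a j * real k * pi)) js F)
    \<and> (\<forall>y\<in>Y. foldr (\<lambda>j. P_factor Y k (a j)) js v y = foldr (\<lambda>j. factor_jet (a j * real k * pi)) js F 0 y)"
  using assms(1)
proof (induction js arbitrary: N)
  case Nil
  then show ?case using assms(4) by simp
next
  case (Cons j js)
  then have "derivative_jet ((N + 2) + 2 * length js) Y F" by (simp add: add_ac)
  from Cons.IH[OF this]
  have IH: "derivative_jet (N + 2) Y (foldr (\<lambda>j. factor_jet (a j * real k * pi)) js F)"
    "\<And>y. y \<in> Y \<Longrightarrow> foldr (\<lambda>j. P_factor Y k (a j)) js v y
       = foldr (\<lambda>j. factor_jet (a j * real k * pi)) js F 0 y" by blast+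
  show ?case
    using derivative_jet_factor_jet[OF IH(1) assms(2), of "a j * real k * pi"]
      P_factor_eq[OF IH(1) assms(3) IH(2), of _ k "a j"] by simp
qed

context perfect_rectangle
begin

lemma L_factor_eq:
  assumes G: "decaying_jet (N + 2) Y G" and Y: "\<And>y. y \<in> Y \<Longrightarrow> locally_convex_at Y y"
    and "0 \<notin> Y"
    and u: "\<And>z. z \<in> X \<times> Y \<Longrightarrow> u z = sine_series G 0 0 z" and "z \<in> X \<times> Y"
  shows "L_factor (X \<times> Y) c u z = sine_series (factor_coeffs c G) 0 0 z"
proof -
  obtain x y where z: "z = (x, y)" "x \<in> X" "y \<in> Y" using assms(5) by auto
  note J = sine_series_jet[OF G Y, of X]
  have dx: "(deriv_x (X \<times> Y) ^^ 2) u (x, y) = sine_series G 2 0 (x, y)"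
    by (rule funpow_deriv_x_eq[OF J u]) (use z in auto)
  have dy: "(deriv_y (X \<times> Y) ^^ 2) u (x, y) = sine_series G 0 2 (x, y)"
    by (rule funpow_deriv_y_eq[OF J u]) (use z in auto)
  have "(\<lambda>k. c\<^sup>2 * (freq k ^ 2 * sin (freq k * x + real 2 * (pi / 2)) * G k 0 y)
      + sgn y * (freq k ^ 0 * sin (freq k * x + real 0 * (pi / 2)) * G k 2 y))
      sums (c\<^sup>2 * sine_series G 2 0 (x, y) + sgn y * sine_series G 0 2 (x, y))"
    by (intro sums_add sums_mult sine_series_sums[OF G]) (use z in auto)
  \<comment> \<open>Two quarter turns change the sign of the sine, so the second
    \<open>x\<close>-derivative multiplies the mode by \<open>- (freq k)\<^sup>2\<close>.\<close>
  moreover have "(\<lambda>k. c\<^sup>2 * (freq k ^ 2 * sin (freq k * x + real 2 * (pi / 2)) * G k 0 y)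
      + sgn y * (freq k ^ 0 * sin (freq k * x + real 0 * (pi / 2)) * G k 2 y))
    = (\<lambda>k. freq k ^ 0 * sin (freq k * x + real 0 * (pi / 2)) * factor_coeffs c G k 0 y)"
    by (rule ext) (simp add: factor_coeffs_def factor_jet_def algebra_simps power_mult_distrib sin_add eval_nat_numeral)
  moreover have "(\<lambda>k. freq k ^ 0 * sin (freq k * x + real 0 * (pi / 2)) * factor_coeffs c G k 0 y)
      sums sine_series (factor_coeffs c G) 0 0 (x, y)"
    by (rule sine_series_sums[OF decaying_jet_factor_coeffs[OF G assms(3)]]) (use z in auto)
  ultimately have "c\<^sup>2 * sine_series G 2 0 (x, y) + sgn y * sine_series G 0 2 (x, y)
      = sine_series (factor_coeffs c G) 0 0 (x, y)"
    by (simp only:) (rule sums_unique2)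
  then show ?thesis by (simp add: z L_factor_def dx dy)
qed

text \<open>A single family \<open>H\<close> describes both operators. If the one-dimensional
  equation holds in every mode, then \<open>H k 0\<close> is zero, and with it the image of the
  series.\<close>

lemma L_factors_eq:
  assumes "decaying_jet (N + 2 * length js) Y G" and Y: "\<And>y. y \<in> Y \<Longrightarrow> locally_convex_at Y y"
    and "0 \<notin> Y" and u: "\<And>z. z \<in> X \<times> Y \<Longrightarrow> u z = sine_series G 0 0 z"
    and v: "\<And>k y. y \<in> Y \<Longrightarrow> v k y = G k 0 y"
  shows "\<exists>H. decaying_jet N Y H
    \<and> (\<forall>z\<in>X \<times> Y. foldr (\<lambda>j. L_factor (X \<times> Y) (a j)) js u z = sine_series H 0 0 z)
    \<and> (\<forall>k. \<forall>y\<in>Y. foldr (\<lambda>j. P_factor Y (Suc k) (a j)) js (v k) y = H k 0 y)"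
  using assms(1)
proof (induction js arbitrary: N)
  case Nil
  then show ?case using u v by auto
next
  case (Cons j js)
  then have "decaying_jet ((N + 2) + 2 * length js) Y G" by (simp add: add_ac)
  from Cons.IH[OF this] obtain H where H: "decaying_jet (N + 2) Y H"
     "\<And>z. z \<in> X \<times> Y \<Longrightarrow> foldr (\<lambda>j. L_factor (X \<times> Y) (a j)) js u z = sine_series H 0 0 z"
     "\<And>k y. y \<in> Y \<Longrightarrow> foldr (\<lambda>j. P_factor Y (Suc k) (a j)) js (v k) y = H k 0 y"
    by blast
  have "derivative_jet (N + 2) Y (H k)" for k
    using H(1) by (simp add: decaying_jet_def)
  then have "P_factor Y (Suc k) (a j) (foldr (\<lambda>j. P_factor Y (Suc k) (a j)) js (v k)) y
      = factor_coeffs (a j) H k 0 y" if "y \<in> Y" for k y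
    using P_factor_eq[of N Y "H k", OF _ limpt_Y H(3) that, of "Suc k" "a j"]
    by (simp add: factor_coeffs_def freq_def mult_ac)
  then show ?case
    using decaying_jet_factor_coeffs[OF H(1) assms(3), of "a j"]
      L_factor_eq[OF H(1) Y assms(3) H(2), of _ "a j"]
    by (intro exI[of _ "factor_coeffs (a j) H"]) auto
qed

end

section \<open>Fourier sine expansions\<close>

text \<open>Up to sign these are the sines for even \<open>N\<close> and the cosines for odd
  \<open>N\<close>. After integrating by parts \<open>N\<close> times, exactly this system
  appears.\<close>

definition phase_sin :: "nat \<Rightarrow> nat \<Rightarrow> real \<Rightarrow> real" where
  "phase_sin N k x = sin (freq k * x + real N * (pi / 2))"

lemma continuous_phase_sin [continuous_intros]: "continuous_on S (phase_sin N k)"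
  unfolding phase_sin_def by (intro continuous_intros)

lemma has_integral_cos_affine:
  assumes "c \<noteq> (0 :: real)"
  shows "((\<lambda>x. cos (c * x + d)) has_integral (sin (c + d) - sin d) / c) {0..1}"
proof -
  have "((\<lambda>x. cos (c * x + d)) has_integral sin (c * 1 + d) / c - sin (c * 0 + d) / c) {0..1}"
    by (rule fundamental_theorem_of_calculus)
      (use assms in \<open>auto intro!: derivative_eq_intros simp: has_real_derivative_iff_has_vector_derivative[symmetric]\<close>)
  then show ?thesis by (simp add: diff_divide_distrib)
qed

text \<open>No constant function occurs among the cosines, as the frequencies start at
  \<open>pi\<close>; hence all squared norms are \<open>1 / 2\<close> for either parity of
  \<open>N\<close>.\<close>

lemma phase_sin_orthogonal:
  "((\<lambda>x. phase_sin N j x * phase_sin N k x) has_integral (if j = k then 1 / 2 else 0)) {0..1}"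
proof -
  have prod: "phase_sin N j x * phase_sin N k x
      = (cos ((freq j - freq k) * x + 0) - cos ((freq j + freq k) * x + real N * pi)) / 2" for x
    unfolding phase_sin_def by (subst sin_times_sin) (simp add: algebra_simps)
  have "(freq j + freq k) + real N * pi = pi * of_int (int (Suc j + Suc k + N))"
    by (simp add: freq_def algebra_simps)
  moreover have "real N * pi = pi * of_int (int N)" by simp
  ultimately have "sin ((freq j + freq k) + real N * pi) = 0" "sin (real N * pi) = 0"
    using sin_npi_int by metis+
  then have plus: "((\<lambda>x. cos ((freq j + freq k) * x + real N * pi)) has_integral 0) {0..1}"
    using has_integral_cos_affine[of "freq j + freq k" "real N * pi"] freq_ge_1[of j] freq_ge_1[of k]
    by auto
  have minus: "((\<lambda>x. cos ((freq j - freq k) * x + 0)) has_integral (if j = k then 1 else 0)) {0..1}"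
  proof (cases "j = k")
    case True
    then show ?thesis using has_integral_const_real[of "1::real" 0 1] by simp
  next
    case False
    have "freq j - freq k = pi * of_int (int j - int k)" by (simp add: freq_def algebra_simps)
    then have "sin (freq j - freq k) = 0" using sin_npi_int by metis
    moreover have "freq j - freq k \<noteq> 0" using False by (simp add: freq_def)
    ultimately show ?thesis
      using has_integral_cos_affine[of "freq j - freq k" 0] False by simp
  qed
  show ?thesis
    unfolding prod using has_integral_divide[OF has_integral_diff[OF minus plus], of 2]
    by (simp split: if_splits)
qed

text \<open>As the squared norms are \<open>1 / 2\<close>, the projection of \<open>g\<close> is
  \<open>2 * P\<close>. Expanding the integral of \<open>(g - 2 P)\<^sup>2 \<ge> 0\<close> even
  bounds twice the sum.\<close>

lemma bessel_inequality:
  fixes N :: nat and g :: "real \<Rightarrow> real"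
  assumes g: "continuous_on {0..1} g"
  defines "\<epsilon> \<equiv> \<lambda>k. integral {0..1} (\<lambda>x. g x * phase_sin N k x)"
  shows "(\<Sum>k<m. (\<epsilon> k)\<^sup>2) \<le> integral {0..1} (\<lambda>x. (g x)\<^sup>2)"
proof -
  define P where "P x = (\<Sum>k<m. \<epsilon> k * phase_sin N k x)" for x
  have gs: "((\<lambda>x. g x * phase_sin N k x) has_integral \<epsilon> k) {0..1}" for k
    unfolding \<epsilon>_def by (intro integrable_integral integrable_continuous_real continuous_intros g)
  have gg: "((\<lambda>x. (g x)\<^sup>2) has_integral integral {0..1} (\<lambda>x. (g x)\<^sup>2)) {0..1}"
    by (intro integrable_integral integrable_continuous_real continuous_intros g)
  have "((\<lambda>x. \<Sum>k<m. \<epsilon> k * (g x * phase_sin N k x)) has_integral (\<Sum>k<m. \<epsilon> k * \<epsilon> k)) {0..1}"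
    by (intro has_integral_sum has_integral_mult_right gs) auto
  then have gP: "((\<lambda>x. g x * P x) has_integral (\<Sum>k<m. (\<epsilon> k)\<^sup>2)) {0..1}"
    by (simp add: P_def sum_distrib_left mult_ac power2_eq_square)
  have sP: "((\<lambda>x. phase_sin N j x * P x) has_integral \<epsilon> j / 2) {0..1}" if "j < m" for j
  proof -
    have "((\<lambda>x. \<Sum>k<m. \<epsilon> k * (phase_sin N j x * phase_sin N k x)) has_integral
        (\<Sum>k<m. \<epsilon> k * (if j = k then 1 / 2 else 0))) {0..1}"
      by (intro has_integral_sum has_integral_mult_right phase_sin_orthogonal) auto
    moreover have "(\<Sum>k<m. \<epsilon> k * (if j = k then 1 / 2 else 0)) = \<epsilon> j / 2"
      using that by (simp add: if_distrib[of "\<lambda>t. _ * t"] sum.delta cong: if_cong)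
    ultimately show ?thesis by (simp add: P_def sum_distrib_left mult_ac)
  qed
  have "((\<lambda>x. \<Sum>j<m. \<epsilon> j * (phase_sin N j x * P x)) has_integral (\<Sum>j<m. \<epsilon> j * (\<epsilon> j / 2))) {0..1}"
    by (intro has_integral_sum has_integral_mult_right sP) auto
  moreover have "(\<Sum>j<m. \<epsilon> j * (phase_sin N j x * P x)) = (P x)\<^sup>2" for x
    by (simp add: P_def power2_eq_square sum_distrib_right mult.assoc)
  ultimately have PP: "((\<lambda>x. (P x)\<^sup>2) has_integral (\<Sum>k<m. (\<epsilon> k)\<^sup>2) / 2) {0..1}"
    by (simp add: sum_divide_distrib power2_eq_square)
  have "((\<lambda>x. (g x)\<^sup>2 - 4 * (g x * P x) + 4 * (P x)\<^sup>2) has_integral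
     integral {0..1} (\<lambda>x. (g x)\<^sup>2) - 4 * (\<Sum>k<m. (\<epsilon> k)\<^sup>2) + 4 * ((\<Sum>k<m. (\<epsilon> k)\<^sup>2) / 2)) {0..1}"
    by (intro has_integral_add has_integral_diff has_integral_mult_right gg gP PP)
  moreover have "0 \<le> (g x)\<^sup>2 - 4 * (g x * P x) + 4 * (P x)\<^sup>2" for x
    using zero_le_power2[of "g x - 2 * P x"] by (simp add: power2_eq_square algebra_simps)
  ultimately have "0 \<le> integral {0..1} (\<lambda>x. (g x)\<^sup>2) - 4 * (\<Sum>k<m. (\<epsilon> k)\<^sup>2) + 4 * ((\<Sum>k<m. (\<epsilon> k)\<^sup>2) / 2)"
    by (rule has_integral_nonneg)
  moreover have "0 \<le> (\<Sum>k<m. (\<epsilon> k)\<^sup>2)" by (simp add: sum_nonneg)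
  ultimately show ?thesis by simp
qed

text \<open>The last power of \<open>k\<close> is spent here: the product of a coefficient and
  \<open>1 / k\<close> is at most the sum of their squares, and both squares are summable.\<close>

lemma summable_coefficients_over_freq:
  assumes g: "continuous_on {0..1} g"
  shows "summable (\<lambda>k. \<bar>integral {0..1} (\<lambda>x. g x * phase_sin N k x)\<bar> / freq k)"
proof -
  let ?\<epsilon> = "\<lambda>k. integral {0..1} (\<lambda>x. g x * phase_sin N k x)"
  have "summable (\<lambda>k. (?\<epsilon> k)\<^sup>2)"
    by (rule summableI_nonneg_bounded[OF _ bessel_inequality[OF g]]) simp
  moreover have "summable (\<lambda>k. inverse (real (Suc k) ^ 2))"
    using inverse_power_summable[of 2, where 'a = real] summable_Suc_iff[of "\<lambda>n. inverse (real n ^ 2)"] by simp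
  ultimately have sm: "summable (\<lambda>k. (?\<epsilon> k)\<^sup>2 + inverse (real (Suc k) ^ 2))"
    by (rule summable_add)
  have "norm (\<bar>?\<epsilon> k\<bar> / freq k) \<le> (?\<epsilon> k)\<^sup>2 + inverse (real (Suc k) ^ 2)" for k
  proof -
    have le: "real (Suc k) \<le> freq k"
      using mult_right_mono[of 1 pi "real (Suc k)"] pi_gt3 by (simp add: freq_def)
    have "norm (\<bar>?\<epsilon> k\<bar> / freq k) = \<bar>?\<epsilon> k\<bar> * inverse (freq k)"
      using freq_ge_1[of k] by (simp add: divide_inverse)
    also have "\<dots> \<le> \<bar>?\<epsilon> k\<bar> * inverse (real (Suc k))"
      using le by (intro mult_left_mono le_imp_inverse_le) auto
    also have "\<dots> \<le> 2 * (\<bar>?\<epsilon> k\<bar> * inverse (real (Suc k)))" by simp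
    also have "\<dots> \<le> \<bar>?\<epsilon> k\<bar>\<^sup>2 + (inverse (real (Suc k)))\<^sup>2"
      using sum_squares_bound[of "\<bar>?\<epsilon> k\<bar>" "inverse (real (Suc k))"] by (simp only: mult.assoc)
    finally show ?thesis by (simp add: power_inverse)
  qed
  then show ?thesis by (intro summable_comparison_test'[OF sm, of 0])
qed

text \<open>The derivative of \<open>phase_sin (Suc s) k\<close> is
  \<open>- freq k * phase_sin s k\<close>. Each integration by parts thus adds a quarter turn,
  produces no sign, and has precisely the boundary term that is assumed to cancel.\<close>

lemma integral_sine_by_parts:
  assumes f: "Ck_on N {0..1} f"
    and bd: "\<And>s. s < N \<Longrightarrow> (deriv_on {0..1} ^^ s) f 1 * phase_sin (Suc s) k 1
        = (deriv_on {0..1} ^^ s) f 0 * phase_sin (Suc s) k 0"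
    and "s \<le> N"
  shows "freq k ^ s * integral {0..1} (\<lambda>x. f x * phase_sin 0 k x)
     = integral {0..1} (\<lambda>x. (deriv_on {0..1} ^^ s) f x * phase_sin s k x)"
  using assms(3)
proof (induction s)
  case (Suc s)
  let ?f = "(deriv_on {0..1} ^^ s) f" and ?f' = "(deriv_on {0..1} ^^ Suc s) f"
  have shift: "phase_sin (Suc s) k x = cos (freq k * x + real s * (pi / 2))" for x
    unfolding phase_sin_def by (rule sin_quarter_shift)
  have "((\<lambda>x. ?f x * phase_sin (Suc s) k x) has_real_derivative
      (?f' x * phase_sin (Suc s) k x - freq k * (?f x * phase_sin s k x))) (at x within {0..1})"
    if "x \<in> {0..1}" for x
  proof -
    have "(?f has_real_derivative ?f' x) (at x within {0..1})"
      using Suc.prems that by (intro Ck_on_has_derivative[OF f]) auto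
    then show ?thesis
      unfolding shift unfolding phase_sin_def by (auto intro!: derivative_eq_intros simp: algebra_simps)
  qed
  then have "((\<lambda>x. ?f' x * phase_sin (Suc s) k x - freq k * (?f x * phase_sin s k x)) has_integral
      ?f 1 * phase_sin (Suc s) k 1 - ?f 0 * phase_sin (Suc s) k 0) {0..1}"
    by (intro fundamental_theorem_of_calculus)
      (auto simp: has_real_derivative_iff_has_vector_derivative)
  then have "integral {0..1} (\<lambda>x. ?f' x * phase_sin (Suc s) k x - freq k * (?f x * phase_sin s k x)) = 0"
    using bd[of s] Suc.prems by (simp add: integral_unique)
  moreover have "continuous_on {0..1} ?f" "continuous_on {0..1} ?f'"
    using Suc.prems by (intro Ck_on_continuous[OF f]; simp)+
  ultimately have "integral {0..1} (\<lambda>x. ?f' x * phase_sin (Suc s) k x)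
      = freq k * integral {0..1} (\<lambda>x. ?f x * phase_sin s k x)"
    by (subst (asm) integral_diff)
      (auto intro!: integrable_continuous_real continuous_intros)
  then show ?case using Suc by simp
qed simp

lemma sine_coeff_eq: "sine_coeff f (Suc k) = sqrt 2 * integral {0..1} (\<lambda>x. f x * phase_sin 0 k x)"
  by (simp add: sine_coeff_def phase_sin_def freq_def)

text \<open>Of the \<open>N + 1\<close> powers gained by integration by parts, \<open>N\<close> form
  the weight and one pays for absolute summability.\<close>

lemma summable_weighted_sine_coeff:
  assumes f: "Ck_on (Suc N) {0..1} f"
    and bd: "\<And>s k. s < Suc N \<Longrightarrow> (deriv_on {0..1} ^^ s) f 1 * phase_sin (Suc s) k 1
        = (deriv_on {0..1} ^^ s) f 0 * phase_sin (Suc s) k 0"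
  shows "summable (\<lambda>k. freq k ^ N * \<bar>sine_coeff f (Suc k)\<bar>)"
proof -
  let ?g = "(deriv_on {0..1} ^^ Suc N) f"
  have "freq k ^ N * \<bar>sine_coeff f (Suc k)\<bar>
      = sqrt 2 * (\<bar>integral {0..1} (\<lambda>x. ?g x * phase_sin (Suc N) k x)\<bar> / freq k)" for k
  proof -
    have "integral {0..1} (\<lambda>x. ?g x * phase_sin (Suc N) k x)
        = freq k ^ Suc N * integral {0..1} (\<lambda>x. f x * phase_sin 0 k x)"
      by (rule integral_sine_by_parts[OF f _ order_refl, symmetric]) (rule bd)
    then show ?thesis
      using freq_ge_1[of k] unfolding sine_coeff_eq by (simp only: abs_mult) simp
  qed
  moreover have "continuous_on {0..1} ?g"
    by (rule Ck_on_continuous[OF f]) simp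
  ultimately show ?thesis
    using summable_coefficients_over_freq by (simp only:) (rule summable_mult)
qed

text \<open>Multiplying \<open>h\<close> by \<open>sin (pi * x)\<close> gives a function orthogonal
  to all polynomials in \<open>cos (pi * x)\<close>. The cosine separates the points of the
  interval, so by Stone-Weierstrass this function is orthogonal to itself and vanishes. Dividing by
  the sine is possible only in the interior.\<close>

lemma sine_system_complete:
  assumes h: "continuous_on {0..1} h"
    and zero: "\<And>k. integral {0..1} (\<lambda>x. h x * phase_sin 0 k x) = 0"
    and "x \<in> {0<..<1}"
  shows "h x = 0"
proof -
  define g where "g x = h x * sin (pi * x)" for x
  have g: "continuous_on {0..1} g"
    unfolding g_def by (intro continuous_intros h)
  \<comment> \<open>A factor \<open>cos (pi * x)\<close> replaces the sine of mode \<open>k\<close>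
    by the mean of its neighbours \<open>k + 1\<close> and \<open>k - 1\<close>; the induction on
    \<open>m\<close> therefore runs over all \<open>k\<close> at once.\<close>
  have "((\<lambda>x. h x * sin (pi * real k * x) * cos (pi * x) ^ m) has_integral 0) {0..1}" for m k
  proof (induction m arbitrary: k)
    case 0
    show ?case
    proof (cases k)
      case (Suc l)
      have "(\<lambda>x. h x * phase_sin 0 l x) integrable_on {0..1}"
        by (intro integrable_continuous_real continuous_intros h)
      then show ?thesis
        using zero[of l] Suc by (simp add: has_integral_integrable_integral phase_sin_def freq_def)
    qed simp
  next
    case (Suc m)
    show ?case
    proof (cases k)
      case (Suc l)
      have eq: "h x * sin (pi * real k * x) * cos (pi * x) ^ Suc m
          = (h x * sin (pi * real (l + 2) * x) * cos (pi * x) ^ m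
            + h x * sin (pi * real l * x) * cos (pi * x) ^ m) / 2" for x
      proof -
        define A where "A = pi * real k * x"
        have "pi * real (l + 2) * x = A + pi * x" "pi * real l * x = A - pi * x"
          by (simp_all add: A_def Suc algebra_simps)
        then have A: "sin (pi * real (l + 2) * x) = sin A * cos (pi * x) + cos A * sin (pi * x)"
          "sin (pi * real l * x) = sin A * cos (pi * x) - cos A * sin (pi * x)"
          by (simp_all only: sin_add sin_diff)
        show ?thesis
          unfolding A A_def[symmetric] by (simp add: algebra_simps)
      qed
      show ?thesis
        unfolding eq
        using has_integral_divide[OF has_integral_add[OF Suc.IH[of "l + 2"] Suc.IH[of l]], of 2]
        by (simp only: add_0_left div_0)
    qed simp
  qed
  from this[of 1] have mono: "((\<lambda>x. g x * cos (pi * x) ^ m) has_integral 0) {0..1}" for m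
    by (simp add: g_def)
  have poly: "((\<lambda>x. g x * poly p (cos (pi * x))) has_integral 0) {0..1}" for p
  proof -
    have "((\<lambda>x. \<Sum>m\<le>degree p. coeff p m * (g x * cos (pi * x) ^ m)) has_integral
        (\<Sum>m\<le>degree p. coeff p m * 0)) {0..1}"
      by (intro has_integral_sum has_integral_mult_right mono) auto
    then show ?thesis by (simp add: poly_altdef sum_distrib_left mult_ac)
  qed
  have gg: "((\<lambda>x. g x * g x) has_integral integral {0..1} (\<lambda>x. g x * g x)) {0..1}"
    by (intro integrable_integral integrable_continuous_real continuous_intros g)
  obtain B where "\<forall>x\<in>{0..1}. \<bar>g x\<bar> \<le> B"
    using compact_imp_bounded[OF compact_continuous_image[OF g compact_Icc]]
    by (auto simp: bounded_iff)
  then have B: "\<bar>g x\<bar> \<le> B" if "x \<in> {0..1}" for x using that by blast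
  \<comment> \<open>As \<open>g\<close> is orthogonal to the approximating polynomial
    \<open>q\<close>, the integral of \<open>g\<^sup>2\<close> equals that of
    \<open>g * (g - q)\<close>.\<close>
  have le: "integral {0..1} (\<lambda>x. g x * g x) \<le> B * e" if e: "e > 0" for e
  proof -
    have "\<exists>q. (\<exists>p. q = (\<lambda>x. poly p (cos (pi * x)))) \<and> (\<forall>x\<in>{0..1}. \<bar>g x - q x\<bar> < e)"
    proof (rule Stone_Weierstrass_HOL[OF compact_Icc _ _ _ _ _ g e])
      show "\<exists>p. (\<lambda>x. c) = (\<lambda>x. poly p (cos (pi * x)))" for c
        by (rule exI[of _ "[:c:]"]) simp
      show "continuous_on {0..1} q" if "\<exists>p. q = (\<lambda>x. poly p (cos (pi * x)))" for q
        using that by (auto intro!: continuous_intros)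
      show "\<exists>p. (\<lambda>x. f x + q x) = (\<lambda>x. poly p (cos (pi * x)))"
        if "(\<exists>p. f = (\<lambda>x. poly p (cos (pi * x)))) \<and> (\<exists>p. q = (\<lambda>x. poly p (cos (pi * x))))" for f q
      proof -
        from that obtain p r where "f = (\<lambda>x. poly p (cos (pi * x)))" "q = (\<lambda>x. poly r (cos (pi * x)))"
          by blast
        then have "(\<lambda>x. f x + q x) = (\<lambda>x. poly (p + r) (cos (pi * x)))" by simp
        then show ?thesis by blast
      qed
      show "\<exists>p. (\<lambda>x. f x * q x) = (\<lambda>x. poly p (cos (pi * x)))"
        if "(\<exists>p. f = (\<lambda>x. poly p (cos (pi * x)))) \<and> (\<exists>p. q = (\<lambda>x. poly p (cos (pi * x))))" for f q
      proof -
        from that obtain p r where "f = (\<lambda>x. poly p (cos (pi * x)))" "q = (\<lambda>x. poly r (cos (pi * x)))"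
          by blast
        then have "(\<lambda>x. f x * q x) = (\<lambda>x. poly (p * r) (cos (pi * x)))" by simp
        then show ?thesis by blast
      qed
      show "\<exists>f. (\<exists>p. f = (\<lambda>x. poly p (cos (pi * x)))) \<and> f x \<noteq> f y"
        if "x \<in> {0..1} \<and> y \<in> {0..1} \<and> x \<noteq> y" for x y
      proof -
        have "pi * x \<noteq> pi * y" "pi * x \<in> {0..pi}" "pi * y \<in> {0..pi}"
          using that mult_left_le[of x pi] mult_left_le[of y pi] by auto
        then have "cos (pi * x) \<noteq> cos (pi * y)"
          using cos_inj_pi[of "pi * x" "pi * y"] by auto
        then show ?thesis
          by (intro exI[of _ "\<lambda>x. cos (pi * x)"] conjI exI[of _ "[:0, 1:]"]) auto
      qed
    qed
    then obtain p where "\<forall>x\<in>{0..1}. \<bar>g x - poly p (cos (pi * x))\<bar> < e" by auto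
    then have p: "\<bar>g x - poly p (cos (pi * x))\<bar> < e" if "x \<in> {0..1}" for x using that by blast
    have "((\<lambda>x. g x * g x - g x * poly p (cos (pi * x))) has_integral
        (integral {0..1} (\<lambda>x. g x * g x) - 0)) {0..1}"
      by (intro has_integral_diff gg poly)
    moreover have "((\<lambda>x::real. B * e) has_integral B * e) {0..1}"
      using has_integral_const_real[of "B * e" 0 1] by simp
    moreover have "g x * g x - g x * poly p (cos (pi * x)) \<le> B * e" if "x \<in> {0..1}" for x
    proof -
      have "g x * g x - g x * poly p (cos (pi * x)) \<le> \<bar>g x\<bar> * \<bar>g x - poly p (cos (pi * x))\<bar>"
        by (metis abs_ge_self abs_mult right_diff_distrib)
      also have "\<dots> \<le> B * e"
        using B[OF that] p[OF that] by (intro mult_mono) (auto intro: order_trans[OF abs_ge_zero])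
      finally show ?thesis .
    qed
    ultimately have "integral {0..1} (\<lambda>x. g x * g x) - 0 \<le> B * e"
      by (rule has_integral_le)
    then show ?thesis by simp
  qed
  have "integral {0..1} (\<lambda>x. g x * g x) \<le> 0"
  proof (rule field_le_epsilon)
    fix e :: real assume "e > 0"
    have "B \<ge> 0" using B[of 0] by auto
    \<comment> \<open>Dividing by \<open>B + 1\<close> also covers \<open>B = 0\<close>.\<close>
    then have "B * (e / (B + 1)) \<le> e" using \<open>e > 0\<close> by (simp add: field_simps)
    moreover have "integral {0..1} (\<lambda>x. g x * g x) \<le> B * (e / (B + 1))"
      using \<open>e > 0\<close> \<open>B \<ge> 0\<close> by (intro le) simp
    ultimately show "integral {0..1} (\<lambda>x. g x * g x) \<le> 0 + e" by simp
  qed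
  moreover have "integral {0..1} (\<lambda>x. g x * g x) \<ge> 0"
    by (rule has_integral_nonneg[OF gg]) simp
  ultimately have "integral {0..1} (\<lambda>x. g x * g x) = 0" by (rule antisym)
  moreover have "continuous_on {0..1} (\<lambda>x. g x * g x)" by (intro continuous_intros g)
  ultimately have "\<forall>x\<in>{0..1}. g x * g x = 0"
    by (subst (asm) integral_eq_0_iff) simp_all
  moreover have "sin (pi * x) > 0"
    using assms(3) by (intro sin_gt_zero) auto
  ultimately show ?thesis
    using assms(3) by (auto simp: g_def)
qed

text \<open>Termwise integration shows that the sum \<open>F\<close> has the same sine coefficients
  as \<open>f\<close>, so completeness applies to \<open>f - F\<close>. At the end points both
  functions vanish.\<close>

lemma sine_series_expansion:
  assumes f: "continuous_on {0..1} f" and "f 0 = 0" "f 1 = 0"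
    and c: "summable (\<lambda>k. \<bar>sine_coeff f (Suc k)\<bar>)" and "x \<in> {0..1}"
  shows "(\<lambda>k. sin (freq k * x) * (sqrt 2 * sine_coeff f (Suc k))) sums f x"
proof -
  let ?b = "\<lambda>k. sqrt 2 * sine_coeff f (Suc k)"
  define F where "F x = (\<Sum>k. phase_sin 0 k x * ?b k)" for x
  have "norm (phase_sin 0 k x * ?b k) \<le> sqrt 2 * \<bar>sine_coeff f (Suc k)\<bar>" for k x
  proof -
    have "norm (phase_sin 0 k x * ?b k) = \<bar>phase_sin 0 k x\<bar> * (sqrt 2 * \<bar>sine_coeff f (Suc k)\<bar>)"
      by (simp add: abs_mult)
    also have "\<dots> \<le> 1 * (sqrt 2 * \<bar>sine_coeff f (Suc k)\<bar>)"
      by (intro mult_right_mono) (auto simp: phase_sin_def)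
    finally show ?thesis by simp
  qed
  note bound = this
  note sm = summable_mult[OF c, of "sqrt 2"]
  have ul: "uniform_limit A (\<lambda>m x. \<Sum>k<m. phase_sin 0 k x * ?b k) F sequentially" for A
    unfolding F_def by (rule Weierstrass_m_test[OF bound sm])
  have sums: "(\<lambda>k. phase_sin 0 k x * ?b k) sums F x" for x
    unfolding F_def by (intro summable_sums summable_comparison_test'[OF sm, of 0] bound)
  have F: "continuous_on {0..1} F"
    by (rule uniform_limit_theorem[OF _ ul]) (auto intro!: always_eventually continuous_intros)
  have "integral {0..1} (\<lambda>x. F x * phase_sin 0 j x) = ?b j / 2" for j
  proof -
    have "uniform_limit {0..1} (\<lambda>m x. (\<Sum>k<m. phase_sin 0 k x * ?b k) * phase_sin 0 j x)
        (\<lambda>x. F x * phase_sin 0 j x) sequentially"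
    proof (rule uniform_lim_mult[OF ul uniform_limit_const])
      show "bounded (F ` {0..1})"
        by (intro compact_imp_bounded compact_continuous_image F compact_Icc)
      show "bounded (phase_sin 0 j ` {0..1})"
        by (intro compact_imp_bounded compact_continuous_image compact_Icc continuous_intros)
    qed
    then obtain I J where IJ: "\<And>m. ((\<lambda>x. (\<Sum>k<m. phase_sin 0 k x * ?b k) * phase_sin 0 j x) has_integral I m) {0..1}"
       "((\<lambda>x. F x * phase_sin 0 j x) has_integral J) {0..1}" "I \<longlonglongrightarrow> J"
      by (rule uniform_limit_integral) (auto intro!: continuous_intros)
    \<comment> \<open>By orthogonality only the term \<open>k = j\<close> contributes, so the
      integrals are constant once the partial sum contains it.\<close>
    have "I m = ?b j / 2" if "m > j" for m
    proof -
      have "((\<lambda>x. \<Sum>k<m. ?b k * (phase_sin 0 k x * phase_sin 0 j x)) has_integral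
          (\<Sum>k<m. ?b k * (if k = j then 1 / 2 else 0))) {0..1}"
        by (intro has_integral_sum has_integral_mult_right phase_sin_orthogonal) auto
      moreover have "(\<Sum>k<m. ?b k * (if k = j then 1 / 2 else 0)) = ?b j / 2"
        using that by (simp add: if_distrib[of "\<lambda>t. _ * t"] sum.delta' cong: if_cong)
      moreover have "(\<Sum>k<m. ?b k * (phase_sin 0 k x * phase_sin 0 j x))
          = (\<Sum>k<m. phase_sin 0 k x * ?b k) * phase_sin 0 j x" for x
        by (simp add: sum_distrib_left mult_ac)
      ultimately have "((\<lambda>x. (\<Sum>k<m. phase_sin 0 k x * ?b k) * phase_sin 0 j x) has_integral ?b j / 2) {0..1}"
        by (simp only:)
      then show ?thesis using IJ(1)[of m] has_integral_unique by blast
    qed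
    then have "I \<longlonglongrightarrow> ?b j / 2"
      by (intro tendsto_eventually eventually_sequentiallyI[of "Suc j"]) auto
    then show ?thesis using IJ LIMSEQ_unique by (metis integral_unique)
  qed
  then have "integral {0..1} (\<lambda>x. F x * phase_sin 0 j x) = integral {0..1} (\<lambda>x. f x * phase_sin 0 j x)" for j
    by (simp add: sine_coeff_eq flip: mult.assoc)
  then have "integral {0..1} (\<lambda>x. (f x - F x) * phase_sin 0 j x) = 0" for j
    unfolding left_diff_distrib
    by (subst integral_diff) (auto intro!: integrable_continuous_real continuous_intros f F)
  then have "f x - F x = 0" if "x \<in> {0<..<1}" for x
    using that by (intro sine_system_complete[of "\<lambda>x. f x - F x"] continuous_intros f F) auto
  moreover have "F 0 = 0" "F 1 = 0"
    by (auto simp: F_def phase_sin_def freq_def simp flip: of_nat_Suc)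
  ultimately have "f x = F x"
    using assms(2,3,5) by (cases "x = 0 \<or> x = 1") auto
  then show ?thesis using sums[of x] by (simp add: phase_sin_def)
qed

section \<open>Constant coefficient equations\<close>

text \<open>The equation has two first integrals,
  \<open>(f1 + \<nu> * f0) * exp (- \<nu> * y)\<close> for \<open>\<nu> = \<mu>\<close> and for
  \<open>\<nu> = - \<mu>\<close>. Since \<open>\<mu>\<close> is nonzero, \<open>f0\<close> can be
  solved from them.\<close>

lemma second_order_solution:
  fixes f0 f1 f2 :: "real \<Rightarrow> complex" and \<mu> :: complex
  assumes I: "open I" "convex I" and "\<mu> \<noteq> 0"
    and d0: "\<And>y. y \<in> I \<Longrightarrow> (f0 has_vector_derivative f1 y) (at y)"
    and d1: "\<And>y. y \<in> I \<Longrightarrow> (f1 has_vector_derivative f2 y) (at y)"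
    and eq: "\<And>y. y \<in> I \<Longrightarrow> f2 y = \<mu>\<^sup>2 * f0 y"
  shows "\<exists>A B. \<forall>y\<in>I. f0 y = A * exp (\<mu> * of_real y) + B * exp (- \<mu> * of_real y)"
proof -
  have const: "\<exists>c. \<forall>y\<in>I. (f1 y + \<nu> * f0 y) * exp (- \<nu> * of_real y) = c" if "\<nu>\<^sup>2 = \<mu>\<^sup>2" for \<nu>
  proof -
    have "((\<lambda>y. (f1 y + \<nu> * f0 y) * exp (- \<nu> * of_real y)) has_vector_derivative 0) (at y within I)"
      if "y \<in> I" for y
    proof -
      have e: "((\<lambda>y. exp (- \<nu> * of_real y)) has_vector_derivative (- \<nu> * exp (- \<nu> * of_real y))) (at y)"
        by (rule has_vector_derivative_real_field) (auto intro!: derivative_eq_intros)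
      have "((\<lambda>y. (f1 y + \<nu> * f0 y) * exp (- \<nu> * of_real y)) has_vector_derivative
          (f1 y + \<nu> * f0 y) * (- \<nu> * exp (- \<nu> * of_real y)) + (f2 y + \<nu> * f1 y) * exp (- \<nu> * of_real y)) (at y)"
        by (intro has_vector_derivative_mult has_vector_derivative_add has_vector_derivative_mult_right
            d0 d1 that e)
      moreover have "(f1 y + \<nu> * f0 y) * (- \<nu> * exp (- \<nu> * of_real y)) + (f2 y + \<nu> * f1 y) * exp (- \<nu> * of_real y)
         = (f2 y - \<nu>\<^sup>2 * f0 y) * exp (- \<nu> * of_real y)"
        by (simp add: algebra_simps power2_eq_square)
      ultimately show ?thesis
        using eq[OF that] \<open>\<nu>\<^sup>2 = \<mu>\<^sup>2\<close> by (auto intro: has_vector_derivative_at_within)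
    qed
    then obtain c where "\<And>y. y \<in> I \<Longrightarrow> (f1 y + \<nu> * f0 y) * exp (- \<nu> * of_real y) = c"
      by (rule has_vector_derivative_zero_constant[OF I(2)]) auto
    then show ?thesis by blast
  qed
  obtain c where c: "\<And>y. y \<in> I \<Longrightarrow> (f1 y + \<mu> * f0 y) * exp (- \<mu> * of_real y) = c"
    using const[of \<mu>] by auto
  obtain d where d: "\<And>y. y \<in> I \<Longrightarrow> (f1 y + - \<mu> * f0 y) * exp (- (- \<mu>) * of_real y) = d"
    using const[of "- \<mu>"] by auto
  have "f0 y = c / (2 * \<mu>) * exp (\<mu> * of_real y) + (- d / (2 * \<mu>)) * exp (- \<mu> * of_real y)"
    if "y \<in> I" for y
  proof -
    have "exp (- \<mu> * of_real y) * exp (\<mu> * of_real y) = 1"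
      by (simp flip: exp_add)
    then have "c * exp (\<mu> * of_real y) = f1 y + \<mu> * f0 y" "d * exp (- \<mu> * of_real y) = f1 y - \<mu> * f0 y"
      using c[OF that] d[OF that] by (auto simp: mult.assoc mult.commute[of "exp (\<mu> * _)"])
    then have "c * exp (\<mu> * of_real y) - d * exp (- \<mu> * of_real y) = 2 * \<mu> * f0 y"
      by (simp add: algebra_simps)
    then show ?thesis
      using \<open>\<mu> \<noteq> 0\<close> by (simp add: field_simps)
  qed
  then show ?thesis by blast
qed

text \<open>The complex form of \<open>factor_jet\<close> on one side of 0: \<open>\<sigma>\<close>
  is the sign of \<open>y\<close>, and \<open>\<mu>\<close> is chosen with
  \<open>\<sigma> * \<mu>\<^sup>2 = l\<^sup>2\<close>.\<close>

definition exp_op :: "complex \<Rightarrow> complex \<Rightarrow> (nat \<Rightarrow> real \<Rightarrow> complex) \<Rightarrow> nat \<Rightarrow> real \<Rightarrow> complex" where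
  "exp_op \<sigma> \<mu> f = (\<lambda>j y. \<sigma> * (f (j + 2) y - \<mu>\<^sup>2 * f j y))"

definition exp_jet :: "complex \<Rightarrow> complex \<Rightarrow> complex \<Rightarrow> nat \<Rightarrow> real \<Rightarrow> complex" where
  "exp_jet \<mu> A B = (\<lambda>j y. A * \<mu> ^ j * exp (\<mu> * of_real y) + B * (- \<mu>) ^ j * exp (- \<mu> * of_real y))"

lemma exp_jet_has_derivative:
  "(exp_jet \<mu> A B j has_vector_derivative exp_jet \<mu> A B (Suc j) y) (at y within S)"
proof -
  have "((\<lambda>y. exp (\<nu> * of_real y)) has_vector_derivative (\<nu> * exp (\<nu> * of_real y))) (at y within S)" for \<nu> :: complex
    by (rule has_vector_derivative_real_field) (auto intro!: derivative_eq_intros)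
  then have "(exp_jet \<mu> A B j has_vector_derivative
      A * \<mu> ^ j * (\<mu> * exp (\<mu> * of_real y)) + B * (- \<mu>) ^ j * (- \<mu> * exp (- \<mu> * of_real y))) (at y within S)"
    unfolding exp_jet_def by (intro has_vector_derivative_add has_vector_derivative_mult_right)
  then show ?thesis by (simp add: exp_jet_def mult_ac)
qed

text \<open>Only the square of \<open>\<nu>\<close> enters, so both exponentials are eigenfunctions
  with the same eigenvalue.\<close>

lemma foldr_exp_op_exp_jet:
  "foldr (\<lambda>i. exp_op \<sigma> (\<mu> i)) is (exp_jet \<nu> A B) =
     exp_jet \<nu> (prod_list (map (\<lambda>i. \<sigma> * (\<nu>\<^sup>2 - (\<mu> i)\<^sup>2)) is) * A) (prod_list (map (\<lambda>i. \<sigma> * (\<nu>\<^sup>2 - (\<mu> i)\<^sup>2)) is) * B)"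
proof (induction "is")
  case (Cons i "is")
  have "exp_op \<sigma> (\<mu> i) (exp_jet \<nu> A' B') = exp_jet \<nu> (\<sigma> * (\<nu>\<^sup>2 - (\<mu> i)\<^sup>2) * A') (\<sigma> * (\<nu>\<^sup>2 - (\<mu> i)\<^sup>2) * B')" for A' B'
    by (intro ext) (simp add: exp_op_def exp_jet_def algebra_simps power2_eq_square)
  then show ?case by (simp add: Cons.IH mult.assoc)
qed simp

lemma foldr_exp_op_diff:
  "foldr (\<lambda>i. exp_op \<sigma> (\<mu> i)) is (\<lambda>j y. f j y - g j y) =
    (\<lambda>j y. foldr (\<lambda>i. exp_op \<sigma> (\<mu> i)) is f j y - foldr (\<lambda>i. exp_op \<sigma> (\<mu> i)) is g j y)"
  by (induction "is") (auto simp: exp_op_def algebra_simps)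

lemma foldr_exp_op_has_derivative:
  assumes "\<And>j y. j < m + 2 * length is \<Longrightarrow> y \<in> I \<Longrightarrow> (f j has_vector_derivative f (Suc j) y) (at y)"
    and "j < m" and "y \<in> I"
  shows "(foldr (\<lambda>i. exp_op \<sigma> (\<mu> i)) is f j has_vector_derivative
      foldr (\<lambda>i. exp_op \<sigma> (\<mu> i)) is f (Suc j) y) (at y)"
  using assms
proof (induction "is" arbitrary: m j y)
  case (Cons i "is")
  let ?g = "foldr (\<lambda>i. exp_op \<sigma> (\<mu> i)) is f"
  have g: "(?g j has_vector_derivative ?g (Suc j) y) (at y)" if "j < m + 2" "y \<in> I" for j y
    using Cons.prems that by (intro Cons.IH[of "m + 2"]) auto
  have "((\<lambda>y. \<sigma> * (?g (j + 2) y - (\<mu> i)\<^sup>2 * ?g j y)) has_vector_derivative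
      \<sigma> * (?g (Suc (j + 2)) y - (\<mu> i)\<^sup>2 * ?g (Suc j) y)) (at y)"
    using Cons.prems by (intro has_vector_derivative_mult_right has_vector_derivative_diff g) auto
  then show ?case by (simp add: exp_op_def[abs_def])
qed auto

text \<open>The outermost factor of the operator determines an exponential, which is subtracted from the
  solution after division by its (nonzero) eigenvalue under the remaining factors.\<close>

lemma exponential_solutions:
  fixes f :: "nat \<Rightarrow> real \<Rightarrow> complex" and \<sigma> :: complex
  assumes I: "open I" "convex I" and "\<sigma> \<noteq> 0"
    and "distinct is" and "inj_on (\<lambda>i. (\<mu> i)\<^sup>2) (set is)" and "\<And>i. i \<in> set is \<Longrightarrow> \<mu> i \<noteq> 0"
    and "\<And>j y. j < 2 * length is \<Longrightarrow> y \<in> I \<Longrightarrow> (f j has_vector_derivative f (Suc j) y) (at y)"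
    and "\<And>y. y \<in> I \<Longrightarrow> foldr (\<lambda>i. exp_op \<sigma> (\<mu> i)) is f 0 y = 0"
  shows "\<exists>A B. \<forall>y\<in>I. f 0 y = (\<Sum>i\<in>set is. exp_jet (\<mu> i) (A i) (B i) 0 y)"
  using assms(4-)
proof (induction "is" arbitrary: f)
  case Nil
  then show ?case by simp
next
  case (Cons i "is")
  let ?op = "foldr (\<lambda>i. exp_op \<sigma> (\<mu> i)) is"
  have op: "(?op f j has_vector_derivative ?op f (Suc j) y) (at y)" if "j < 2" "y \<in> I" for j y
    using Cons.prems(4) that by (intro foldr_exp_op_has_derivative[where m = 2 and I = I]) auto
  have "?op f 2 y = (\<mu> i)\<^sup>2 * ?op f 0 y" if "y \<in> I" for y
  proof -
    define g where "g = ?op f"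
    have "exp_op \<sigma> (\<mu> i) g 0 y = 0"
      using Cons.prems(5)[OF that] by (simp add: g_def)
    then show ?thesis
      using \<open>\<sigma> \<noteq> 0\<close> by (simp add: exp_op_def eval_nat_numeral flip: g_def)
  qed
  then obtain A B where AB: "\<And>y. y \<in> I \<Longrightarrow> ?op f 0 y = A * exp (\<mu> i * of_real y) + B * exp (- \<mu> i * of_real y)"
    using second_order_solution[OF I, of "\<mu> i" "?op f 0" "?op f 1" "?op f 2"]
      op[of 0] op[of 1] Cons.prems(3) by (auto simp: eval_nat_numeral)
  define \<kappa> where "\<kappa> = prod_list (map (\<lambda>l. \<sigma> * ((\<mu> i)\<^sup>2 - (\<mu> l)\<^sup>2)) is)"
  have "\<kappa> \<noteq> 0"
    using Cons.prems(1,2) \<open>\<sigma> \<noteq> 0\<close> by (auto simp: \<kappa>_def prod_list_zero_iff)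
  define h where "h = exp_jet (\<mu> i) (A / \<kappa>) (B / \<kappa>)"
  have "\<exists>A B. \<forall>y\<in>I. f 0 y - h 0 y = (\<Sum>i\<in>set is. exp_jet (\<mu> i) (A i) (B i) 0 y)"
  proof (rule Cons.IH)
    show "((\<lambda>y. f j y - h j y) has_vector_derivative f (Suc j) y - h (Suc j) y) (at y)"
      if "j < 2 * length is" "y \<in> I" for j y
      unfolding h_def using that Cons.prems(4)
      by (intro has_vector_derivative_diff exp_jet_has_derivative) auto
    show "?op (\<lambda>j y. f j y - h j y) 0 y = 0" if "y \<in> I" for y
      using AB[OF that] \<open>\<kappa> \<noteq> 0\<close>
      by (simp add: foldr_exp_op_diff h_def foldr_exp_op_exp_jet flip: \<kappa>_def) (simp add: exp_jet_def)
  qed (use Cons.prems in auto)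
  then obtain A' B' where
    AB': "\<And>y. y \<in> I \<Longrightarrow> f 0 y - h 0 y = (\<Sum>i\<in>set is. exp_jet (\<mu> i) (A' i) (B' i) 0 y)"
    by blast
  have "f 0 y = (\<Sum>l\<in>set (i # is). exp_jet (\<mu> l) ((A'(i := A / \<kappa>)) l) ((B'(i := B / \<kappa>)) l) 0 y)"
    if "y \<in> I" for y
  proof -
    have "(\<Sum>l\<in>set is. exp_jet (\<mu> l) ((A'(i := A / \<kappa>)) l) ((B'(i := B / \<kappa>)) l) 0 y)
        = (\<Sum>l\<in>set is. exp_jet (\<mu> l) (A' l) (B' l) 0 y)"
      using Cons.prems(1) by (intro sum.cong) auto
    then show ?thesis
      using AB'[OF that] Cons.prems(1) by (simp add: h_def algebra_simps)
  qed
  then show ?case by blast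
qed

section \<open>Estimates of the coefficients\<close>

lemma norm_det_le:
  fixes A :: "complex Matrix.mat"
  assumes A: "A \<in> carrier_mat N N" and b: "\<And>i j. i < N \<Longrightarrow> j < N \<Longrightarrow> norm (A $$ (i, j)) \<le> b"
  shows "norm (Determinant.det A) \<le> fact N * b ^ N"
proof -
  have "norm (signof p * (\<Prod>i = 0..<N. A $$ (i, p i))) \<le> b ^ N" if "p permutes {0..<N}" for p
  proof -
    have "(\<Prod>i = 0..<N. norm (A $$ (i, p i))) \<le> (\<Prod>i = 0..<N. b)"
      using permutes_in_image[OF that] by (intro prod_mono) (auto intro!: b)
    then show ?thesis by (simp add: norm_mult prod_norm sign_def)
  qed
  then have "norm (Determinant.det A) \<le> of_nat (card {p. p permutes {0..<N}}) * b ^ N"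
    unfolding det_def'[OF A] by (intro sum_norm_bound) auto
  then show ?thesis by (simp add: card_permutations)
qed

text \<open>Multiplying \<open>A * x\<close> by the adjugate gives \<open>det A * x\<close> without
  inverting \<open>A\<close>. The entries of the adjugate are cofactors, bounded by the Leibniz
  formula.\<close>

lemma cramer_bound:
  fixes A :: "complex Matrix.mat"
  assumes A: "A \<in> carrier_mat N N" and b: "\<And>i j. i < N \<Longrightarrow> j < N \<Longrightarrow> norm (A $$ (i, j)) \<le> b"
    and "b \<ge> 1" and "c < N"
  shows "norm (Determinant.det A) * norm (x c) \<le> fact N * b ^ N * (\<Sum>r<N. norm (\<Sum>c'<N. A $$ (r, c') * x c'))"
proof -
  let ?y = "\<lambda>r. \<Sum>c'<N. A $$ (r, c') * x c'"
  note adj = adj_mat[OF A]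
  have entry: "norm (adj_mat A $$ (c, r)) \<le> fact N * b ^ N" if "r < N" for r
  proof -
    have "norm (Determinant.det (mat_delete A r c)) \<le> fact (N - 1) * b ^ (N - 1)"
      using that assms(4) A by (intro norm_det_le) (auto simp: mat_delete_def intro!: b)
    also have "\<dots> \<le> fact N * b ^ N"
      using assms(3) by (intro mult_mono fact_mono power_increasing) auto
    finally show ?thesis
      using that assms(4) A by (simp add: adj_mat_def cofactor_def norm_mult norm_power)
  qed
  have prod: "(\<Sum>r<N. adj_mat A $$ (c, r) * A $$ (r, c')) = (if c = c' then Determinant.det A else 0)"
    if "c' < N" for c'
  proof -
    have "(adj_mat A * A) $$ (c, c') = (\<Sum>r<N. adj_mat A $$ (c, r) * A $$ (r, c'))"
      using adj(1) A assms(4) that by (auto simp: scalar_prod_def atLeast0LessThan intro!: sum.cong)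
    then show ?thesis using adj(3) assms(4) that by (cases "c = c'") auto
  qed
  have "Determinant.det A * x c = (\<Sum>c'<N. (if c = c' then Determinant.det A else 0) * x c')"
    using assms(4) by (simp add: if_distrib[of "\<lambda>t. t * _"] cong: if_cong)
  also have "\<dots> = (\<Sum>c'<N. \<Sum>r<N. adj_mat A $$ (c, r) * A $$ (r, c') * x c')"
    by (intro sum.cong) (auto simp: prod sum_distrib_right[symmetric])
  also have "\<dots> = (\<Sum>r<N. adj_mat A $$ (c, r) * ?y r)"
    by (subst sum.swap) (simp add: sum_distrib_left mult.assoc)
  finally have "norm (Determinant.det A) * norm (x c) = norm (\<Sum>r<N. adj_mat A $$ (c, r) * ?y r)"
    by (simp only: norm_mult[symmetric])
  also have "\<dots> \<le> (\<Sum>r<N. norm (adj_mat A $$ (c, r) * ?y r))"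
    by (rule norm_sum)
  also have "\<dots> \<le> (\<Sum>r<N. fact N * b ^ N * norm (?y r))"
    by (intro sum_mono) (auto simp: norm_mult intro!: mult_right_mono entry)
  finally show ?thesis by (simp add: sum_distrib_left)
qed

lemma sum_lessThan_add:
  fixes f :: "nat \<Rightarrow> 'a :: comm_monoid_add"
  shows "(\<Sum>c<n + m. f c) = (\<Sum>c<n. f c) + (\<Sum>c<m. f (n + c))"
  by (induction m) (auto simp: add.assoc)

text \<open>Mirrors the columns of \<open>Delta2\<close>: \<open>n\<close> single ones, followed by
  \<open>n\<close> interleaved pairs.\<close>

lemma sum_lessThan_double:
  fixes f :: "nat \<Rightarrow> 'a :: comm_monoid_add"
  shows "(\<Sum>c<n + 2 * m. f c) = (\<Sum>c<n. f c) + (\<Sum>s<m. f (n + 2 * s) + f (n + 2 * s + 1))"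
  by (induction m) (auto simp: add.assoc)

text \<open>Here \<open>e s\<close> and \<open>e' s\<close> are the values at \<open>-1\<close> of the two oscillating exponentials.\<close>

lemma Delta2_bound:
  fixes n k :: nat and a :: "nat \<Rightarrow> real" and A C D :: "nat \<Rightarrow> complex"
  assumes R: "R \<ge> 1" "\<And>s. s \<in> {1..n} \<Longrightarrow> 0 < a s \<and> a s \<le> R"
  defines "e \<equiv> \<lambda>s. exp (- \<i> * of_real (pi * real k * a s))"
    and "e' \<equiv> \<lambda>s. exp (\<i> * of_real (pi * real k * a s))"
  assumes q: "\<And>m. m < n \<Longrightarrow> (\<Sum>s=1..n. of_real (a s ^ (2 * m)) * (C s * e s + D s * e' s)) = q m"
    and h: "\<And>t. t < 2 * n \<Longrightarrow> (\<Sum>s=1..n. of_real ((- a s) ^ t) * A s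
        - ((\<i> * of_real (a s)) ^ t * C s + (- \<i> * of_real (a s)) ^ t * D s)) = h t"
    and s: "s \<in> {1..n}" and X: "X \<in> {A s, C s, D s}"
  shows "norm (Delta2 n a k) * norm X
    \<le> fact (3 * n) * (R ^ (2 * n)) ^ (3 * n) * ((\<Sum>m<n. norm (q m)) + (\<Sum>t<2 * n. norm (h t)))"
proof -
  define B where "B = Matrix.mat (3 * n) (3 * n) (\<lambda>(r, c).
     if c < n then p_entry n a (c + 1) r
     else if even (c - n) then q_pos_entry n a k ((c - n) div 2 + 1) r
     else q_neg_entry n a k ((c - n) div 2 + 1) r)"
  \<comment> \<open>The matching condition equates the two sides of 0, whereas the matrix has the
    \<open>q\<close> columns with a positive sign. Hence \<open>C\<close> and \<open>D\<close> enter
    negatively, and the first \<open>n\<close> rows return \<open>- q m\<close>.\<close>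
  define x where "x c = (if c < n then A (c + 1)
     else if even (c - n) then - C ((c - n) div 2 + 1) else - D ((c - n) div 2 + 1))" for c
  have B: "B \<in> carrier_mat (3 * n) (3 * n)" by (simp add: B_def)
  have det: "norm (Delta2 n a k) \<le> norm (Determinant.det B)"
  proof -
    have "norm (Delta2 n a k) = (1 / 2) ^ n * norm (Determinant.det B)"
      by (simp add: Delta2_def B_def norm_mult norm_power norm_divide)
    also have "\<dots> \<le> 1 * norm (Determinant.det B)"
      by (intro mult_right_mono power_le_one) auto
    finally show ?thesis by simp
  qed
  have powR: "a s ^ t \<le> R ^ (2 * n)" if "s \<in> {1..n}" "t \<le> 2 * n" for s t
  proof -
    have "a s ^ t \<le> R ^ t" using R(2)[OF that(1)] by (intro power_mono) auto
    also have "\<dots> \<le> R ^ (2 * n)" using R(1) that(2) by (intro power_increasing)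
    finally show ?thesis .
  qed
  have pabs: "\<bar>a s\<bar> ^ t \<le> R ^ (2 * n)" if "s \<in> {1..n}" "t \<le> 2 * n" for s t
    using powR[OF that] R(2)[OF that(1)] by simp
  have B_le: "norm (B $$ (i, j)) \<le> R ^ (2 * n)" if "i < 3 * n" "j < 3 * n" for i j
  proof -
    have "0 \<le> R ^ (2 * n)" using R(1) by simp
    have p: "norm (p_entry n a s i) \<le> R ^ (2 * n)" "norm (q_pos_entry n a k s i) \<le> R ^ (2 * n)"
      "norm (q_neg_entry n a k s i) \<le> R ^ (2 * n)" if "s \<in> {1..n}" for s
      using \<open>0 \<le> R ^ (2 * n)\<close> pabs[OF that, of "i - n"] powR[OF that, of "2 * i"] \<open>i < 3 * n\<close>
        R(2)[OF that]
      by (auto simp: p_entry_def q_pos_entry_def q_neg_entry_def norm_mult norm_power power_abs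
          simp flip: of_real_power)
    then show ?thesis using that by (auto simp: B_def)
  qed
  have row: "(\<Sum>c<3 * n. B $$ (r, c) * x c) = (\<Sum>s=1..n. p_entry n a s r * A s
      - (q_pos_entry n a k s r * C s + q_neg_entry n a k s r * D s))" if "r < 3 * n" for r
  proof -
    have "(\<Sum>c<n + 2 * n. B $$ (r, c) * x c) = (\<Sum>c<n. p_entry n a (Suc c) r * A (Suc c))
        + (\<Sum>s<n. - (q_pos_entry n a k (Suc s) r * C (Suc s)) + - (q_neg_entry n a k (Suc s) r * D (Suc s)))"
      unfolding sum_lessThan_double
      using that by (intro arg_cong2[of _ _ _ _ "(+)"] sum.cong) (auto simp: B_def x_def)
    also have "\<dots> = (\<Sum>s<n. p_entry n a (Suc s) r * A (Suc s)
      - (q_pos_entry n a k (Suc s) r * C (Suc s) + q_neg_entry n a k (Suc s) r * D (Suc s)))"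
      by (simp add: sum_subtractf sum.distrib sum_negf)
    finally show ?thesis by (simp add: sum.atLeast1_atMost_eq)
  qed
  have "(\<Sum>r<3 * n. norm (\<Sum>c<3 * n. B $$ (r, c) * x c)) = (\<Sum>m<n. norm (q m)) + (\<Sum>t<2 * n. norm (h t))"
  proof -
    have "(\<Sum>c<3 * n. B $$ (m, c) * x c) = - q m" if "m < n" for m
    proof -
      have "(\<Sum>c<3 * n. B $$ (m, c) * x c)
          = (\<Sum>s=1..n. - (of_real (a s ^ (2 * m)) * (C s * e s + D s * e' s)))"
        using that by (subst row)
          (auto simp: p_entry_def q_pos_entry_def q_neg_entry_def e_def e'_def algebra_simps intro!: sum.cong)
      then show ?thesis by (simp only: sum_negf q[OF that])
    qed
    moreover have "(\<Sum>c<3 * n. B $$ (n + t, c) * x c) = h t" if "t < 2 * n" for t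
      using that by (subst row)
        (simp_all add: p_entry_def q_pos_entry_def q_neg_entry_def flip: h)
    moreover have "(\<Sum>r<n + 2 * n. norm (\<Sum>c<3 * n. B $$ (r, c) * x c))
        = (\<Sum>m<n. norm (\<Sum>c<3 * n. B $$ (m, c) * x c)) + (\<Sum>t<2 * n. norm (\<Sum>c<3 * n. B $$ (n + t, c) * x c))"
      by (rule sum_lessThan_add)
    ultimately show ?thesis by simp
  qed
  then have cr: "norm (Determinant.det B) * norm (x c) \<le>
      fact (3 * n) * (R ^ (2 * n)) ^ (3 * n) * ((\<Sum>m<n. norm (q m)) + (\<Sum>t<2 * n. norm (h t)))" if "c < 3 * n" for c
    using cramer_bound[OF B B_le _ that, of x] R(1) one_le_power by simp
  obtain i where i: "s = Suc i" "i < n" using s by (cases s) auto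
  have "norm X \<in> {norm (x i), norm (x (n + 2 * i)), norm (x (n + 2 * i + 1))}"
    using X i by (auto simp: x_def)
  then obtain c where "c < 3 * n" "norm X = norm (x c)"
    using i(2) by (elim insertE emptyE) (rule that; simp)+
  then show ?thesis
    using cr mult_right_mono[OF det, of "norm X"] by force
qed

text \<open>The Lagrange polynomial \<open>L s\<close> is 1 at \<open>b s\<close> and 0 at the other
  nodes, so its coefficients recover \<open>z s\<close> from the power sums. The constant depends on
  the nodes alone, and thus not on \<open>k\<close> in the application.\<close>

lemma vandermonde_bound:
  fixes b :: "nat \<Rightarrow> real"
  assumes "finite S" and "inj_on b S"
  shows "\<exists>V\<ge>0. \<forall>z :: nat \<Rightarrow> complex. \<forall>s\<in>S. norm (z s) \<le> V * (\<Sum>m<card S. norm (\<Sum>r\<in>S. of_real (b r ^ m) * z r))"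
proof -
  define L where "L s = (\<Prod>r\<in>S - {s}. [:- b r / (b s - b r), 1 / (b s - b r):])" for s
  have deg: "degree (L s) < card S" if "s \<in> S" for s
  proof -
    have "degree (L s) \<le> (\<Sum>r\<in>S - {s}. degree [:- b r / (b s - b r), 1 / (b s - b r):])"
      unfolding L_def using assms(1) by (intro degree_prod_sum_le[unfolded o_def]) simp
    also have "\<dots> \<le> (\<Sum>r\<in>S - {s}. 1)" by (intro sum_mono) auto
    also have "\<dots> < card S"
      using assms(1) that card_gt_0_iff[of S] by auto
    finally show ?thesis .
  qed
  have L: "poly (L s) (b r) = (if r = s then 1 else 0)" if "s \<in> S" "r \<in> S" for s r
  proof -
    have "b s \<noteq> b r" if "r \<in> S - {s}" for r
      using assms(2) that \<open>s \<in> S\<close> by (auto simp: inj_on_def)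
    moreover have "poly (L s) t = (\<Prod>r\<in>S - {s}. (t - b r) / (b s - b r))" for t
      by (simp add: L_def poly_prod diff_divide_distrib)
    ultimately show ?thesis
      using that assms(1) by (auto intro!: prod.neutral prod_zero bexI[of _ r])
  qed
  define V where "V = (\<Sum>s\<in>S. \<Sum>m<card S. \<bar>coeff (L s) m\<bar>)"
  have "norm (z s) \<le> V * (\<Sum>m<card S. norm (\<Sum>r\<in>S. of_real (b r ^ m) * z r))" if s: "s \<in> S" for z :: "nat \<Rightarrow> complex" and s
  proof -
    let ?y = "\<lambda>m. \<Sum>r\<in>S. of_real (b r ^ m) * z r"
    have "{..degree (L s)} \<subseteq> {..<card S}" using deg[OF s] by auto
    have ev: "poly (L s) t = (\<Sum>m<card S. coeff (L s) m * t ^ m)" for t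
      using poly_altdef[of "L s" t] \<open>{..degree (L s)} \<subseteq> {..<card S}\<close>
        sum.mono_neutral_left[of "{..<card S}" "{..degree (L s)}" "\<lambda>m. coeff (L s) m * t ^ m"]
      by (auto simp: coeff_eq_0)
    have "z s = (\<Sum>r\<in>S. of_real (poly (L s) (b r)) * z r)"
      using assms(1) s by (simp add: L if_distrib[of "\<lambda>t. of_real t * _"] cong: if_cong)
    also have "\<dots> = (\<Sum>r\<in>S. \<Sum>m<card S. of_real (coeff (L s) m) * (of_real (b r ^ m) * z r))"
      by (simp add: ev sum_distrib_right mult.assoc)
    also have "\<dots> = (\<Sum>m<card S. of_real (coeff (L s) m) * ?y m)"
      by (subst sum.swap) (simp add: sum_distrib_left)
    finally have "norm (z s) \<le> (\<Sum>m<card S. \<bar>coeff (L s) m\<bar> * norm (?y m))"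
      by (metis (mono_tags, lifting) norm_mult norm_of_real norm_sum sum.cong)
    also have "\<dots> \<le> (\<Sum>m<card S. V * norm (?y m))"
    proof (intro sum_mono mult_right_mono)
      fix m assume m: "m \<in> {..<card S}"
      have "\<bar>coeff (L s) m\<bar> \<le> (\<Sum>m<card S. \<bar>coeff (L s) m\<bar>)"
        using m by (intro member_le_sum) auto
      also have "\<dots> \<le> V"
        unfolding V_def using s assms(1) by (intro member_le_sum) (auto intro: sum_nonneg)
      finally show "\<bar>coeff (L s) m\<bar> \<le> V" .
    qed auto
    finally show ?thesis by (simp add: sum_distrib_left)
  qed
  moreover have "V \<ge> 0" by (auto simp: V_def intro!: sum_nonneg)
  ultimately show ?thesis by blast
qed

text \<open>A Vandermonde system in the \<open>a\<^sub>s\<^sup>2\<close> determines the coefficients \<open>B\<close> up to an exponentially small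
  multiple of \<open>A\<close>, and Cramer's rule for the matrix of \<open>Delta2\<close> determines \<open>A\<close>, \<open>C\<close>, \<open>D\<close> up to an
  exponentially small multiple of \<open>B\<close>. The factor \<open>k\<^sup>\<gamma>\<close> lost by dividing by \<open>Delta2\<close> does not spoil
  the smallness, so the two estimates can be combined for large \<open>k\<close>.\<close>

lemma coefficient_bound:
  fixes n :: nat and a :: "nat \<Rightarrow> real" and M \<gamma> :: real
  assumes pos: "\<And>s. s \<in> {1..n} \<Longrightarrow> 0 < a s" and inj: "inj_on a {1..n}"
    and M: "M > 0" and "\<gamma> \<ge> 0"
    and Delta: "\<forall>\<^sub>F k in sequentially. norm (Delta2 n a k) > M / real k powr \<gamma>"
  shows "\<exists>K. \<forall>\<^sub>F k in sequentially. \<forall>A B C D p q.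
      (\<forall>m<n. (\<Sum>s=1..n. of_real (a s ^ (2 * m)) * (A s * of_real (exp (- (pi * real k * a s))) + B s)) = p m) \<longrightarrow>
      (\<forall>m<n. (\<Sum>s=1..n. of_real (a s ^ (2 * m)) * (C s * exp (- \<i> * of_real (pi * real k * a s))
          + D s * exp (\<i> * of_real (pi * real k * a s)))) = q m) \<longrightarrow>
      (\<forall>t<2 * n. (\<Sum>s=1..n. of_real ((- a s) ^ t) * A s + of_real (a s ^ t * exp (- (pi * real k * a s))) * B s)
          = (\<Sum>s=1..n. (\<i> * of_real (a s)) ^ t * C s + (- \<i> * of_real (a s)) ^ t * D s)) \<longrightarrow>
      (\<Sum>s=1..n. norm (A s) + norm (B s) + norm (C s) + norm (D s :: complex))
        \<le> K * real k powr \<gamma> * ((\<Sum>m<n. norm (p m)) + (\<Sum>m<n. norm (q m)))"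
proof -
  define R where "R = 1 + (\<Sum>s=1..n. a s)"
  have "0 \<le> (\<Sum>s=1..n. a s)" by (rule sum_nonneg) (use pos less_imp_le in blast)
  then have R1: "R \<ge> 1" by (simp add: R_def)
  have R: "0 < a s \<and> a s \<le> R" if "s \<in> {1..n}" for s
  proof -
    have "a s \<le> (\<Sum>s=1..n. a s)"
      using pos that by (intro member_le_sum) (auto intro: less_imp_le)
    then show ?thesis using pos[OF that] by (simp add: R_def)
  qed
  have "inj_on (\<lambda>s. (a s)\<^sup>2) {1..n}"
  proof (rule inj_onI)
    fix s r assume sr: "s \<in> {1..n}" "r \<in> {1..n}" "(a s)\<^sup>2 = (a r)\<^sup>2"
    then have "a s = a r"
      using pos[OF sr(1)] pos[OF sr(2)] power2_eq_iff_nonneg[of "a s" "a r"] by simp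
    then show "s = r" using inj_onD[OF inj] sr by blast
  qed
  from vandermonde_bound[OF finite_atLeastAtMost this] obtain V where V: "V \<ge> 0"
    "\<forall>z :: nat \<Rightarrow> complex. \<forall>s\<in>{1..n}. norm (z s) \<le>
       V * (\<Sum>m<card {1..n}. norm (\<Sum>r=1..n. of_real ((a r)\<^sup>2 ^ m) * z r))"
    by blast
  have Vz: "norm (z s) \<le> V * (\<Sum>m<n. norm (\<Sum>r=1..n. of_real (a r ^ (2 * m)) * z r))"
    if "s \<in> {1..n}" for z :: "nat \<Rightarrow> complex" and s
    using V(2)[rule_format, OF that, of z] by (simp add: power_mult)
  \<comment> \<open>\<open>K1\<close> is the constant of \<open>Delta2_bound\<close>,
    \<open>K2\<close> sums it over the \<open>3 n\<close> unknowns after division by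
    \<open>M\<close>, and \<open>K3\<close> sums the error \<open>R ^ (2 * n)\<close> over the
    \<open>2 n\<close> matching rows.\<close>
  define K1 where "K1 = fact (3 * n) * (R ^ (2 * n)) ^ (3 * n)"
  define K2 where "K2 = 3 * real n * K1 / M"
  define K3 where "K3 = 2 * real n * R ^ (2 * n)"
  define \<epsilon> where "\<epsilon> k = (\<Sum>s=1..n. exp (- (pi * real k * a s)))" for k
  have K: "K1 \<ge> 0" "K2 \<ge> 0" "K3 \<ge> 0" using R1 M by (auto simp: K1_def K2_def K3_def)
  \<comment> \<open>This is the factor with which the growing part acts on itself through both
    estimates. Exponential decay beats \<open>k powr \<gamma>\<close>, so it is eventually below
    \<open>1 / 2\<close>.\<close>
  have lim: "(\<lambda>k. K2 * K3 * (real k powr \<gamma> * \<epsilon> k)) \<longlonglongrightarrow> 0"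
  proof -
    have "(\<lambda>k. real k powr \<gamma> * exp (- (pi * real k * a s))) \<longlonglongrightarrow> 0" if "s \<in> {1..n}" for s
      using pos[OF that] by real_asymp
    then have "(\<lambda>k. K2 * K3 * (\<Sum>s=1..n. real k powr \<gamma> * exp (- (pi * real k * a s))))
        \<longlonglongrightarrow> K2 * K3 * (\<Sum>s=1..n. 0)"
      by (intro tendsto_mult_left tendsto_sum)
    then show ?thesis
      by (simp add: \<epsilon>_def sum_distrib_left)
  qed
  show ?thesis
  proof (intro exI eventually_mono[OF eventually_conj[OF Delta eventually_conj[OF
        order_tendstoD(2)[OF lim, of "1 / 2"] eventually_gt_at_top[of 0]]]] allI impI)
    fix k :: nat and A B C D p q :: "nat \<Rightarrow> complex"
    assume k: "M / real k powr \<gamma> < norm (Delta2 n a k) \<and> K2 * K3 * (real k powr \<gamma> * \<epsilon> k) < 1 / 2 \<and> 0 < k"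
    \<comment> \<open>The conditions at \<open>y = 1\<close>, at \<open>y = -1\<close> and at
      \<open>y = 0\<close>. \<open>A\<close> belongs to the decaying exponentials, \<open>B\<close>
      to the growing ones divided by their value at \<open>y = 1\<close>.\<close>
    assume p: "\<forall>m<n. (\<Sum>s=1..n. of_real (a s ^ (2 * m)) * (A s * of_real (exp (- (pi * real k * a s))) + B s)) = p m"
      and q: "\<forall>m<n. (\<Sum>s=1..n. of_real (a s ^ (2 * m)) * (C s * exp (- \<i> * of_real (pi * real k * a s))
          + D s * exp (\<i> * of_real (pi * real k * a s)))) = q m"
      and h: "\<forall>t<2 * n. (\<Sum>s=1..n. of_real ((- a s) ^ t) * A s + of_real (a s ^ t * exp (- (pi * real k * a s))) * B s)
          = (\<Sum>s=1..n. (\<i> * of_real (a s)) ^ t * C s + (- \<i> * of_real (a s)) ^ t * D s)"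
    \<comment> \<open>\<open>X\<close> collects the unknowns of the \<open>Delta2\<close> system and
      \<open>Y\<close> those of the Vandermonde system.\<close>
    define P Q X Y where "P = (\<Sum>m<n. norm (p m))" and "Q = (\<Sum>m<n. norm (q m))"
      and "X = (\<Sum>s=1..n. norm (A s) + norm (C s) + norm (D s))" and "Y = (\<Sum>s=1..n. norm (B s))"
    define g where "g = real k powr \<gamma>"
    have nonneg: "P \<ge> 0" "Q \<ge> 0" "X \<ge> 0" "Y \<ge> 0"
      by (auto simp: P_def Q_def X_def Y_def intro!: sum_nonneg add_nonneg_nonneg)
    have g: "g \<ge> 1" using k \<open>\<gamma> \<ge> 0\<close> by (simp add: g_def ge_one_powr_ge_zero)
    have e1: "exp (- (pi * real k * a s)) \<le> 1" if "s \<in> {1..n}" for s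
      using pos[OF that] by simp
    have e: "exp (- (pi * real k * a s)) \<le> \<epsilon> k" if "s \<in> {1..n}" for s
      unfolding \<epsilon>_def using that by (intro member_le_sum) auto
    have "Y \<le> real n * V * P + X"
    proof -
      have "norm (B s) \<le> V * P + (norm (A s) + norm (C s) + norm (D s))" if "s \<in> {1..n}" for s
      proof -
        have "norm (B s) \<le> norm (A s * of_real (exp (- (pi * real k * a s))) + B s)
            + norm (A s * of_real (exp (- (pi * real k * a s))))"
          by (metis add_diff_cancel_left' norm_triangle_ineq4)
        also have "norm (A s * of_real (exp (- (pi * real k * a s)))) \<le> norm (A s) * 1"
          unfolding norm_mult using e1[OF that] by (intro mult_left_mono) auto
        also have "norm (A s * of_real (exp (- (pi * real k * a s))) + B s) \<le> V * P"
          using Vz[OF that, of "\<lambda>s. A s * of_real (exp (- (pi * real k * a s))) + B s"] p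
          by (simp add: P_def)
        finally show ?thesis
          using norm_ge_zero[of "C s"] norm_ge_zero[of "D s"] by linarith
      qed
      then have "Y \<le> (\<Sum>s=1..n. V * P + (norm (A s) + norm (C s) + norm (D s)))"
        unfolding Y_def by (rule sum_mono)
      then show ?thesis by (simp add: X_def sum.distrib)
    qed
    moreover have "X \<le> K2 * g * (Q + K3 * \<epsilon> k * Y)"
    proof -
      \<comment> \<open>The exponentially small contribution of \<open>B\<close> to the matching
        conditions, treated as a right-hand side.\<close>
      define b where "b t = - (\<Sum>s=1..n. of_real (a s ^ t * exp (- (pi * real k * a s))) * B s)" for t
      have b: "norm (b t) \<le> R ^ (2 * n) * (\<epsilon> k * Y)" if "t < 2 * n" for t
      proof -
        have "norm (of_real (a s ^ t * exp (- (pi * real k * a s))) * B s) \<le> R ^ (2 * n) * \<epsilon> k * norm (B s)"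
          if "s \<in> {1..n}" for s
        proof -
          have "a s ^ t \<le> R ^ t" using R[OF that] by (intro power_mono) auto
          also have "\<dots> \<le> R ^ (2 * n)" using R1 \<open>t < 2 * n\<close> by (intro power_increasing) auto
          finally have "a s ^ t * exp (- (pi * real k * a s)) \<le> R ^ (2 * n) * \<epsilon> k"
            using R[OF that] R1 by (intro mult_mono e[OF that]) auto
          moreover have "0 \<le> a s ^ t * exp (- (pi * real k * a s))"
            using R[OF that] by simp
          ultimately have "norm (of_real (a s ^ t * exp (- (pi * real k * a s))) :: complex) \<le> R ^ (2 * n) * \<epsilon> k"
            by (simp only: norm_of_real abs_of_nonneg)
          then show ?thesis
            unfolding norm_mult[of _ "B s"] by (rule mult_right_mono) simp
        qed
        then have "norm (b t) \<le> (\<Sum>s=1..n. R ^ (2 * n) * \<epsilon> k * norm (B s))"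
          unfolding b_def norm_minus_cancel by (rule sum_norm_le)
        then show ?thesis by (simp add: Y_def sum_distrib_left mult.assoc)
      qed
      have h': "(\<Sum>s=1..n. of_real ((- a s) ^ t) * A s
        - ((\<i> * of_real (a s)) ^ t * C s + (- \<i> * of_real (a s)) ^ t * D s)) = b t" if "t < 2 * n" for t
        using h that by (simp add: b_def sum_subtractf sum.distrib algebra_simps)
      define T where "T = (\<Sum>t<2 * n. norm (b t))"
      have T: "T \<le> K3 * \<epsilon> k * Y"
        using sum_bounded_above[of "{..<2 * n}" "\<lambda>t. norm (b t)" "R ^ (2 * n) * (\<epsilon> k * Y)"] b
        by (simp add: T_def K3_def mult_ac)
      define W where "W = g / M * K1 * (Q + T)"
      have Z: "norm Z \<le> W" if "s \<in> {1..n}" "Z \<in> {A s, C s, D s}" for s Z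
      proof -
        have "norm (Delta2 n a k) * norm Z \<le> K1 * (Q + T)"
          using Delta2_bound[OF R1 R q[rule_format] h' that] by (simp add: K1_def Q_def T_def)
        moreover have "M / g * norm Z \<le> norm (Delta2 n a k) * norm Z"
          using k by (intro mult_right_mono) (auto simp: g_def)
        ultimately have "M / g * norm Z \<le> K1 * (Q + T)" by linarith
        then show ?thesis using M g by (simp add: W_def field_simps)
      qed
      have "norm (A s) + norm (C s) + norm (D s) \<le> 3 * W" if "s \<in> {1..n}" for s
        using Z[OF that, of "A s"] Z[OF that, of "C s"] Z[OF that, of "D s"] by simp
      then have "X \<le> (\<Sum>s=1..n. 3 * W)"
        unfolding X_def by (rule sum_mono)
      also have "\<dots> = K2 * g * (Q + T)" by (simp add: K2_def W_def mult_ac)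
      also have "\<dots> \<le> K2 * g * (Q + K3 * \<epsilon> k * Y)"
        using K g T by (intro mult_left_mono) auto
      finally show ?thesis .
    qed
    moreover have "K2 * g * (K3 * \<epsilon> k * Y) \<le> 1 / 2 * Y"
      using k mult_right_mono[of "K2 * K3 * (g * \<epsilon> k)" "1 / 2" Y] nonneg by (simp add: g_def mult_ac)
    \<comment> \<open>Inserting the bound for \<open>X\<close> into that for \<open>Y\<close> and
      absorbing \<open>Y / 2\<close> bounds \<open>Y\<close>; the bound for \<open>X\<close>
      follows.\<close>
    ultimately have "X + Y \<le> 4 * (K2 * g * Q) + 3 * (real n * V * P)"
      by (simp add: algebra_simps)
    also have "\<dots> \<le> 4 * (K2 * g * (P + Q)) + 3 * (real n * V * (g * (P + Q)))"
    proof -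
      have "P \<le> g * (P + Q)" using g nonneg mult_right_mono[of 1 g "P + Q"] by simp
      then show ?thesis
        using K g V(1) nonneg by (intro add_mono mult_left_mono) auto
    qed
    also have "\<dots> = (4 * K2 + 3 * real n * V) * g * (P + Q)"
      by (simp add: algebra_simps)
    finally show "(\<Sum>s=1..n. norm (A s) + norm (B s) + norm (C s) + norm (D s))
        \<le> (4 * K2 + 3 * real n * V) * real k powr \<gamma> * ((\<Sum>m<n. norm (p m)) + (\<Sum>m<n. norm (q m)))"
      by (simp add: X_def Y_def P_def Q_def g_def sum.distrib algebra_simps)
  qed simp
qed

section \<open>Solutions of the one-dimensional problem\<close>

text \<open>Over the complex numbers the two sides of 0 differ only in whether the roots
  \<open>\<mu>\<close> are real or imaginary.\<close>

lemma foldr_factor_jet_complex: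
  assumes "sgn y = \<sigma>" and "\<And>i. of_real \<sigma> * (\<mu> i)\<^sup>2 = of_real ((l i)\<^sup>2)"
  shows "complex_of_real (foldr (\<lambda>i. factor_jet (l i)) is F j y) =
    foldr (\<lambda>i. exp_op (of_real \<sigma>) (\<mu> i)) is (\<lambda>j y. of_real (F j y)) j y"
proof (induction "is" arbitrary: j)
  case (Cons i "is")
  let ?F = "foldr (\<lambda>i. factor_jet (l i)) is F"
  have "complex_of_real (factor_jet (l i) ?F j y)
      = of_real \<sigma> * of_real (?F (j + 2) y) - of_real ((l i)\<^sup>2) * of_real (?F j y)"
    using assms(1) by (simp add: factor_jet_def)
  also have "\<dots> = of_real \<sigma> * (of_real (?F (j + 2) y) - (\<mu> i)\<^sup>2 * of_real (?F j y))"
    unfolding assms(2)[symmetric] by (simp add: algebra_simps)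
  finally show ?case by (simp add: Cons.IH exp_op_def)
qed simp

lemma derivative_family_unique:
  fixes f g :: "nat \<Rightarrow> real \<Rightarrow> complex"
  assumes "open I"
    and "\<And>j y. j < m \<Longrightarrow> y \<in> I \<Longrightarrow> (f j has_vector_derivative f (Suc j) y) (at y)"
    and "\<And>j y. j < m \<Longrightarrow> y \<in> I \<Longrightarrow> (g j has_vector_derivative g (Suc j) y) (at y)"
    and "\<And>y. y \<in> I \<Longrightarrow> f 0 y = g 0 y" and "j \<le> m" and "y \<in> I"
  shows "f j y = g j y"
  using assms(5,6)
proof (induction j arbitrary: y)
  case (Suc j)
  have "(g j has_vector_derivative f (Suc j) y) (at y)"
    using Suc.prems Suc.IH
    by (intro has_vector_derivative_transform_within_open[OF assms(2) assms(1)]) auto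
  then show ?case
    using assms(3)[of j y] Suc.prems by (auto intro: vector_derivative_unique_at)
qed (use assms(4) in auto)

definition exp_sum :: "nat \<Rightarrow> (nat \<Rightarrow> complex) \<Rightarrow> (nat \<Rightarrow> complex) \<Rightarrow> (nat \<Rightarrow> complex) \<Rightarrow> nat \<Rightarrow> real \<Rightarrow> complex" where
  "exp_sum n \<mu> A B j y = (\<Sum>s=1..n. exp_jet (\<mu> s) (A s) (B s) j y)"

lemma exp_sum_has_derivative:
  "(exp_sum n \<mu> A B j has_vector_derivative exp_sum n \<mu> A B (Suc j) y) (at y within S)"
  unfolding exp_sum_def by (intro has_vector_derivative_sum exp_jet_has_derivative)

lemma exp_sum_continuous: "continuous_on S (exp_sum n \<mu> A B j)"
  using exp_sum_has_derivative
  by (meson continuous_on_eq_continuous_within has_vector_derivative_continuous)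

definition punctured :: "real set" where
  "punctured = {y. 0 < \<bar>y\<bar> \<and> \<bar>y\<bar> < 1}"

lemma open_punctured: "open punctured"
proof -
  have eq: "punctured = {-1<..<0} \<union> {0<..<1}" by (auto simp: punctured_def)
  show ?thesis unfolding eq by (intro open_Un open_greaterThanLessThan)
qed

lemma punctured_islimpt: "y \<in> punctured \<Longrightarrow> y islimpt punctured"
  using open_punctured interior_open interior_limit_point by metis

text \<open>On each side of \<open>0\<close> the equation turns into a product of operators \<open>d\<^sup>2/dy\<^sup>2 - \<mu>\<^sup>2\<close>, with real
  roots above and imaginary roots below.\<close>

lemma one_sided_exp_sum:
  assumes pos: "\<And>s. s \<in> {1..n} \<Longrightarrow> 0 < a s" and inj: "inj_on a {1..n}" and "k \<ge> 1"
    and C: "Ck_on (2 * n) punctured v" and P: "\<And>y. y \<in> punctured \<Longrightarrow> P_op n a k v y = 0"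
    and I: "open I" "convex I" "I \<subseteq> punctured" and sgn: "\<And>y. y \<in> I \<Longrightarrow> sgn y = \<sigma>"
    and \<nu>: "of_real \<sigma> * \<nu>\<^sup>2 = 1" "\<sigma> \<noteq> 0"
  shows "\<exists>A B. \<forall>j\<le>2 * n. \<forall>y\<in>I. of_real ((deriv_on punctured ^^ j) v y)
     = exp_sum n (\<lambda>s. \<nu> * of_real (a s * real k * pi)) A B j y"
proof -
  define F where "F j = (deriv_on punctured ^^ j) v" for j
  let ?\<mu> = "\<lambda>s. \<nu> * of_real (a s * real k * pi)"
  let ?f = "\<lambda>j y. complex_of_real (F j y)"
  have F: "derivative_jet (2 * n) punctured F"
    unfolding derivative_jet_def F_def using Ck_on_has_derivative[OF C] by auto
  have f: "(?f j has_vector_derivative ?f (Suc j) y) (at y)" if "j < 2 * n" "y \<in> I" for j y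
  proof -
    have "y \<in> punctured" using that I(3) by auto
    then have "(F j has_real_derivative F (Suc j) y) (at y within punctured)"
      using F that(1) by (auto simp: derivative_jet_def)
    then have "(F j has_real_derivative F (Suc j) y) (at y)"
      by (simp only: at_within_open[OF \<open>y \<in> punctured\<close> open_punctured])
    then show ?thesis
      by (intro has_vector_derivative_of_real) (simp add: has_real_derivative_iff_has_vector_derivative)
  qed
  have "\<nu> \<noteq> 0" using \<nu> by auto
  \<comment> \<open>In the applications \<open>\<sigma> = 1\<close>, \<open>\<nu> = 1\<close> above
    0 and \<open>\<sigma> = -1\<close>, \<open>\<nu> = \<i>\<close> below.\<close>
  have sq: "of_real \<sigma> * (?\<mu> s)\<^sup>2 = of_real ((a s * real k * pi)\<^sup>2)" for s
    using \<nu>(1) by (simp add: power_mult_distrib flip: mult.assoc)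
  have "\<exists>A B. \<forall>y\<in>I. ?f 0 y = (\<Sum>s\<in>set [1..<Suc n]. exp_jet (?\<mu> s) (A s) (B s) 0 y)"
  proof (rule exponential_solutions[OF I(1,2), where \<sigma> = "of_real \<sigma>"])
    show "complex_of_real \<sigma> \<noteq> 0" using \<nu> by simp
    show "inj_on (\<lambda>s. (?\<mu> s)\<^sup>2) (set [1..<Suc n])"
    proof (rule inj_onI)
      fix s r assume sr: "s \<in> set [1..<Suc n]" "r \<in> set [1..<Suc n]" and eq: "(?\<mu> s)\<^sup>2 = (?\<mu> r)\<^sup>2"
      have sr': "s \<in> {1..n}" "r \<in> {1..n}" using sr by auto
      have "complex_of_real ((a s * real k * pi)\<^sup>2) = of_real ((a r * real k * pi)\<^sup>2)"
        unfolding sq[symmetric] eq ..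
      then have "(a s * real k * pi)\<^sup>2 = (a r * real k * pi)\<^sup>2" by (simp only: of_real_eq_iff)
      then have "(a s)\<^sup>2 = (a r)\<^sup>2" using \<open>k \<ge> 1\<close> by (simp add: power_mult_distrib)
      then have "a s = a r"
        using pos[OF sr'(1)] pos[OF sr'(2)] power2_eq_iff_nonneg[of "a s" "a r"] by simp
      then show "s = r" using inj_onD[OF inj] sr' by blast
    qed
    show "?\<mu> s \<noteq> 0" if "s \<in> set [1..<Suc n]" for s
      using that pos[of s] \<open>k \<ge> 1\<close> \<open>\<nu> \<noteq> 0\<close> by auto
    show "(?f j has_vector_derivative ?f (Suc j) y) (at y)" if "j < 2 * length [1..<Suc n]" "y \<in> I" for j y
      using that by (intro f) (simp_all del: upt_Suc)
    show "foldr (\<lambda>s. exp_op (of_real \<sigma>) (?\<mu> s)) [1..<Suc n] ?f 0 y = 0" if y: "y \<in> I" for y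
    proof -
      have "foldr (\<lambda>s. factor_jet (a s * real k * pi)) [1..<Suc n] F 0 y = 0"
        using P_factors_eq[of 0 "[1..<Suc n]" punctured F v a k] F punctured_islimpt P[of y] y I(3)
        by (auto simp: punctured_def F_def P_op_def simp del: upt_Suc)
      then show ?thesis
        using foldr_factor_jet_complex[OF sgn[OF y], of ?\<mu> "\<lambda>s. a s * real k * pi" "[1..<Suc n]" F 0] sq
        by (simp del: upt_Suc)
    qed
  qed simp
  then obtain A B where AB: "\<And>y. y \<in> I \<Longrightarrow> ?f 0 y = exp_sum n ?\<mu> A B 0 y"
    unfolding exp_sum_def by (auto simp: atLeastLessThanSuc_atLeastAtMost simp del: upt_Suc)
  have "?f j y = exp_sum n ?\<mu> A B j y" if "j \<le> 2 * n" "y \<in> I" for j y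
    by (rule derivative_family_unique[OF I(1) f exp_sum_has_derivative AB that])
  then show ?thesis by (auto simp: F_def)
qed

section \<open>Bounding the two branches and joining them at 0\<close>

lemma has_real_derivative_glue:
  assumes "(f has_real_derivative d) (at c)" and "(g has_real_derivative d) (at c)" and "f c = g c"
  shows "((\<lambda>y. if y \<le> c then f y else g y) has_real_derivative d) (at c)"
proof -
  let ?h = "\<lambda>y. if y \<le> c then f y else g y"
  have "(?h has_real_derivative d) (at c within {..c})"
    using has_real_derivative_cong_on[of "{..c}" ?h f c d] DERIV_subset[OF assms(1)] by auto
  moreover have "(?h has_real_derivative d) (at c within {c..})"
    using has_real_derivative_cong_on[of "{c..}" ?h g c d] DERIV_subset[OF assms(2)] assms(3) by auto
  ultimately have "(?h has_real_derivative d) (at c within {..c} \<union> {c..})"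
    unfolding has_field_derivative_iff by (rule Lim_Un)
  moreover have "{..c} \<union> {c..} = UNIV" by auto
  ultimately show ?thesis by simp
qed

text \<open>A growing exponential is largest at \<open>y = 1\<close>, hence the weight
  \<open>exp (l s)\<close> on \<open>A\<close>; the weighted coefficient is the normalised one that
  the linear system controls.\<close>

lemma exp_sum_real_bound:
  assumes "\<And>s. s \<in> {1..n} \<Longrightarrow> 0 \<le> l s \<and> l s \<le> L" and "y \<in> {0..1}"
  shows "norm (exp_sum n (\<lambda>s. of_real (l s)) A B j y)
    \<le> L ^ j * (\<Sum>s=1..n. norm (A s) * exp (l s) + norm (B s))"
proof -
  have "norm (exp_jet (of_real (l s)) (A s) (B s) j y) \<le> L ^ j * (norm (A s) * exp (l s) + norm (B s))"
    if s: "s \<in> {1..n}" for s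
  proof -
    have l: "0 \<le> l s" "l s \<le> L" using assms(1)[OF s] by auto
    then have ly: "l s * y \<le> l s" "0 \<le> l s * y" using assms(2) by (auto simp: mult_left_le)
    have "norm (exp_jet (of_real (l s)) (A s) (B s) j y)
        \<le> norm (A s) * l s ^ j * exp (l s * y) + norm (B s) * l s ^ j * exp (- (l s * y))"
      unfolding exp_jet_def using l
      by (intro norm_triangle_le) (simp add: norm_mult norm_power)
    also have "\<dots> \<le> norm (A s) * L ^ j * exp (l s) + norm (B s) * L ^ j * 1"
      using l ly by (intro add_mono mult_mono power_mono) auto
    finally show ?thesis by (simp add: algebra_simps)
  qed
  then show ?thesis
    unfolding exp_sum_def sum_distrib_left by (rule sum_norm_le)
qed

lemma exp_sum_imaginary_bound:
  assumes "\<And>s. s \<in> {1..n} \<Longrightarrow> 0 \<le> l s \<and> l s \<le> L"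
  shows "norm (exp_sum n (\<lambda>s. \<i> * of_real (l s)) C D j y) \<le> L ^ j * (\<Sum>s=1..n. norm (C s) + norm (D s))"
proof -
  have "norm (exp_jet (\<i> * of_real (l s)) (C s) (D s) j y) \<le> L ^ j * (norm (C s) + norm (D s))"
    if s: "s \<in> {1..n}" for s
  proof -
    have l: "0 \<le> l s" "l s \<le> L" using assms(1)[OF s] by auto
    have "norm (exp_jet (\<i> * of_real (l s)) (C s) (D s) j y)
        \<le> norm (C s) * l s ^ j + norm (D s) * l s ^ j"
      unfolding exp_jet_def using l
      by (intro norm_triangle_le) (simp add: norm_mult norm_power)
    also have "\<dots> \<le> norm (C s) * L ^ j + norm (D s) * L ^ j"
      using l by (intro add_mono mult_left_mono power_mono) auto
    finally show ?thesis by (simp add: algebra_simps)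
  qed
  then show ?thesis
    unfolding exp_sum_def sum_distrib_left by (rule sum_norm_le)
qed

lemma continuous_eq_on_closure:
  fixes f g :: "real \<Rightarrow> 'a :: real_normed_vector"
  assumes "continuous_on (closure S) f" and "continuous_on (closure S) g"
    and "\<And>x. x \<in> S \<Longrightarrow> f x = g x" and "x \<in> closure S"
  shows "f x = g x"
proof -
  have "f x - g x = 0"
    by (rule continuous_constant_on_closure[of S "\<lambda>x. f x - g x"])
      (use assms in \<open>auto intro!: continuous_on_diff\<close>)
  then show ?thesis by simp
qed

text \<open>At 0 the lower branch is taken. For solutions this is immaterial below order
  \<open>2 n\<close>, where the branches match, and an arbitrary choice at order
  \<open>2 n\<close>.\<close>

definition glue :: "(nat \<Rightarrow> real \<Rightarrow> real) \<Rightarrow> (nat \<Rightarrow> real \<Rightarrow> real) \<Rightarrow> nat \<Rightarrow> real \<Rightarrow> real" where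
  "glue f g j y = (if y \<le> 0 then f j y else g j y)"

lemma glue_has_derivative:
  assumes f: "\<And>j y. (f j has_real_derivative f (Suc j) y) (at y)"
    and g: "\<And>j y. (g j has_real_derivative g (Suc j) y) (at y)"
    and "y \<noteq> 0 \<or> f j 0 = g j 0 \<and> f (Suc j) 0 = g (Suc j) 0"
  shows "(glue f g j has_real_derivative glue f g (Suc j) y) (at y within S)"
proof -
  consider "y < 0" | "y > 0" | "y = 0" by linarith
  then have "(glue f g j has_real_derivative glue f g (Suc j) y) (at y)"
  proof cases
    case 1
    then have eq: "glue f g (Suc j) y = f (Suc j) y" by (simp add: glue_def)
    show ?thesis
      unfolding eq by (rule has_field_derivative_transform_within_open[OF f, where S = "{..<0}"])
        (use 1 in \<open>auto simp: glue_def\<close>)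
  next
    case 2
    then have eq: "glue f g (Suc j) y = g (Suc j) y" by (simp add: glue_def)
    show ?thesis
      unfolding eq by (rule has_field_derivative_transform_within_open[OF g, where S = "{0<..}"])
        (use 2 in \<open>auto simp: glue_def\<close>)
  next
    case 3
    then show ?thesis
      using has_real_derivative_glue[OF f[of j 0], of "g j"] g[of j 0] assms(3)
      by (simp add: glue_def[abs_def])
  qed
  then show ?thesis by (rule has_field_derivative_at_within)
qed

lemma glue_continuous:
  assumes "\<And>j y. (f j has_real_derivative f (Suc j) y) (at y)"
    and "\<And>j y. (g j has_real_derivative g (Suc j) y) (at y)" and "f j 0 = g j 0"
  shows "continuous_on S (glue f g j)"
proof -
  have "continuous_on T (f j)" "continuous_on T (g j)" for T
    by (rule DERIV_continuous_on[OF has_field_derivative_at_within[OF assms(1)]]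
        DERIV_continuous_on[OF has_field_derivative_at_within[OF assms(2)]])+
  then show ?thesis
    unfolding glue_def using assms(3) by (intro continuous_on_cases_le continuous_on_id) auto
qed

lemma Re_exp_sum_has_derivative:
  "((\<lambda>y. Re (exp_sum n \<mu> A B j y)) has_real_derivative Re (exp_sum n \<mu> A B (Suc j) y)) (at y)"
  using bounded_linear.has_vector_derivative[OF bounded_linear_Re exp_sum_has_derivative]
  by (simp add: has_real_derivative_iff_has_vector_derivative)

text \<open>What is kept of a solution with roots \<open>l\<close> and boundary data
  \<open>p\<close>, \<open>q\<close>. The matching and boundary conditions are complex equations,
  although \<open>v\<close> is real, so that they form a linear system for the complex
  coefficients.\<close>

definition exp_rep :: "nat \<Rightarrow> (nat \<Rightarrow> real) \<Rightarrow> (real \<Rightarrow> real) \<Rightarrow> (nat \<Rightarrow> real) \<Rightarrow> (nat \<Rightarrow> real) \<Rightarrow>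
    (nat \<Rightarrow> complex) \<Rightarrow> (nat \<Rightarrow> complex) \<Rightarrow> (nat \<Rightarrow> complex) \<Rightarrow> (nat \<Rightarrow> complex) \<Rightarrow> bool" where
  "exp_rep n l v p q A B C D \<longleftrightarrow>
     (\<forall>y\<in>{0..1}. v y = Re (exp_sum n (\<lambda>s. of_real (l s)) A B 0 y))
   \<and> (\<forall>y\<in>{-1..0}. v y = Re (exp_sum n (\<lambda>s. \<i> * of_real (l s)) C D 0 y))
   \<and> (\<forall>t<2 * n. exp_sum n (\<lambda>s. of_real (l s)) A B t 0 = exp_sum n (\<lambda>s. \<i> * of_real (l s)) C D t 0)
   \<and> (\<forall>m<n. exp_sum n (\<lambda>s. of_real (l s)) A B (2 * m) 1 = of_real (p m)
         \<and> exp_sum n (\<lambda>s. \<i> * of_real (l s)) C D (2 * m) (-1) = of_real (q m))"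

lemma islimpt_two_sided:
  assumes "y \<in> {-1..1} - {0 :: real}"
  shows "y islimpt ({-1..1} - {0})"
proof (cases "y > 0")
  case True
  have "y islimpt {y/2..y}"
    using True by (intro connected_imp_perfect) (auto simp: atLeastAtMost_singleton_iff)
  then show ?thesis by (rule islimpt_subset) (use True assms in auto)
next
  case False
  then have "y islimpt {y..y/2}"
    using assms by (intro connected_imp_perfect) (auto simp: atLeastAtMost_singleton_iff)
  then show ?thesis by (rule islimpt_subset) (use False assms in auto)
qed

text \<open>The exponential form is available inside the two open intervals. By continuity the
  imaginary parts, zero inside, vanish up to the end points; this upgrades the real boundary and
  matching conditions to the complex ones of \<open>exp_rep\<close>.\<close>

lemma solves_P_exp_rep:
  assumes n: "n \<ge> 1" and pos: "\<And>s. s \<in> {1..n} \<Longrightarrow> 0 < a s" and inj: "inj_on a {1..n}" and "k \<ge> 1"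
    and v: "solves_P n a \<phi> \<psi> k v"
  shows "\<exists>A B C D. exp_rep n (\<lambda>s. a s * real k * pi) v (\<lambda>m. sine_coeff (\<phi> m) k) (\<lambda>m. sine_coeff (\<psi> m) k) A B C D"
proof -
  let ?l = "\<lambda>s. a s * real k * pi" and ?S = "{-1..1} - {0 :: real}"
  define F where "F j = (deriv_on punctured ^^ j) v" for j
  have smooth: "Ck_on (2 * n) punctured v" and zero: "\<And>y. y \<in> punctured \<Longrightarrow> P_op n a k v y = 0"
    and cont: "continuous_on ?S v" and cont0: "isCont v 0"
    using v Ck_on_continuous[of "2 * n - 2" ?S v 0] by (auto simp: solves_P_def punctured_def)
  have bdry: "(deriv_on ?S ^^ (2 * m)) v 1 = sine_coeff (\<phi> m) k"
      "(deriv_on ?S ^^ (2 * m)) v (-1) = sine_coeff (\<psi> m) k" if "m < n" for m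
    using v that by (auto simp: solves_P_def)
  have match: "\<exists>l. (F t \<longlongrightarrow> l) (at_right 0) \<and> (F t \<longlongrightarrow> l) (at_left 0)" if "t < 2 * n" for t
    using v that by (auto simp: solves_P_def F_def punctured_def)
  have sub: "{0<..<1} \<subseteq> punctured" "{-1<..<0} \<subseteq> punctured" by (auto simp: punctured_def)
  have "\<exists>A B. \<forall>j\<le>2 * n. \<forall>y\<in>{0<..<1}. of_real (F j y) = exp_sum n (\<lambda>s. of_real (?l s)) A B j y"
    using one_sided_exp_sum[OF pos inj \<open>k \<ge> 1\<close> smooth zero, of "{0<..<1}" 1 1] sub
    by (simp add: F_def)
  then obtain A B where AB: "\<forall>j\<le>2 * n. \<forall>y\<in>{0<..<1}.
      of_real (F j y) = exp_sum n (\<lambda>s. of_real (?l s)) A B j y" by blast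
  have "\<exists>C D. \<forall>j\<le>2 * n. \<forall>y\<in>{-1<..<0}. of_real (F j y) = exp_sum n (\<lambda>s. \<i> * of_real (?l s)) C D j y"
    using one_sided_exp_sum[OF pos inj \<open>k \<ge> 1\<close> smooth zero, of "{-1<..<0}" "-1" "\<i>"] sub
    by (simp add: F_def)
  then obtain C D where CD: "\<forall>j\<le>2 * n. \<forall>y\<in>{-1<..<0}.
      of_real (F j y) = exp_sum n (\<lambda>s. \<i> * of_real (?l s)) C D j y" by blast
  define E E' where "E = exp_sum n (\<lambda>s. of_real (?l s)) A B"
    and "E' = exp_sum n (\<lambda>s. \<i> * of_real (?l s)) C D"
  have contE: "continuous_on T (E j)" "continuous_on T (E' j)" for T j
    unfolding E_def E'_def by (rule exp_sum_continuous)+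
  have FE: "F j y = Re (E j y)" "Im (E j y) = 0" if "j \<le> 2 * n" "y \<in> {0<..<1}" for j y
    using AB[rule_format, OF that] by (simp_all add: E_def complex_eq_iff)
  have FE': "F j y = Re (E' j y)" "Im (E' j y) = 0" if "j \<le> 2 * n" "y \<in> {-1<..<0}" for j y
    using CD[rule_format, OF that] by (simp_all add: E'_def complex_eq_iff)
  have ImE: "Im (E j y) = 0" if "j \<le> 2 * n" "y \<in> {0..1}" for j y
    by (rule continuous_eq_on_closure[of "{0<..<1}" "\<lambda>y. Im (E j y)" "\<lambda>_. 0"])
      (use that FE(2) in \<open>auto intro!: continuous_intros contE\<close>)
  have ImE': "Im (E' j y) = 0" if "j \<le> 2 * n" "y \<in> {-1..0}" for j y
    by (rule continuous_eq_on_closure[of "{-1<..<0}" "\<lambda>y. Im (E' j y)" "\<lambda>_. 0"])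
      (use that FE'(2) in \<open>auto intro!: continuous_intros contE\<close>)
  have limE: "((\<lambda>y. Re (E j y)) \<longlongrightarrow> Re (E j 0)) (at 0)" "((\<lambda>y. Re (E' j y)) \<longlongrightarrow> Re (E' j 0)) (at 0)" for j
    using contE[of UNIV j] by (auto simp: continuous_on_def intro!: tendsto_intros)
  have right: "(F j \<longlongrightarrow> Re (E j 0)) (at_right 0)" if "j \<le> 2 * n" for j
  proof (rule Lim_transform_eventually)
    show "((\<lambda>y. Re (E j y)) \<longlongrightarrow> Re (E j 0)) (at_right 0)"
      using limE(1) by (simp add: filterlim_at_split)
    show "\<forall>\<^sub>F y in at_right 0. Re (E j y) = F j y"
      using eventually_at_right_real[of 0 1] FE(1)[OF that] by (auto elim: eventually_mono)
  qed
  have left: "(F j \<longlongrightarrow> Re (E' j 0)) (at_left 0)" if "j \<le> 2 * n" for j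
  proof (rule Lim_transform_eventually)
    show "((\<lambda>y. Re (E' j y)) \<longlongrightarrow> Re (E' j 0)) (at_left 0)"
      using limE(2) by (simp add: filterlim_at_split)
    show "\<forall>\<^sub>F y in at_left 0. Re (E' j y) = F j y"
      using eventually_at_left_real[of "-1" 0] FE'(1)[OF that] by (auto elim: eventually_mono)
  qed
  have EE': "E t 0 = E' t 0" if t: "t < 2 * n" for t
  proof -
    obtain l where "(F t \<longlongrightarrow> l) (at_right 0)" "(F t \<longlongrightarrow> l) (at_left 0)"
      using match[OF t] by blast
    then have "Re (E t 0) = l" "Re (E' t 0) = l"
      using right[of t] left[of t] t
      by (auto intro: tendsto_unique[OF trivial_limit_at_right_real] tendsto_unique[OF trivial_limit_at_left_real])
    then show ?thesis
      using ImE[of t 0] ImE'[of t 0] t by (simp add: complex_eq_iff)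
  qed
  have v0: "v 0 = Re (E 0 0)"
  proof -
    have "(v \<longlongrightarrow> v 0) (at_right 0)"
      using cont0 by (simp add: isCont_def filterlim_at_split)
    then show ?thesis
      using right[of 0] tendsto_unique[OF trivial_limit_at_right_real] by (auto simp: F_def)
  qed
  have vE: "v y = Re (E 0 y)" if "y \<in> {0..1}" for y
  proof (cases "y = 0")
    case False
    have "v y = Re (E 0 y)"
    \<comment> \<open>Starting at \<open>y / 2\<close> keeps the closure away from 0, where
      \<open>cont\<close> says nothing, and still includes \<open>y = 1\<close>.\<close>
    proof (rule continuous_eq_on_closure[of "{y/2<..<1}" v "\<lambda>y. Re (E 0 y)"])
      show "continuous_on (closure {y/2<..<1}) v"
        using that False by (intro continuous_on_subset[OF cont]) auto
    qed (use that False FE(1)[of 0] in \<open>auto simp: F_def intro!: continuous_intros contE\<close>)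
    then show ?thesis .
  qed (use v0 in simp)
  have vE': "v y = Re (E' 0 y)" if "y \<in> {-1..0}" for y
  proof (cases "y = 0")
    case False
    have "v y = Re (E' 0 y)"
    proof (rule continuous_eq_on_closure[of "{-1<..<y/2}" v "\<lambda>y. Re (E' 0 y)"])
      show "continuous_on (closure {-1<..<y/2}) v"
        using that False by (intro continuous_on_subset[OF cont]) auto
    qed (use that False FE'(1)[of 0] in \<open>auto simp: F_def intro!: continuous_intros contE\<close>)
    then show ?thesis .
  qed (use v0 EE'[of 0] n in simp)
  \<comment> \<open>The boundary conditions use derivatives relative to \<open>?S\<close>, one-sided
    at the end points. The exponentials extend beyond these points, so the glued family evaluates
    them.\<close>
  have deriv: "(deriv_on ?S ^^ j) v y = glue (\<lambda>j y. Re (E' j y)) (\<lambda>j y. Re (E j y)) j y" if "y \<in> ?S" for j y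
  proof (rule funpow_deriv_on_eq[where m = j])
    show "v y = glue (\<lambda>j y. Re (E' j y)) (\<lambda>j y. Re (E j y)) 0 y" if "y \<in> ?S" for y
      using that vE[of y] vE'[of y] by (auto simp: glue_def)
    show "(glue (\<lambda>j y. Re (E' j y)) (\<lambda>j y. Re (E j y)) j has_real_derivative
        glue (\<lambda>j y. Re (E' j y)) (\<lambda>j y. Re (E j y)) (Suc j) y) (at y within ?S)" if "y \<in> ?S" for j y
      unfolding E_def E'_def using that by (intro glue_has_derivative Re_exp_sum_has_derivative) auto
  qed (use that islimpt_two_sided in auto)
  have "E (2 * m) 1 = of_real (sine_coeff (\<phi> m) k)" "E' (2 * m) (-1) = of_real (sine_coeff (\<psi> m) k)" if "m < n" for m
    using bdry[OF that] deriv[of 1 "2 * m"] deriv[of "-1" "2 * m"] ImE[of "2 * m" 1] ImE'[of "2 * m" "-1"] that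
    by (simp_all add: glue_def complex_eq_iff)
  then have "exp_rep n ?l v (\<lambda>m. sine_coeff (\<phi> m) k) (\<lambda>m. sine_coeff (\<psi> m) k) A B C D"
    using vE vE' EE' by (simp add: exp_rep_def E_def E'_def)
  then show ?thesis by blast
qed

lemma exp_jet_even:
  "exp_jet \<mu> A B (2 * m) y = (\<mu>\<^sup>2) ^ m * (A * exp (\<mu> * of_real y) + B * exp (- \<mu> * of_real y))"
  unfolding exp_jet_def power_mult by (simp add: algebra_simps)

text \<open>Dividing a condition of order \<open>t\<close> by \<open>(k * pi) ^ t\<close> leaves the
  powers of \<open>a s\<close> that \<open>coefficient_bound\<close> expects. Since
  \<open>k * pi\<close> is at least 1, the data do not grow.\<close>

lemma exp_rep_bound:
  assumes pos: "\<And>s. s \<in> {1..n} \<Longrightarrow> 0 < a s" and inj: "inj_on a {1..n}"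
    and M: "M > 0" and \<gamma>: "\<gamma> \<ge> 0"
    and Delta: "\<forall>\<^sub>F k in sequentially. norm (Delta2 n a k) > M / real k powr \<gamma>"
  shows "\<exists>K. \<forall>\<^sub>F k in sequentially. \<forall>v p q A B C D. exp_rep n (\<lambda>s. a s * real k * pi) v p q A B C D \<longrightarrow>
     (\<Sum>s=1..n. norm (A s) * exp (a s * real k * pi) + norm (B s)) + (\<Sum>s=1..n. norm (C s) + norm (D s))
       \<le> K * real k powr \<gamma> * ((\<Sum>m<n. \<bar>p m\<bar>) + (\<Sum>m<n. \<bar>q m\<bar>))"
proof -
  obtain K where K: "\<forall>\<^sub>F k in sequentially. \<forall>A B C D p q.
      (\<forall>m<n. (\<Sum>s=1..n. of_real (a s ^ (2 * m)) * (A s * of_real (exp (- (pi * real k * a s))) + B s)) = p m) \<longrightarrow>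
      (\<forall>m<n. (\<Sum>s=1..n. of_real (a s ^ (2 * m)) * (C s * exp (- \<i> * of_real (pi * real k * a s))
          + D s * exp (\<i> * of_real (pi * real k * a s)))) = q m) \<longrightarrow>
      (\<forall>t<2 * n. (\<Sum>s=1..n. of_real ((- a s) ^ t) * A s + of_real (a s ^ t * exp (- (pi * real k * a s))) * B s)
          = (\<Sum>s=1..n. (\<i> * of_real (a s)) ^ t * C s + (- \<i> * of_real (a s)) ^ t * D s)) \<longrightarrow>
      (\<Sum>s=1..n. norm (A s) + norm (B s) + norm (C s) + norm (D s :: complex))
        \<le> K * real k powr \<gamma> * ((\<Sum>m<n. norm (p m)) + (\<Sum>m<n. norm (q m)))"
    using coefficient_bound[OF pos inj M \<gamma> Delta] by blast
  show ?thesis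
  proof (intro exI eventually_mono[OF eventually_conj[OF K eventually_gt_at_top[of 0]]] allI impI, elim conjE)
    fix k :: nat and v :: "real \<Rightarrow> real" and p q :: "nat \<Rightarrow> real" and A B C D :: "nat \<Rightarrow> complex"
    assume "0 < k" and rep: "exp_rep n (\<lambda>s. a s * real k * pi) v p q A B C D"
    assume bound: "\<forall>A B C D p q.
      (\<forall>m<n. (\<Sum>s=1..n. of_real (a s ^ (2 * m)) * (A s * of_real (exp (- (pi * real k * a s))) + B s)) = p m) \<longrightarrow>
      (\<forall>m<n. (\<Sum>s=1..n. of_real (a s ^ (2 * m)) * (C s * exp (- \<i> * of_real (pi * real k * a s))
          + D s * exp (\<i> * of_real (pi * real k * a s)))) = q m) \<longrightarrow>
      (\<forall>t<2 * n. (\<Sum>s=1..n. of_real ((- a s) ^ t) * A s + of_real (a s ^ t * exp (- (pi * real k * a s))) * B s)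
          = (\<Sum>s=1..n. (\<i> * of_real (a s)) ^ t * C s + (- \<i> * of_real (a s)) ^ t * D s)) \<longrightarrow>
      (\<Sum>s=1..n. norm (A s) + norm (B s) + norm (C s) + norm (D s :: complex))
        \<le> K * real k powr \<gamma> * ((\<Sum>m<n. norm (p m)) + (\<Sum>m<n. norm (q m)))"
    define \<kappa> where "\<kappa> = real k * pi"
    have "1 * 1 \<le> real k * pi" using \<open>0 < k\<close> pi_gt3 by (intro mult_mono) auto
    then have \<kappa>: "\<kappa> \<ge> 1" by (simp add: \<kappa>_def)
    have arg: "a s * real k * pi = a s * \<kappa>" "pi * real k * a s = a s * \<kappa>" for s
      by (simp_all add: \<kappa>_def)
    \<comment> \<open>In \<open>exp_jet\<close> the first coefficient belongs to the growing
      exponential, and \<open>A'\<close> is its normalisation at \<open>y = 1\<close>. Thus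
      \<open>B\<close> and \<open>A'\<close> take the places of \<open>A\<close> and
      \<open>B\<close> in \<open>coefficient_bound\<close>.\<close>
    define A' where "A' s = A s * exp (of_real (a s * \<kappa>))" for s
    have A': "A s = A' s * exp (- of_real (a s * \<kappa>))" for s
      by (simp add: A'_def mult.assoc flip: exp_add)
    have nA': "norm (A' s) = norm (A s) * exp (a s * \<kappa>)" for s
      by (simp add: A'_def norm_mult)
    have 1: "(\<Sum>s=1..n. of_real (a s ^ (2 * m)) * (B s * of_real (exp (- (a s * \<kappa>))) + A' s))
        = of_real (p m / \<kappa> ^ (2 * m))" if "m < n" for m
    proof -
      have sq: "((complex_of_real (a s * \<kappa>))\<^sup>2) ^ m = of_real (\<kappa> ^ (2 * m)) * of_real (a s ^ (2 * m))" for s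
      proof -
        have "((complex_of_real (a s * \<kappa>))\<^sup>2) ^ m = of_real ((a s * \<kappa>) ^ (2 * m))"
          by (simp only: power_mult of_real_power)
        then show ?thesis by (simp only: power_mult_distrib of_real_mult mult.commute)
      qed
      have "of_real (\<kappa> ^ (2 * m)) * (\<Sum>s=1..n. of_real (a s ^ (2 * m)) * (B s * of_real (exp (- (a s * \<kappa>))) + A' s))
          = exp_sum n (\<lambda>s. of_real (a s * \<kappa>)) A B (2 * m) 1"
        unfolding exp_sum_def sum_distrib_left exp_jet_even sq
        by (intro sum.cong) (simp_all add: A'_def algebra_simps flip: exp_of_real)
      also have "\<dots> = of_real (p m)"
        using rep that by (simp add: exp_rep_def arg)
      finally show ?thesis using \<kappa> by (simp add: field_simps)
    qed
    have 2: "(\<Sum>s=1..n. of_real (a s ^ (2 * m)) * (C s * exp (- \<i> * of_real (a s * \<kappa>))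
          + D s * exp (\<i> * of_real (a s * \<kappa>)))) = of_real ((- 1) ^ m * q m / \<kappa> ^ (2 * m))" if "m < n" for m
    proof -
      have sq: "((\<i> * complex_of_real (a s * \<kappa>))\<^sup>2) ^ m = of_real (\<kappa> ^ (2 * m)) * (-1) ^ m * of_real (a s ^ (2 * m))" for s
      proof -
        have "(\<i> * complex_of_real (a s * \<kappa>))\<^sup>2 = of_real (\<kappa>\<^sup>2) * (-1) * of_real ((a s)\<^sup>2)"
          by (simp add: power_mult_distrib)
        then show ?thesis by (simp only: power_mult_distrib power_mult of_real_power)
      qed
      have "of_real (\<kappa> ^ (2 * m)) * (-1) ^ m * (\<Sum>s=1..n. of_real (a s ^ (2 * m)) * (C s * exp (- \<i> * of_real (a s * \<kappa>))
          + D s * exp (\<i> * of_real (a s * \<kappa>))))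
          = exp_sum n (\<lambda>s. \<i> * of_real (a s * \<kappa>)) C D (2 * m) (-1)"
        unfolding exp_sum_def sum_distrib_left exp_jet_even sq
        by (intro sum.cong) (simp_all add: algebra_simps)
      also have "\<dots> = of_real (q m)"
        using rep that by (simp add: exp_rep_def arg)
      finally have eq: "of_real (\<kappa> ^ (2 * m)) * (-1) ^ m * (\<Sum>s=1..n. of_real (a s ^ (2 * m)) * (C s * exp (- \<i> * of_real (a s * \<kappa>))
          + D s * exp (\<i> * of_real (a s * \<kappa>)))) = of_real (q m)" .
      \<comment> \<open>Even powers of the imaginary roots carry the sign \<open>(-1) ^ m\<close>,
        which is moved to the datum.\<close>
      have "(-1) ^ m * (-1) ^ m = (1 :: complex)" by (simp flip: power_mult_distrib)
      then show ?thesis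
        using \<kappa> by (simp only: eq[symmetric] of_real_divide of_real_mult of_real_power of_real_minus of_real_1)
          (simp add: field_simps)
    qed
    have 3: "(\<Sum>s=1..n. of_real ((- a s) ^ t) * B s + of_real (a s ^ t * exp (- (a s * \<kappa>))) * A' s)
          = (\<Sum>s=1..n. (\<i> * of_real (a s)) ^ t * C s + (- \<i> * of_real (a s)) ^ t * D s)" if "t < 2 * n" for t
    proof -
      have "of_real (\<kappa> ^ t) * (\<Sum>s=1..n. of_real ((- a s) ^ t) * B s + of_real (a s ^ t * exp (- (a s * \<kappa>))) * A' s)
         = exp_sum n (\<lambda>s. of_real (a s * \<kappa>)) A B t 0"
        unfolding exp_sum_def sum_distrib_left exp_jet_def
        by (intro sum.cong) (simp_all add: A' power_mult_distrib algebra_simps power_minus[of "_ * _"]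
            power_minus[of "complex_of_real _"] flip: exp_of_real)
      also have "\<dots> = exp_sum n (\<lambda>s. \<i> * of_real (a s * \<kappa>)) C D t 0"
        using rep that by (simp add: exp_rep_def arg)
      also have "\<dots> = of_real (\<kappa> ^ t) * (\<Sum>s=1..n. (\<i> * of_real (a s)) ^ t * C s + (- \<i> * of_real (a s)) ^ t * D s)"
        unfolding exp_sum_def sum_distrib_left exp_jet_def
        by (intro sum.cong) (simp_all add: power_mult_distrib algebra_simps power_minus[of "_ * _"])
      finally show ?thesis using \<kappa> by simp
    qed
    have "(\<Sum>s=1..n. norm (B s) + norm (A' s) + norm (C s) + norm (D s))
       \<le> K * real k powr \<gamma> * ((\<Sum>m<n. norm (complex_of_real (p m / \<kappa> ^ (2 * m))))
          + (\<Sum>m<n. norm (complex_of_real ((- 1) ^ m * q m / \<kappa> ^ (2 * m)))))"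
      using bound[rule_format, of B A' "\<lambda>m. of_real (p m / \<kappa> ^ (2 * m))" C D
          "\<lambda>m. of_real ((- 1) ^ m * q m / \<kappa> ^ (2 * m))"] 1 2 3 unfolding arg by blast
    also have "\<dots> \<le> \<bar>K\<bar> * real k powr \<gamma> * ((\<Sum>m<n. \<bar>p m\<bar>) + (\<Sum>m<n. \<bar>q m\<bar>))"
    proof -
      have div: "\<bar>t\<bar> / \<kappa> ^ (2 * m) \<le> \<bar>t\<bar>" for t m
        using \<kappa> by (simp add: divide_le_eq mult_le_cancel_left1 one_le_power)
      have "norm (complex_of_real (p m / \<kappa> ^ (2 * m))) \<le> \<bar>p m\<bar>"
        "norm (complex_of_real ((- 1) ^ m * q m / \<kappa> ^ (2 * m))) \<le> \<bar>q m\<bar>" for m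
        using div[of "p m" m] div[of "q m" m] \<kappa> by (simp_all only: norm_of_real abs_divide abs_mult power_abs) simp_all
      then show ?thesis
        by (intro mult_mono add_mono sum_mono mult_right_mono) (auto intro!: add_nonneg_nonneg sum_nonneg)
    qed
    finally show "(\<Sum>s=1..n. norm (A s) * exp (a s * real k * pi) + norm (B s)) + (\<Sum>s=1..n. norm (C s) + norm (D s))
       \<le> \<bar>K\<bar> * real k powr \<gamma> * ((\<Sum>m<n. \<bar>p m\<bar>) + (\<Sum>m<n. \<bar>q m\<bar>))"
      unfolding nA' arg by (simp add: sum.distrib add_ac)
  qed
qed

text \<open>\<open>H\<close> is an explicit family of derivatives of \<open>v\<close> on both sides
  of 0. At 0 itself a derivative requires both branches to match in the next order too, hence the
  restriction \<open>Suc j < 2 * n\<close> there.\<close>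

lemma exp_rep_jet:
  assumes rep: "exp_rep n l v p q A B C D" and l: "\<forall>s\<in>{1..n}. 0 \<le> l s \<and> l s \<le> L"
    and "L \<ge> 0"
  defines "H \<equiv> glue (\<lambda>j y. Re (exp_sum n (\<lambda>s. \<i> * of_real (l s)) C D j y)) (\<lambda>j y. Re (exp_sum n (\<lambda>s. of_real (l s)) A B j y))"
  shows "y \<in> {-1..1} \<Longrightarrow> v y = H 0 y"
    and "y \<noteq> 0 \<or> Suc j < 2 * n \<Longrightarrow> (H j has_real_derivative H (Suc j) y) (at y within S)"
    and "j < 2 * n \<Longrightarrow> continuous_on S (H j)"
    and "m < n \<Longrightarrow> H (2 * m) 1 = p m" and "m < n \<Longrightarrow> H (2 * m) (-1) = q m"
    and "y \<in> {-1..1} \<Longrightarrow> \<bar>H j y\<bar> \<le> L ^ j * ((\<Sum>s=1..n. norm (A s) * exp (l s) + norm (B s)) + (\<Sum>s=1..n. norm (C s) + norm (D s)))"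
proof -
  let ?E = "exp_sum n (\<lambda>s. of_real (l s)) A B" and ?E' = "exp_sum n (\<lambda>s. \<i> * of_real (l s)) C D"
  have EE': "?E t 0 = ?E' t 0" if "t < 2 * n" for t
    using rep that by (simp add: exp_rep_def)
  show "v y = H 0 y" if "y \<in> {-1..1}"
    using rep that by (auto simp: exp_rep_def H_def glue_def)
  show "(H j has_real_derivative H (Suc j) y) (at y within S)" if "y \<noteq> 0 \<or> Suc j < 2 * n"
    unfolding H_def using that
    by (intro glue_has_derivative Re_exp_sum_has_derivative) (auto simp: EE')
  show "continuous_on S (H j)" if "j < 2 * n"
    unfolding H_def using that
    by (intro glue_continuous Re_exp_sum_has_derivative) (simp add: EE')
  show "H (2 * m) 1 = p m" "H (2 * m) (-1) = q m" if "m < n"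
    using rep that by (auto simp: exp_rep_def H_def glue_def)
  let ?S = "\<Sum>s=1..n. norm (A s) * exp (l s) + norm (B s)" and ?S' = "\<Sum>s=1..n. norm (C s) + norm (D s)"
  have S: "?S \<ge> 0" "?S' \<ge> 0" by (auto intro!: sum_nonneg add_nonneg_nonneg)
  show "\<bar>H j y\<bar> \<le> L ^ j * (?S + ?S')" if y: "y \<in> {-1..1}"
  proof (cases "y \<le> 0")
    case True
    have "\<bar>H j y\<bar> \<le> norm (?E' j y)"
      using True by (simp add: H_def glue_def abs_Re_le_cmod)
    also have "\<dots> \<le> L ^ j * ?S'" by (rule exp_sum_imaginary_bound[OF l[rule_format]])
    also have "\<dots> \<le> L ^ j * (?S + ?S')" using S \<open>L \<ge> 0\<close> by (intro mult_left_mono) auto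
    finally show ?thesis .
  next
    case False
    have "\<bar>H j y\<bar> \<le> norm (?E j y)"
      using False by (simp add: H_def glue_def abs_Re_le_cmod)
    also have "\<dots> \<le> L ^ j * ?S" using y False by (intro exp_sum_real_bound[OF l[rule_format]]) auto
    also have "\<dots> \<le> L ^ j * (?S + ?S')" using S \<open>L \<ge> 0\<close> by (intro mult_left_mono) auto
    finally show ?thesis .
  qed
qed

section \<open>The Dirichlet problem\<close>

lemma locally_convex_at_convex: "convex Y \<Longrightarrow> locally_convex_at Y y"
  unfolding locally_convex_at_def by (intro exI[of _ 1]) (simp add: convex_Int)

lemma locally_convex_at_open:
  assumes "open Y" and "y \<in> Y"
  shows "locally_convex_at Y y"
proof -
  obtain d where "d > 0" "ball y d \<subseteq> Y" using assms openE by blast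
  then show ?thesis
    unfolding locally_convex_at_def by (intro exI[of _ d]) (simp add: Int_absorb1)
qed

lemma closure_Omega: "closure Omega = {0..1} \<times> {-1..1}"
proof -
  have eq: "Omega = {0<..<1} \<times> {-1<..<1}" by (auto simp: Omega_def)
  show ?thesis unfolding eq by (simp add: closure_Times)
qed

lemma Omega_pos_neg: "Omega_pos \<union> Omega_neg = {0<..<1} \<times> punctured"
  by (auto simp: Omega_pos_def Omega_neg_def Omega_def punctured_def)

text \<open>The cosine of \<open>pi * k\<close> has opposite signs at \<open>k = 1\<close> and
  \<open>k = 2\<close>, which gives both \<open>f 1 = - f 0\<close> and
  \<open>f 1 = f 0\<close>.\<close>

lemma boundary_values_zero:
  assumes "\<And>k. k \<ge> 1 \<Longrightarrow> f 1 * sin (pi * real k * 1 + pi / 2) - f 0 * sin (pi * real k * 0 + pi / 2) = 0"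
  shows "f 0 = 0" and "f (1 :: real) = (0 :: real)"
proof -
  have shift: "sin (t + pi / 2) = cos t" for t by (simp add: sin_add)
  have "- f 1 - f 0 = 0" "f 1 - f 0 = 0"
    using assms[of 1] assms[of 2] unfolding shift by (simp_all add: mult.commute[of pi])
  then show "f 0 = 0" "f 1 = 0" by linarith+
qed

lemma foldr_factor_jet_scale:
  "foldr (\<lambda>i. factor_jet (l i)) is (\<lambda>j y. c * F j y) = (\<lambda>j y. c * foldr (\<lambda>i. factor_jet (l i)) is F j y)"
  by (induction "is") (auto simp: factor_jet_def algebra_simps)

theorem theorem3:
  fixes n \<alpha> :: nat and a :: "nat \<Rightarrow> real" and M \<gamma> :: real
    and \<phi> \<psi> :: "nat \<Rightarrow> real \<Rightarrow> real" and U :: "nat \<Rightarrow> real \<Rightarrow> real"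
  assumes "n \<ge> 1"
    and "\<forall>j\<in>{1..n}. 0 < a j" and "strict_mono_on {1..n} a"
    and "M > 0" and "\<gamma> \<ge> 0"
    and "finite {k. k \<ge> 1 \<and> \<not> norm (Delta2 n a k) > M / real k powr \<gamma>}"
    and "\<alpha> = (if \<gamma> \<in> \<nat> then nat \<lfloor>\<gamma>\<rfloor> else nat \<lfloor>\<gamma>\<rfloor> + 1)"
    and "\<forall>j<n. Ck_on (2 * n + 1 + \<alpha>) {0..1} (\<phi> j) \<and> Ck_on (2 * n + 1 + \<alpha>) {0..1} (\<psi> j)"
    and "\<forall>j<n. \<forall>s\<in>{1..2 * n + 1 + \<alpha>}. \<forall>k\<ge>1.
           (deriv_on {0..1} ^^ (s - 1)) (\<phi> j) 1 * sin (pi * real k * 1 + pi / 2 * real s)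
         - (deriv_on {0..1} ^^ (s - 1)) (\<phi> j) 0 * sin (pi * real k * 0 + pi / 2 * real s) = 0"
    and "\<forall>j<n. \<forall>s\<in>{1..2 * n + 1 + \<alpha>}. \<forall>k\<ge>1.
           (deriv_on {0..1} ^^ (s - 1)) (\<psi> j) 1 * sin (pi * real k * 1 + pi / 2 * real s)
         - (deriv_on {0..1} ^^ (s - 1)) (\<psi> j) 0 * sin (pi * real k * 0 + pi / 2 * real s) = 0"
    and "\<forall>k\<ge>1. solves_P n a \<phi> \<psi> k (U k)"
  shows "(\<forall>(x, y)\<in>closure Omega. summable (\<lambda>k. U (Suc k) y * sin (pi * real (Suc k) * x)))
       \<and> classical_solution n a \<phi> \<psi>
           (\<lambda>(x, y). sqrt 2 * (\<Sum>k. U (Suc k) y * sin (pi * real (Suc k) * x)))"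
proof -
  note n = assms(1) and M = assms(4) and \<gamma> = assms(5)
  have pos: "0 < a s" if "s \<in> {1..n}" for s using assms(2) that by blast
  have inj: "inj_on a {1..n}" using assms(3) by (rule strict_mono_on_imp_inj_on)
  have Delta: "\<forall>\<^sub>F k in sequentially. norm (Delta2 n a k) > M / real k powr \<gamma>"
  proof -
    obtain k0 where "\<forall>k\<in>{k. k \<ge> 1 \<and> \<not> norm (Delta2 n a k) > M / real k powr \<gamma>}. k < k0"
      using assms(6) finite_nat_set_iff_bounded by blast
    then show ?thesis
      by (intro eventually_sequentiallyI[of "max 1 k0"]) force
  qed
  have \<alpha>: "\<gamma> \<le> real \<alpha>"
  proof (cases "\<gamma> \<in> \<nat>")
    case True
    then show ?thesis using assms(7) by (auto elim!: Nats_cases)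
  next
    case False
    then have "real \<alpha> = of_int \<lfloor>\<gamma>\<rfloor> + 1" using assms(7) \<gamma> by simp
    then show ?thesis by linarith
  qed

  \<comment> \<open>Exponential form of all modes\<close>
  define l where "l k s = a s * real (Suc k) * pi" for k s
  \<comment> \<open>This includes the finitely many modes for which \<open>Delta2\<close> is not
    bounded below. They only lack the estimate, which does not affect summability.\<close>
  have "\<exists>A B C D. exp_rep n (l k) (U (Suc k)) (\<lambda>m. sine_coeff (\<phi> m) (Suc k)) (\<lambda>m. sine_coeff (\<psi> m) (Suc k)) A B C D" for k
    using solves_P_exp_rep[OF n pos inj, of "Suc k"] assms(11) unfolding l_def by simp
  then obtain A B C D where rep: "\<And>k. exp_rep n (l k) (U (Suc k)) (\<lambda>m. sine_coeff (\<phi> m) (Suc k))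
      (\<lambda>m. sine_coeff (\<psi> m) (Suc k)) (A k) (B k) (C k) (D k)"
    by metis
  define R where "R = 1 + (\<Sum>s=1..n. a s)"
  have "0 \<le> (\<Sum>s=1..n. a s)" by (rule sum_nonneg) (use pos less_imp_le in blast)
  then have R: "R \<ge> 1" by (simp add: R_def)
  have l: "0 \<le> l k s \<and> l k s \<le> R * freq k" if s: "s \<in> {1..n}" for k s
  proof -
    have "a s \<le> (\<Sum>s=1..n. a s)"
      using s pos by (intro member_le_sum) (auto intro: less_imp_le)
    then have "a s * freq k \<le> R * freq k"
      using freq_ge_1[of k] by (intro mult_right_mono) (auto simp: R_def)
    moreover have "l k s = a s * freq k" by (simp add: l_def freq_def mult_ac)
    ultimately show ?thesis using pos[OF s] freq_ge_1[of k] by simp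
  qed
  define H where "H k = glue (\<lambda>j y. Re (exp_sum n (\<lambda>s. \<i> * of_real (l k s)) (C k) (D k) j y))
      (\<lambda>j y. Re (exp_sum n (\<lambda>s. of_real (l k s)) (A k) (B k) j y))" for k
  define S where "S k = (\<Sum>s=1..n. norm (A k s) * exp (l k s) + norm (B k s)) + (\<Sum>s=1..n. norm (C k s) + norm (D k s))" for k
  have L: "0 \<le> R * freq k" for k using R freq_ge_1[of k] by simp
  have "\<forall>s\<in>{1..n}. 0 \<le> l k s \<and> l k s \<le> R * freq k" for k using l by blast
  note jet = exp_rep_jet[OF rep this L, folded H_def S_def]
  define G where "G k j y = sqrt 2 * H k j y" for k j y

  \<comment> \<open>Summable majorants\<close>
  have Cphi: "Ck_on (Suc (2 * n + \<alpha>)) {0..1} (\<phi> j)" "Ck_on (Suc (2 * n + \<alpha>)) {0..1} (\<psi> j)" if "j < n" for j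
    using assms(8) that by auto
  have weighted: "summable (\<lambda>k. freq k ^ (2 * n + \<alpha>) * \<bar>sine_coeff (\<phi> j) (Suc k)\<bar>)"
    "summable (\<lambda>k. freq k ^ (2 * n + \<alpha>) * \<bar>sine_coeff (\<psi> j) (Suc k)\<bar>)" if "j < n" for j
  proof -
    have comm: "pi * real k * x + pi / 2 * real s = pi * real k * x + real s * (pi / 2)" for k s x by simp
    show "summable (\<lambda>k. freq k ^ (2 * n + \<alpha>) * \<bar>sine_coeff (\<phi> j) (Suc k)\<bar>)"
    proof (rule summable_weighted_sine_coeff[OF Cphi(1)[OF that]])
      fix s k assume "s < Suc (2 * n + \<alpha>)"
      then show "(deriv_on {0..1} ^^ s) (\<phi> j) 1 * phase_sin (Suc s) k 1 = (deriv_on {0..1} ^^ s) (\<phi> j) 0 * phase_sin (Suc s) k 0"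
        using assms(9)[rule_format, OF that, of "Suc s" "Suc k"] unfolding comm phase_sin_def freq_def by simp
    qed
    show "summable (\<lambda>k. freq k ^ (2 * n + \<alpha>) * \<bar>sine_coeff (\<psi> j) (Suc k)\<bar>)"
    proof (rule summable_weighted_sine_coeff[OF Cphi(2)[OF that]])
      fix s k assume "s < Suc (2 * n + \<alpha>)"
      then show "(deriv_on {0..1} ^^ s) (\<psi> j) 1 * phase_sin (Suc s) k 1 = (deriv_on {0..1} ^^ s) (\<psi> j) 0 * phase_sin (Suc s) k 0"
        using assms(10)[rule_format, OF that, of "Suc s" "Suc k"] unfolding comm phase_sin_def freq_def by simp
    qed
  qed
  have S0: "S k \<ge> 0" for k
    unfolding S_def by (auto intro!: sum_nonneg add_nonneg_nonneg)
  have S: "summable (\<lambda>k. freq k ^ (2 * n) * S k)"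
  proof -
    define T where "T k = (\<Sum>m<n. \<bar>sine_coeff (\<phi> m) (Suc k)\<bar>) + (\<Sum>m<n. \<bar>sine_coeff (\<psi> m) (Suc k)\<bar>)" for k
    have T0: "T k \<ge> 0" for k unfolding T_def by (intro add_nonneg_nonneg sum_nonneg) auto
    obtain K where "\<forall>\<^sub>F k in sequentially. \<forall>v p q A B C D. exp_rep n (\<lambda>s. a s * real k * pi) v p q A B C D \<longrightarrow>
     (\<Sum>s=1..n. norm (A s) * exp (a s * real k * pi) + norm (B s)) + (\<Sum>s=1..n. norm (C s) + norm (D s))
       \<le> K * real k powr \<gamma> * ((\<Sum>m<n. \<bar>p m\<bar>) + (\<Sum>m<n. \<bar>q m\<bar>))"
      using exp_rep_bound[OF pos inj M \<gamma> Delta] by blast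
    then have "\<forall>\<^sub>F k in sequentially. \<forall>v p q A B C D. exp_rep n (l k) v p q A B C D \<longrightarrow>
     (\<Sum>s=1..n. norm (A s) * exp (l k s) + norm (B s)) + (\<Sum>s=1..n. norm (C s) + norm (D s))
       \<le> K * real (Suc k) powr \<gamma> * ((\<Sum>m<n. \<bar>p m\<bar>) + (\<Sum>m<n. \<bar>q m\<bar>))"
      unfolding l_def by (subst (asm) eventually_sequentially_Suc[symmetric])
    then have "\<forall>\<^sub>F k in sequentially. S k \<le> K * real (Suc k) powr \<gamma> * T k"
    proof eventually_elim
      case (elim k)
      then show ?case unfolding S_def T_def using rep[of k] by blast
    qed
    \<comment> \<open>\<open>k powr \<gamma>\<close> is replaced by an integral power of the
      frequency, to be met by the weighted sine coefficients. The sign of \<open>K\<close> is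
      unknown, hence \<open>\<bar>K\<bar>\<close>.\<close>
    then have ev: "\<forall>\<^sub>F k in sequentially. norm (freq k ^ (2 * n) * S k) \<le> \<bar>K\<bar> * (freq k ^ (2 * n + \<alpha>) * T k)"
    proof eventually_elim
      case (elim k)
      have le: "1 \<le> real (Suc k)" "real (Suc k) \<le> freq k"
        using mult_right_mono[of 1 pi "real (Suc k)"] pi_gt3 by (auto simp: freq_def)
      have "real (Suc k) powr \<gamma> \<le> real (Suc k) powr real \<alpha>"
        using le(1) \<alpha> by (intro powr_mono)
      also have "\<dots> = real (Suc k) ^ \<alpha>" using le(1) by (intro powr_realpow) simp
      also have "\<dots> \<le> freq k ^ \<alpha>" using le by (intro power_mono) auto
      finally have pw: "real (Suc k) powr \<gamma> \<le> freq k ^ \<alpha>" .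
      have "S k \<le> \<bar>K\<bar> * freq k ^ \<alpha> * T k"
        using elim by (rule order_trans) (intro mult_mono pw T0; use freq_ge_1[of k] in simp)
      then have "freq k ^ (2 * n) * S k \<le> freq k ^ (2 * n) * (\<bar>K\<bar> * freq k ^ \<alpha> * T k)"
        using freq_ge_1[of k] by (intro mult_left_mono) auto
      then show ?case using S0[of k] freq_ge_1[of k] by (simp add: power_add abs_mult mult_ac)
    qed
    have "summable (\<lambda>k. (\<Sum>m<n. freq k ^ (2 * n + \<alpha>) * \<bar>sine_coeff (\<phi> m) (Suc k)\<bar>)
        + (\<Sum>m<n. freq k ^ (2 * n + \<alpha>) * \<bar>sine_coeff (\<psi> m) (Suc k)\<bar>))"
      by (intro summable_add summable_sum weighted) auto
    then have "summable (\<lambda>k. \<bar>K\<bar> * (freq k ^ (2 * n + \<alpha>) * T k))"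
      unfolding T_def by (intro summable_mult) (simp add: sum_distrib_left distrib_left)
    then show ?thesis by (rule summable_comparison_test_ev[OF ev])
  qed
  \<comment> \<open>\<open>R ^ (2 * n)\<close> comes from \<open>l k s \<le> R * freq k\<close>. As
    \<open>R\<close> and the frequencies are at least 1, one majorant serves every order up to
    \<open>2 n\<close>.\<close>
  define c where "c k = sqrt 2 * R ^ (2 * n) * (freq k ^ (2 * n) * S k)" for k
  have c: "summable c" unfolding c_def by (intro summable_mult S)
  have bound: "freq k ^ (N - j) * \<bar>G k j y\<bar> \<le> c k" if "j \<le> N" "N \<le> 2 * n" "y \<in> {-1..1}" for N k j y
  proof -
    have "\<bar>G k j y\<bar> = sqrt 2 * \<bar>H k j y\<bar>" by (simp add: G_def abs_mult)
    also have "\<dots> \<le> sqrt 2 * ((R * freq k) ^ j * S k)"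
      using jet(6)[OF that(3)] by (intro mult_left_mono) auto
    finally have "freq k ^ (N - j) * \<bar>G k j y\<bar> \<le> freq k ^ (N - j) * (sqrt 2 * ((R * freq k) ^ j * S k))"
      using freq_ge_1[of k] by (intro mult_left_mono) auto
    also have "\<dots> = sqrt 2 * R ^ j * (freq k ^ N * S k)"
    proof -
      have "freq k ^ N = freq k ^ (N - j) * freq k ^ j" using that(1) by (simp flip: power_add)
      then show ?thesis by (simp add: power_mult_distrib mult_ac)
    qed
    also have "\<dots> \<le> c k"
      unfolding c_def using that R freq_ge_1[of k] S0[of k]
      by (intro mult_mono power_increasing) auto
    finally show ?thesis .
  qed
  have Gd: "(G k j has_real_derivative G k (Suc j) y) (at y within Y)" if "y \<noteq> 0 \<or> Suc j < 2 * n" for k j y Y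
    unfolding G_def using jet(2)[OF that] by (rule DERIV_cmult)
  have G1: "decaying_jet (2 * n - 1) {-1..1} G"
    unfolding decaying_jet_def derivative_jet_def
  proof (intro conjI allI impI ballI exI[of _ c])
    show "continuous_on {-1..1} (G k j)" if "j \<le> 2 * n - 1" for k j
      unfolding G_def using jet(3)[of j] that n by (intro continuous_intros) auto
    show "(G k j has_real_derivative G k (Suc j) y) (at y within {-1..1})" if "j < 2 * n - 1" for k j y
      using that by (intro Gd) auto
    show "freq k ^ (2 * n - 1 - j) * \<bar>G k j y\<bar> \<le> c k" if "j \<le> 2 * n - 1" "y \<in> {-1..1}" for k j y
      using that by (intro bound) auto
  qed (rule c)
  have G2: "decaying_jet (2 * n) punctured G"
    unfolding decaying_jet_def derivative_jet_def
  proof (intro conjI allI impI ballI exI[of _ c])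
    show "continuous_on punctured (G k j)" for k j
      by (rule DERIV_continuous_on[OF Gd]) (auto simp: punctured_def)
    show "(G k j has_real_derivative G k (Suc j) y) (at y within punctured)" if "y \<in> punctured" for k j y
      using that by (intro Gd) (auto simp: punctured_def)
    show "freq k ^ (2 * n - j) * \<bar>G k j y\<bar> \<le> c k" if "j \<le> 2 * n" "y \<in> punctured" for k j y
      using that by (intro bound) (auto simp: punctured_def)
  qed (rule c)

  \<comment> \<open>Verification of the Dirichlet problem\<close>
  interpret rect: perfect_rectangle "{0..1}" "{-1..1}"
    by unfold_locales (auto intro!: connected_imp_perfect simp: atLeastAtMost_singleton_iff)
  interpret open_rect: perfect_rectangle "{0<..<1}" punctured
    by unfold_locales (auto intro!: punctured_islimpt open_imp_islimpt)
  note J1 = sine_series_jet[OF G1 locally_convex_at_convex[OF convex_real_interval(5)], of "{0..1}"]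
  note J2 = sine_series_jet[OF G2 locally_convex_at_open[OF open_punctured], of "{0<..<1}"]

  let ?u = "\<lambda>(x, y). sqrt 2 * (\<Sum>k. U (Suc k) y * sin (pi * real (Suc k) * x))"
  have sums: "(\<lambda>k. U (Suc k) y * sin (pi * real (Suc k) * x)) sums (sine_series G 0 0 (x, y) / sqrt 2)"
    if "y \<in> {-1..1}" for x y
  proof -
    have "(\<lambda>k. freq k ^ 0 * sin (freq k * x + real 0 * (pi / 2)) * G k 0 y / sqrt 2)
        sums (sine_series G 0 0 (x, y) / sqrt 2)"
      by (intro sums_divide sine_series_sums[OF G1 _ that]) simp
    then show ?thesis
      using jet(1)[OF that] by (simp add: G_def freq_def mult.commute)
  qed
  have u: "?u z = sine_series G 0 0 z" if "z \<in> {0..1} \<times> {-1..1}" for z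
    using that sums_unique[OF sums, symmetric] by auto
  have u': "?u z = sine_series G 0 0 z" if "z \<in> {0<..<1} \<times> punctured" for z
    using that by (intro u) (auto simp: punctured_def)
  have "Ck2_on (2 * n - 1) (closure Omega) ?u"
    unfolding closure_Omega by (rule rect.Ck2_on_jet[OF J1 u]) auto
  moreover have "Ck2_on (2 * n) (Omega_pos \<union> Omega_neg) ?u"
    unfolding Omega_pos_neg by (rule open_rect.Ck2_on_jet[OF J2 u']) auto
  moreover have "L_op n a ?u z = 0" if "z \<in> Omega_pos \<union> Omega_neg" for z
  proof -
    \<comment> \<open>The hypothesis concerns \<open>U (Suc k)\<close>. It is transferred to the
      family \<open>H k\<close>, scaled by \<open>sqrt 2\<close>, and transferred back to
      \<open>G k 0\<close>.\<close>
    have P0: "foldr (\<lambda>j. P_factor punctured (Suc k) (a j)) [1..<Suc n] (G k 0) y = 0" if "y \<in> punctured" for k y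
    proof -
      let ?op = "foldr (\<lambda>j. factor_jet (a j * real (Suc k) * pi)) [1..<Suc n]"
      have "0 \<notin> punctured" by (simp add: punctured_def)
      note P = P_factors_eq[OF _ this punctured_islimpt, THEN conjunct2, rule_format]
      have "derivative_jet (0 + 2 * length [1..<Suc n]) punctured (H k)"
        unfolding derivative_jet_def by (auto simp: punctured_def simp del: upt_Suc intro!: jet(2))
      then have "foldr (\<lambda>j. P_factor punctured (Suc k) (a j)) [1..<Suc n] (U (Suc k)) y = ?op (H k) 0 y"
        by (rule P) (use that in \<open>auto intro!: jet(1) simp: punctured_def\<close>)
      then have "?op (H k) 0 y = P_op n a (Suc k) (U (Suc k)) y"
        by (simp only: P_op_def punctured_def)
      also have "\<dots> = 0"
        using assms(11) that by (auto simp: solves_P_def punctured_def)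
      finally have "?op (G k) 0 y = 0"
        by (simp add: G_def[abs_def] foldr_factor_jet_scale del: upt_Suc)
      have "derivative_jet (0 + 2 * length [1..<Suc n]) punctured (G k)"
        using G2 by (simp add: decaying_jet_def del: upt_Suc)
      then have "foldr (\<lambda>j. P_factor punctured (Suc k) (a j)) [1..<Suc n] (G k 0) y = ?op (G k) 0 y"
        by (rule P) (use that in auto)
      then show ?thesis using \<open>?op (G k) 0 y = 0\<close> by (simp only:)
    qed
    \<comment> \<open>\<open>E k 0\<close> is both a coefficient of the image under \<open>L\<close>
      and the value of the one-dimensional operator on \<open>G k 0\<close>, which is zero by
      \<open>P0\<close>.\<close>
    have "\<exists>E. decaying_jet 0 punctured E
      \<and> (\<forall>z\<in>{0<..<1} \<times> punctured. foldr (\<lambda>j. L_factor ({0<..<1} \<times> punctured) (a j)) [1..<Suc n] ?u z = sine_series E 0 0 z)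
      \<and> (\<forall>k. \<forall>y\<in>punctured. foldr (\<lambda>j. P_factor punctured (Suc k) (a j)) [1..<Suc n] (G k 0) y = E k 0 y)"
      by (rule open_rect.L_factors_eq[OF _ locally_convex_at_open[OF open_punctured] _ u'])
        (use G2 in \<open>auto simp: punctured_def simp del: upt_Suc\<close>)
    then obtain E where E:
      "\<forall>z\<in>{0<..<1} \<times> punctured. foldr (\<lambda>j. L_factor ({0<..<1} \<times> punctured) (a j)) [1..<Suc n] ?u z = sine_series E 0 0 z"
      "\<forall>k. \<forall>y\<in>punctured. foldr (\<lambda>j. P_factor punctured (Suc k) (a j)) [1..<Suc n] (G k 0) y = E k 0 y"
      by (elim exE conjE)
    obtain x y where z: "z = (x, y)" "x \<in> {0<..<1}" "y \<in> punctured"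
      using \<open>z \<in> Omega_pos \<union> Omega_neg\<close> unfolding Omega_pos_neg by (elim SigmaE) blast
    have "E k 0 y = 0" for k
      using E(2)[rule_format, OF z(3), of k] P0[OF z(3), of k] by (simp only:)
    then have "sine_series E 0 0 z = 0" by (simp add: z sine_series_def)
    moreover have "L_op n a ?u z = sine_series E 0 0 z"
      unfolding L_op_def Omega_pos_neg by (rule E(1)[rule_format]) (use z in simp)
    ultimately show ?thesis by (simp only:)
  qed
  moreover have "(deriv_x (closure Omega) ^^ (2 * s)) ?u (0, y) = 0
      \<and> (deriv_x (closure Omega) ^^ (2 * s)) ?u (1, y) = 0" if "s < n" "y \<in> {-1..1}" for s y
  proof -
    have "sine_series G (2 * s) 0 (x, y) = 0" if "x = 0 \<or> x = 1" for x
    proof -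
      have "sin (freq k * x + real (2 * s) * (pi / 2)) = 0" for k
      proof -
        have "freq k * x + real (2 * s) * (pi / 2) = pi * of_int (int (if x = 0 then s else Suc k + s))"
          using that by (auto simp: freq_def algebra_simps)
        then show ?thesis by (simp only: sin_npi_int)
      qed
      then show ?thesis by (simp add: sine_series_def)
    qed
    moreover have "(deriv_x (closure Omega) ^^ (2 * s)) ?u (x, y) = sine_series G (2 * s) 0 (x, y)" if "x \<in> {0..1}" for x
      unfolding closure_Omega by (rule rect.funpow_deriv_x_eq[OF J1 u]) (use that \<open>s < n\<close> \<open>y \<in> _\<close> in auto)
    ultimately show ?thesis by simp
  qed
  moreover have "(deriv_y (closure Omega) ^^ (2 * s)) ?u (x, 1) = \<phi> s x"
    "(deriv_y (closure Omega) ^^ (2 * s)) ?u (x, -1) = \<psi> s x" if s: "s < n" and x: "x \<in> {0..1}" for s x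
  proof -
    have dy: "(deriv_y (closure Omega) ^^ (2 * s)) ?u (x, y) = sine_series G 0 (2 * s) (x, y)" if "y \<in> {-1..1}" for y
      unfolding closure_Omega by (rule rect.funpow_deriv_y_eq[OF J1 u]) (use that s x in auto)
    have abs: "summable (\<lambda>k. \<bar>sine_coeff f (Suc k)\<bar>)"
      if "summable (\<lambda>k. freq k ^ (2 * n + \<alpha>) * \<bar>sine_coeff f (Suc k)\<bar>)" for f
    proof (rule summable_comparison_test'[OF that, of 0])
      show "norm \<bar>sine_coeff f (Suc k)\<bar> \<le> freq k ^ (2 * n + \<alpha>) * \<bar>sine_coeff f (Suc k)\<bar>" for k
        using one_le_power[OF freq_ge_1[of k], of "2 * n + \<alpha>"] mult_right_mono[of 1 "freq k ^ (2 * n + \<alpha>)"] by simp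
    qed
    \<comment> \<open>The index 1 in the boundary hypothesis concerns the derivative of order
      0.\<close>
    have "\<phi> s 0 = 0" "\<phi> s 1 = 0"
      using boundary_values_zero[of "\<phi> s"] assms(9)[rule_format, OF s, of 1] by simp_all
    moreover have "continuous_on {0..1} (\<phi> s)" using Ck_on_continuous[OF Cphi(1)[OF s], of 0] by simp
    ultimately have e1: "(\<lambda>k. sin (freq k * x) * (sqrt 2 * sine_coeff (\<phi> s) (Suc k))) sums \<phi> s x"
      by (intro sine_series_expansion abs weighted(1) s x)
    then show "(deriv_y (closure Omega) ^^ (2 * s)) ?u (x, 1) = \<phi> s x"
      using dy[of 1] jet(4)[OF s] sums_unique[OF e1] by (simp add: sine_series_def G_def)
    have "\<psi> s 0 = 0" "\<psi> s 1 = 0"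
      using boundary_values_zero[of "\<psi> s"] assms(10)[rule_format, OF s, of 1] by simp_all
    moreover have "continuous_on {0..1} (\<psi> s)" using Ck_on_continuous[OF Cphi(2)[OF s], of 0] by simp
    ultimately have e2: "(\<lambda>k. sin (freq k * x) * (sqrt 2 * sine_coeff (\<psi> s) (Suc k))) sums \<psi> s x"
      by (intro sine_series_expansion abs weighted(2) s x)
    then show "(deriv_y (closure Omega) ^^ (2 * s)) ?u (x, -1) = \<psi> s x"
      using dy[of "-1"] jet(5)[OF s] sums_unique[OF e2] by (simp add: sine_series_def G_def)
  qed
  ultimately have "classical_solution n a \<phi> \<psi> ?u"
    unfolding classical_solution_def by blast
  moreover have "\<forall>(x, y)\<in>closure Omega. summable (\<lambda>k. U (Suc k) y * sin (pi * real (Suc k) * x))"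
    using sums_summable[OF sums] unfolding closure_Omega by auto
  ultimately show ?thesis by blast
qed

end
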